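(* Let $\mathcal{A}$ be a monoidal category and let $P\colon\mathcal{E}\to\mathcal{A}$ be a monoidal opfibration, given by the monoidal Grothendieck construction of a weakly lax monoidal pseudofunctor $F\colon\mathcal{A}\to\mathbf{Cat}$. Then the induced functor between categories of internal monoids $\mathrm{Mon}(P)\colon\mathrm{Mon}(\mathcal{E})\to\mathrm{Mon}(\mathcal{A})$ is the Grothendieck construction of the pseudofunctor \[\mathrm{Mon}(\mathcal{A})\xrightarrow{\ \widehat{F}\ }\mathbf{MonCat}\xrightarrow{\ \mathrm{Mon}(-)\ }\mathbf{Cat}.\]
   Context: $\mathbf{Cat}$ is monoidal via the cartesian product. $\mathbf{MonCat}$ is the 2-category of monoidal categories, strong monoidal functors and monoidal natural transformations. $\mathrm{Mon}(\mathcal{M})$ is the category of internal monoids in a monoidal category $\mathcal{M}$ and monoid morphisms; $\mathrm{Mon}(-)\colon\mathbf{MonCat}\to\mathbf{Cat}$ is the resulting 2-functor. A weakly lax monoidal pseudofunctor $F\colon\mathcal{A}\to\mathbf{Cat}$ is a pseudofunctor together with a pseudonatural transformation with components $\phi^F_{A,B}\colon F(A)\times F(B)\to F(A\otimes B)$, a functor $\iota^F\colon\mathbf{1}\to F(I)$, and invertible modifications expressing associativity and left and right unitality of $(\phi^F,\iota^F)$ (compatible with the associator and unitors of $\mathcal{A}$), satisfying the usual coherence axioms for a weak (lax) monoidal homomorphism of monoidal bicategories. The Grothendieck construction of a pseudofunctor $F\colon\mathcal{A}\to\mathbf{Cat}$ is the projection $\int F\to\mathcal{A}$, where $\int F$ has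 objects $(A,X)$ with $X\in F(A)$, and morphisms $(A,X)\to(B,Y)$ are pairs $(f,\alpha)$ with $f\colon A\to B$ and $\alpha\colon F(f)(X)\to Y$ in $F(B)$. When $F$ is weakly lax monoidal, the monoidal Grothendieck construction equips $\int F$ with the monoidal structure $(A,X)\otimes(B,Y)=(A\otimes B,\phi^F_{A,B}(X,Y))$ with unit $(I,\iota^F(\ast))$, with action on morphisms and coherence isomorphisms induced by the pseudonaturality of $\phi^F$ and the structure modifications; the projection is then a monoidal opfibration, i.e. an opfibration between monoidal categories that is a strict monoidal functor and such that the tensor product of the total category preserves opcartesian liftings. The pseudofunctor $\widehat{F}\colon\mathrm{Mon}(\mathcal{A})\to\mathbf{MonCat}$ sends a monoid $(M,m\colon M\otimes M\to M,e\colon I\to M)$ to the category $F(M)$ with tensor product $F(M)\times F(M)\xrightarrow{\phi^F_{M,M}}F(M\otimes M)\xrightarrow{F(m)}F(M)$, unit $\mathbf{1}\xrightarrow{\iota^F}F(I)\xrightarrow{F(e)}F(M)$, and associator and unitors obtained by pasting the structure modifications of $F$, the pseudonaturality isomorphisms of $\phi^F$, and the images under $F$ of the monoid axioms of $M$; it sends a monoid morphism $f$ to the functor $F(f)$ with the strong monoidal structure given by the pseudonaturality of $\phi^F$ and the pseudofunctoriality of $F$. Equivalently, viewing monoids in $\mathcal{A}$ as weakly lax monoidal pseudofunctors $\mathbf{1}\to\mathcal{A}$ and monoidal categories as weakly lax monoidal pseudofunctors $\mathbf{1}\to\mathbf{Cat}$, $\widehat{F}$ is postcomposition with $F$. "Is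 the Grothendieck construction of" is meant as a category over $\mathrm{Mon}(\mathcal{A})$, up to isomorphism over $\mathrm{Mon}(\mathcal{A})$. *)

theory Defs
  imports Main
begin

section \<open>Categories, functors, natural transformations\<close>

record ('o, 'a) cat =
  Ob :: "'o set"
  Ar :: "'a set"
  Dom :: "'a \<Rightarrow> 'o"
  Cod :: "'a \<Rightarrow> 'o"
  Idn :: "'o \<Rightarrow> 'a"
  Cmp :: "'a \<Rightarrow> 'a \<Rightarrow> 'a"  (infixr "\<cdot>\<index>" 55)

definition hom :: "('o, 'a, 'z) cat_scheme \<Rightarrow> 'o \<Rightarrow> 'o \<Rightarrow> 'a set" where
  "hom C a b = {f \<in> Ar C. Dom C f = a \<and> Cod C f = b}"

locale category =
  fixes C :: "('o, 'a, 'z) cat_scheme" (structure)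
  assumes dom_cod: "f \<in> Ar C \<Longrightarrow> Dom C f \<in> Ob C \<and> Cod C f \<in> Ob C"
    and idn_in_hom: "a \<in> Ob C \<Longrightarrow> Idn C a \<in> hom C a a"
    and cmp_in_hom: "\<lbrakk>f \<in> hom C a b; g \<in> hom C b c\<rbrakk> \<Longrightarrow> g \<cdot> f \<in> hom C a c"
    and cmp_idn_left: "f \<in> hom C a b \<Longrightarrow> Idn C b \<cdot> f = f"
    and cmp_idn_right: "f \<in> hom C a b \<Longrightarrow> f \<cdot> Idn C a = f"
    and cmp_assoc: "\<lbrakk>f \<in> hom C a b; g \<in> hom C b c; h \<in> hom C c d\<rbrakk>
      \<Longrightarrow> (h \<cdot> g) \<cdot> f = h \<cdot> (g \<cdot> f)"

definition inverse_arrows :: "('o, 'a, 'z) cat_scheme \<Rightarrow> 'a \<Rightarrow> 'a \<Rightarrow> bool" where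
  "inverse_arrows C f g \<longleftrightarrow> f \<in> Ar C \<and> g \<in> hom C (Cod C f) (Dom C f) \<and>
     g \<cdot>\<^bsub>C\<^esub> f = Idn C (Dom C f) \<and> f \<cdot>\<^bsub>C\<^esub> g = Idn C (Cod C f)"

definition iso_arrow :: "('o, 'a, 'z) cat_scheme \<Rightarrow> 'a \<Rightarrow> bool" where
  "iso_arrow C f \<longleftrightarrow> (\<exists>g. inverse_arrows C f g)"

definition inv_arrow :: "('o, 'a, 'z) cat_scheme \<Rightarrow> 'a \<Rightarrow> 'a" where
  "inv_arrow C f = (THE g. inverse_arrows C f g)"

record ('o, 'a, 'p, 'b) funct =
  obj_map :: "'o \<Rightarrow> 'p"
  arr_map :: "'a \<Rightarrow> 'b"

locale is_functor = C: category C + D: category D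
  for C :: "('o, 'a, 'z) cat_scheme" and D :: "('p, 'b, 'w) cat_scheme" +
  fixes S :: "('o, 'a, 'p, 'b, 'v) funct_scheme"
  assumes obj_map_in: "a \<in> Ob C \<Longrightarrow> obj_map S a \<in> Ob D"
    and arr_map_in: "f \<in> hom C a b \<Longrightarrow> arr_map S f \<in> hom D (obj_map S a) (obj_map S b)"
    and arr_map_idn: "a \<in> Ob C \<Longrightarrow> arr_map S (Idn C a) = Idn D (obj_map S a)"
    and arr_map_cmp: "\<lbrakk>f \<in> hom C a b; g \<in> hom C b c\<rbrakk>
      \<Longrightarrow> arr_map S (g \<cdot>\<^bsub>C\<^esub> f) = arr_map S g \<cdot>\<^bsub>D\<^esub> arr_map S f"

definition id_funct :: "('o, 'a, 'o, 'a) funct" where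
  "id_funct = \<lparr>obj_map = (\<lambda>a. a), arr_map = (\<lambda>f. f)\<rparr>"

definition comp_funct ::
  "('p, 'b, 'q, 'c, 'w) funct_scheme \<Rightarrow> ('o, 'a, 'p, 'b, 'v) funct_scheme \<Rightarrow> ('o, 'a, 'q, 'c) funct"
  (infixr "\<circ>\<^sub>F" 55) where
  "T \<circ>\<^sub>F S = \<lparr>obj_map = (\<lambda>a. obj_map T (obj_map S a)), arr_map = (\<lambda>f. arr_map T (arr_map S f))\<rparr>"

text \<open>The maps of a functor are total HOL functions, so functors out of \<open>C\<close> are compared
  only on the objects and arrows of \<open>C\<close>.\<close>

definition funct_eq_on ::
  "('o, 'a, 'z) cat_scheme \<Rightarrow> ('o, 'a, 'p, 'b, 'v) funct_scheme \<Rightarrow> ('o, 'a, 'p, 'b, 'w) funct_scheme \<Rightarrow> bool"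
  where
  "funct_eq_on C S T \<longleftrightarrow> (\<forall>a\<in>Ob C. obj_map S a = obj_map T a) \<and> (\<forall>f\<in>Ar C. arr_map S f = arr_map T f)"

definition iso_of_categories ::
  "('o, 'a, 'z) cat_scheme \<Rightarrow> ('p, 'b, 'w) cat_scheme \<Rightarrow> ('o, 'a, 'p, 'b, 'v) funct_scheme \<Rightarrow> bool"
  where
  "iso_of_categories C D S \<longleftrightarrow> is_functor C D S \<and>
     (\<exists>T :: ('p, 'b, 'o, 'a) funct. is_functor D C T \<and>
        funct_eq_on C (T \<circ>\<^sub>F S) id_funct \<and> funct_eq_on D (S \<circ>\<^sub>F T) id_funct)"

locale nat_iso = S: is_functor C D S + T: is_functor C D T
  for C :: "('o, 'a, 'z) cat_scheme" and D :: "('p, 'b, 'w) cat_scheme"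
    and S :: "('o, 'a, 'p, 'b, 'v) funct_scheme" and T :: "('o, 'a, 'p, 'b, 'u) funct_scheme" +
  fixes t :: "'o \<Rightarrow> 'b"
  assumes component: "a \<in> Ob C \<Longrightarrow> t a \<in> hom D (obj_map S a) (obj_map T a)"
    and naturality: "f \<in> hom C a b \<Longrightarrow> t b \<cdot>\<^bsub>D\<^esub> arr_map S f = arr_map T f \<cdot>\<^bsub>D\<^esub> t a"
    and component_iso: "a \<in> Ob C \<Longrightarrow> iso_arrow D (t a)"

definition prod_cat ::
  "('o, 'a, 'z) cat_scheme \<Rightarrow> ('p, 'b, 'w) cat_scheme \<Rightarrow> ('o \<times> 'p, 'a \<times> 'b) cat"
  (infixl "\<times>\<^sub>C" 60) where
  "C \<times>\<^sub>C D = \<lparr>Ob = Ob C \<times> Ob D, Ar = Ar C \<times> Ar D,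
     Dom = (\<lambda>(f, g). (Dom C f, Dom D g)), Cod = (\<lambda>(f, g). (Cod C f, Cod D g)),
     Idn = (\<lambda>(a, b). (Idn C a, Idn D b)),
     Cmp = (\<lambda>(f', g') (f, g). (f' \<cdot>\<^bsub>C\<^esub> f, g' \<cdot>\<^bsub>D\<^esub> g))\<rparr>"

definition prod_funct ::
  "('o, 'a, 'p, 'b, 'v) funct_scheme \<Rightarrow> ('o2, 'a2, 'p2, 'b2, 'w) funct_scheme
     \<Rightarrow> ('o \<times> 'o2, 'a \<times> 'a2, 'p \<times> 'p2, 'b \<times> 'b2) funct"
  (infixl "\<times>\<^sub>F" 60) where
  "S \<times>\<^sub>F T = \<lparr>obj_map = (\<lambda>(a, b). (obj_map S a, obj_map T b)),
     arr_map = (\<lambda>(f, g). (arr_map S f, arr_map T g))\<rparr>"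

definition terminal_cat :: "(unit, unit) cat" where
  "terminal_cat = \<lparr>Ob = UNIV, Ar = UNIV, Dom = (\<lambda>_. ()), Cod = (\<lambda>_. ()), Idn = (\<lambda>_. ()),
     Cmp = (\<lambda>_ _. ())\<rparr>"


section \<open>Monoidal categories and internal monoids\<close>

record ('o, 'a) moncat = "('o, 'a) cat" +
  tensor :: "('o \<times> 'o, 'a \<times> 'a, 'o, 'a) funct"
  unit_ob :: "'o"
  associator :: "'o \<Rightarrow> 'o \<Rightarrow> 'o \<Rightarrow> 'a"
  lunitor :: "'o \<Rightarrow> 'a"
  runitor :: "'o \<Rightarrow> 'a"

abbreviation tensor_ob :: "('o, 'a, 'z) moncat_scheme \<Rightarrow> 'o \<Rightarrow> 'o \<Rightarrow> 'o" (infixl "\<otimes>\<index>" 70)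
  where "a \<otimes>\<^bsub>C\<^esub> b \<equiv> obj_map (tensor C) (a, b)"

abbreviation tensor_ar :: "('o, 'a, 'z) moncat_scheme \<Rightarrow> 'a \<Rightarrow> 'a \<Rightarrow> 'a" (infixl "\<odot>\<index>" 70)
  where "f \<odot>\<^bsub>C\<^esub> g \<equiv> arr_map (tensor C) (f, g)"

locale monoidal_category = category C
  for C :: "('o, 'a, 'z) moncat_scheme" (structure) +
  assumes tensor_functor: "is_functor (C \<times>\<^sub>C C) C (tensor C)"
    and unit_ob_in: "unit_ob C \<in> Ob C"
    and associator_nat_iso: "nat_iso ((C \<times>\<^sub>C C) \<times>\<^sub>C C) C
      \<lparr>obj_map = (\<lambda>((a, b), c). (a \<otimes> b) \<otimes> c), arr_map = (\<lambda>((f, g), h). (f \<odot> g) \<odot> h)\<rparr>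
      \<lparr>obj_map = (\<lambda>((a, b), c). a \<otimes> (b \<otimes> c)), arr_map = (\<lambda>((f, g), h). f \<odot> (g \<odot> h))\<rparr>
      (\<lambda>((a, b), c). associator C a b c)"
    and lunitor_nat_iso: "nat_iso C C
      \<lparr>obj_map = (\<lambda>a. unit_ob C \<otimes> a), arr_map = (\<lambda>f. Idn C (unit_ob C) \<odot> f)\<rparr> id_funct
      (lunitor C)"
    and runitor_nat_iso: "nat_iso C C
      \<lparr>obj_map = (\<lambda>a. a \<otimes> unit_ob C), arr_map = (\<lambda>f. f \<odot> Idn C (unit_ob C))\<rparr> id_funct
      (runitor C)"
    and pentagon: "\<lbrakk>a \<in> Ob C; b \<in> Ob C; c \<in> Ob C; d \<in> Ob C\<rbrakk> \<Longrightarrow>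
      associator C a b (c \<otimes> d) \<cdot> associator C (a \<otimes> b) c d =
      (Idn C a \<odot> associator C b c d) \<cdot> associator C a (b \<otimes> c) d \<cdot> (associator C a b c \<odot> Idn C d)"
    and triangle: "\<lbrakk>a \<in> Ob C; b \<in> Ob C\<rbrakk> \<Longrightarrow>
      (Idn C a \<odot> lunitor C b) \<cdot> associator C a (unit_ob C) b = runitor C a \<odot> Idn C b"

text \<open>A monoid is a triple \<open>(M, m, e)\<close>.  As the domain and codomain of an arrow are functions of
  the arrow, a monoid morphism is a triple (source monoid, target monoid, underlying arrow); the
  arrows of the Grothendieck construction below are encoded in the same way.\<close>

type_synonym ('o, 'a) monoid = "'o \<times> 'a \<times> 'a"
type_synonym ('o, 'a) monoid_arr = "('o, 'a) monoid \<times> ('o, 'a) monoid \<times> 'a"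

fun is_monoid :: "('o, 'a, 'z) moncat_scheme \<Rightarrow> ('o, 'a) monoid \<Rightarrow> bool" where
  "is_monoid C (M, m, e) \<longleftrightarrow> M \<in> Ob C \<and> m \<in> hom C (M \<otimes>\<^bsub>C\<^esub> M) M \<and> e \<in> hom C (unit_ob C) M \<and>
     m \<cdot>\<^bsub>C\<^esub> (m \<odot>\<^bsub>C\<^esub> Idn C M) = m \<cdot>\<^bsub>C\<^esub> (Idn C M \<odot>\<^bsub>C\<^esub> m) \<cdot>\<^bsub>C\<^esub> associator C M M M \<and>
     m \<cdot>\<^bsub>C\<^esub> (e \<odot>\<^bsub>C\<^esub> Idn C M) = lunitor C M \<and>
     m \<cdot>\<^bsub>C\<^esub> (Idn C M \<odot>\<^bsub>C\<^esub> e) = runitor C M"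

fun is_monoid_morphism ::
  "('o, 'a, 'z) moncat_scheme \<Rightarrow> ('o, 'a) monoid \<Rightarrow> ('o, 'a) monoid \<Rightarrow> 'a \<Rightarrow> bool" where
  "is_monoid_morphism C (M, m, e) (N, n, d) f \<longleftrightarrow>
     f \<in> hom C M N \<and> f \<cdot>\<^bsub>C\<^esub> m = n \<cdot>\<^bsub>C\<^esub> (f \<odot>\<^bsub>C\<^esub> f) \<and> f \<cdot>\<^bsub>C\<^esub> e = d"

definition Mon :: "('o, 'a, 'z) moncat_scheme \<Rightarrow> (('o, 'a) monoid, ('o, 'a) monoid_arr) cat" where
  "Mon C = \<lparr>Ob = {x. is_monoid C x},
     Ar = {(x, y, f). is_monoid C x \<and> is_monoid C y \<and> is_monoid_morphism C x y f},
     Dom = (\<lambda>(x, y, f). x), Cod = (\<lambda>(x, y, f). y),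
     Idn = (\<lambda>x. (x, x, Idn C (fst x))),
     Cmp = (\<lambda>(_, z, g) (x, _, f). (x, z, g \<cdot>\<^bsub>C\<^esub> f))\<rparr>"

text \<open>Data of a strong monoidal functor \<open>S\<close>: \<open>smu S (a, b)\<close> goes from \<open>S a \<otimes> S b\<close> to
  \<open>S (a \<otimes> b)\<close>, and \<open>seta S\<close> from the unit to the image of the unit.\<close>

record ('o, 'a, 'p, 'b) smfunct = "('o, 'a, 'p, 'b) funct" +
  smu :: "'o \<times> 'o \<Rightarrow> 'b"
  seta :: "'b"

definition comp_smfunct ::
  "('q, 'c, 'w) cat_scheme \<Rightarrow> ('p, 'b, 'q, 'c) smfunct \<Rightarrow> ('o, 'a, 'p, 'b) smfunct
     \<Rightarrow> ('o, 'a, 'q, 'c) smfunct" where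
  "comp_smfunct D T S = funct.extend (T \<circ>\<^sub>F S) (smfunct.fields
     (\<lambda>(a, b). arr_map T (smu S (a, b)) \<cdot>\<^bsub>D\<^esub> smu T (obj_map S a, obj_map S b))
     (arr_map T (seta S) \<cdot>\<^bsub>D\<^esub> seta T))"

definition id_smfunct :: "('o, 'a, 'z) moncat_scheme \<Rightarrow> ('o, 'a, 'o, 'a) smfunct" where
  "id_smfunct C = funct.extend id_funct (smfunct.fields
     (\<lambda>(a, b). Idn C (a \<otimes>\<^bsub>C\<^esub> b)) (Idn C (unit_ob C)))"

definition Mon_ob ::
  "('p, 'b, 'w) cat_scheme \<Rightarrow> ('o, 'a, 'p, 'b) smfunct \<Rightarrow> ('o, 'a) monoid \<Rightarrow> ('p, 'b) monoid" where
  "Mon_ob D S = (\<lambda>(M, m, e).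
     (obj_map S M, arr_map S m \<cdot>\<^bsub>D\<^esub> smu S (M, M), arr_map S e \<cdot>\<^bsub>D\<^esub> seta S))"

text \<open>The action of the 2-functor \<open>Mon\<close> on strong monoidal functors with target \<open>D\<close> and on
  the components of monoidal natural transformations between them.\<close>

definition Mon_funct ::
  "('p, 'b, 'w) cat_scheme \<Rightarrow> ('o, 'a, 'p, 'b) smfunct
     \<Rightarrow> (('o, 'a) monoid, ('o, 'a) monoid_arr, ('p, 'b) monoid, ('p, 'b) monoid_arr) funct" where
  "Mon_funct D S = \<lparr>obj_map = Mon_ob D S,
     arr_map = (\<lambda>(x, y, f). (Mon_ob D S x, Mon_ob D S y, arr_map S f))\<rparr>"

definition Mon_trans ::
  "('p, 'b, 'w) cat_scheme \<Rightarrow> ('o, 'a, 'p, 'b) smfunct \<Rightarrow> ('o, 'a, 'p, 'b) smfunct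
     \<Rightarrow> ('o \<Rightarrow> 'b) \<Rightarrow> ('o, 'a) monoid \<Rightarrow> ('p, 'b) monoid_arr" where
  "Mon_trans D S T t = (\<lambda>x. (Mon_ob D S x, Mon_ob D T x, t (fst x)))"


section \<open>Pseudofunctors into Cat and the Grothendieck construction\<close>

text \<open>All fibres have their objects in one type \<open>'x\<close> and their arrows in one type \<open>'y\<close>; they
  need not be disjoint.  \<open>pcomp F g f X\<close> goes from \<open>F(g)(F(f)X)\<close> to \<open>F(g f)X\<close>, and
  \<open>punit F A X\<close> from \<open>X\<close> to \<open>F(1\<^sub>A)X\<close>.\<close>

record ('o, 'a, 'x, 'y) psfun =
  fib :: "'o \<Rightarrow> ('x, 'y) cat"
  push :: "'a \<Rightarrow> ('x, 'y, 'x, 'y) funct"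
  pcomp :: "'a \<Rightarrow> 'a \<Rightarrow> 'x \<Rightarrow> 'y"
  punit :: "'o \<Rightarrow> 'x \<Rightarrow> 'y"

abbreviation po :: "('o, 'a, 'x, 'y, 'z) psfun_scheme \<Rightarrow> 'a \<Rightarrow> 'x \<Rightarrow> 'x" where
  "po F f \<equiv> obj_map (push F f)"

abbreviation pa :: "('o, 'a, 'x, 'y, 'z) psfun_scheme \<Rightarrow> 'a \<Rightarrow> 'y \<Rightarrow> 'y" where
  "pa F f \<equiv> arr_map (push F f)"

locale pseudofunctor = B: category B
  for B :: "('o, 'a, 'w) cat_scheme" (structure) +
  fixes F :: "('o, 'a, 'x, 'y, 'z) psfun_scheme"
  assumes fib_category: "a \<in> Ob B \<Longrightarrow> category (fib F a)"
    and push_functor: "f \<in> hom B a b \<Longrightarrow> is_functor (fib F a) (fib F b) (push F f)"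
    and pcomp_nat_iso: "\<lbrakk>f \<in> hom B a b; g \<in> hom B b c\<rbrakk> \<Longrightarrow>
      nat_iso (fib F a) (fib F c) (push F g \<circ>\<^sub>F push F f) (push F (g \<cdot> f)) (pcomp F g f)"
    and punit_nat_iso: "a \<in> Ob B \<Longrightarrow>
      nat_iso (fib F a) (fib F a) id_funct (push F (Idn B a)) (punit F a)"
    and pcomp_assoc: "\<lbrakk>f \<in> hom B a b; g \<in> hom B b c; h \<in> hom B c d; X \<in> Ob (fib F a)\<rbrakk> \<Longrightarrow>
      pcomp F (h \<cdot> g) f X \<cdot>\<^bsub>fib F d\<^esub> pcomp F h g (po F f X) =
      pcomp F h (g \<cdot> f) X \<cdot>\<^bsub>fib F d\<^esub> pa F h (pcomp F g f X)"
    and pcomp_punit_right: "\<lbrakk>f \<in> hom B a b; X \<in> Ob (fib F a)\<rbrakk> \<Longrightarrow>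
      pcomp F f (Idn B a) X \<cdot>\<^bsub>fib F b\<^esub> pa F f (punit F a X) = Idn (fib F b) (po F f X)"
    and pcomp_punit_left: "\<lbrakk>f \<in> hom B a b; X \<in> Ob (fib F a)\<rbrakk> \<Longrightarrow>
      pcomp F (Idn B b) f X \<cdot>\<^bsub>fib F b\<^esub> punit F b (po F f X) = Idn (fib F b) (po F f X)"

type_synonym ('o, 'a, 'x, 'y) groth_arr = "('o \<times> 'x) \<times> ('o \<times> 'x) \<times> ('a \<times> 'y)"

definition grothendieck ::
  "('o, 'a, 'w) cat_scheme \<Rightarrow> ('o, 'a, 'x, 'y, 'z) psfun_scheme
     \<Rightarrow> ('o \<times> 'x, ('o, 'a, 'x, 'y) groth_arr) cat" where
  "grothendieck B F = \<lparr>
     Ob = {(a, X). a \<in> Ob B \<and> X \<in> Ob (fib F a)},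
     Ar = {((a, X), (b, Y), (f, u)). a \<in> Ob B \<and> X \<in> Ob (fib F a) \<and> b \<in> Ob B \<and> Y \<in> Ob (fib F b) \<and>
             f \<in> hom B a b \<and> u \<in> hom (fib F b) (po F f X) Y},
     Dom = (\<lambda>(x, y, _). x), Cod = (\<lambda>(x, y, _). y),
     Idn = (\<lambda>(a, X). ((a, X), (a, X), (Idn B a, inv_arrow (fib F a) (punit F a X)))),
     Cmp = (\<lambda>(_, (c, Z), (g, v)) ((a, X), _, (f, u)).
       ((a, X), (c, Z), (g \<cdot>\<^bsub>B\<^esub> f,
          v \<cdot>\<^bsub>fib F c\<^esub> pa F g u \<cdot>\<^bsub>fib F c\<^esub> inv_arrow (fib F c) (pcomp F g f X))))\<rparr>"

definition groth_proj :: "('o \<times> 'x, ('o, 'a, 'x, 'y) groth_arr, 'o, 'a) funct" where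
  "groth_proj = \<lparr>obj_map = (\<lambda>(a, X). a), arr_map = (\<lambda>(_, _, (f, u)). f)\<rparr>"

definition is_grothendieck_construction_of ::
  "('o, 'a, 'w) cat_scheme \<Rightarrow> ('e, 'f, 'v) cat_scheme \<Rightarrow> ('e, 'f, 'o, 'a, 'u) funct_scheme
     \<Rightarrow> ('o, 'a, 'x, 'y, 'z) psfun_scheme \<Rightarrow> bool" where
  "is_grothendieck_construction_of B E P G \<longleftrightarrow> pseudofunctor B G \<and> is_functor E B P \<and>
     (\<exists>S :: ('e, 'f, 'o \<times> 'x, ('o, 'a, 'x, 'y) groth_arr) funct.
        iso_of_categories E (grothendieck B G) S \<and> funct_eq_on E (groth_proj \<circ>\<^sub>F S) P)"


section \<open>Weakly lax monoidal pseudofunctors\<close>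

text \<open>The additional data, for \<open>f : A \<rightarrow> A'\<close> and \<open>g : B \<rightarrow> B'\<close>, writing \<open>\<phi>\<close> for \<open>lax\<close> and
  \<open>\<iota>\<close> for the object picked out by \<open>lax_unit\<close>:
  \<^item> \<open>lax_2 f g (X, Y)\<close> from \<open>\<phi>(F(f)X, F(g)Y)\<close> to \<open>F(f \<otimes> g)(\<phi>(X, Y))\<close>, the pseudonaturality
    of \<open>\<phi>\<close>;
  \<^item> \<open>lax_assoc A B C X Y Z\<close> from \<open>F(\<alpha>)(\<phi>(\<phi>(X, Y), Z))\<close> to \<open>\<phi>(X, \<phi>(Y, Z))\<close>;
  \<^item> \<open>lax_lunit A X\<close> from \<open>F(\<lambda>)(\<phi>(\<iota>, X))\<close> to \<open>X\<close>;
  \<^item> \<open>lax_runit A X\<close> from \<open>F(\<rho>)(\<phi>(X, \<iota>))\<close> to \<open>X\<close>.\<close>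

record ('o, 'a, 'x, 'y) laxpsfun = "('o, 'a, 'x, 'y) psfun" +
  lax :: "'o \<Rightarrow> 'o \<Rightarrow> ('x \<times> 'x, 'y \<times> 'y, 'x, 'y) funct"
  lax_2 :: "'a \<Rightarrow> 'a \<Rightarrow> 'x \<times> 'x \<Rightarrow> 'y"
  lax_unit :: "(unit, unit, 'x, 'y) funct"
  lax_assoc :: "'o \<Rightarrow> 'o \<Rightarrow> 'o \<Rightarrow> 'x \<Rightarrow> 'x \<Rightarrow> 'x \<Rightarrow> 'y"
  lax_lunit :: "'o \<Rightarrow> 'x \<Rightarrow> 'y"
  lax_runit :: "'o \<Rightarrow> 'x \<Rightarrow> 'y"

abbreviation lo :: "('o, 'a, 'x, 'y, 'z) laxpsfun_scheme \<Rightarrow> 'o \<Rightarrow> 'o \<Rightarrow> 'x \<Rightarrow> 'x \<Rightarrow> 'x" where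
  "lo F a b X Y \<equiv> obj_map (lax F a b) (X, Y)"

abbreviation la :: "('o, 'a, 'x, 'y, 'z) laxpsfun_scheme \<Rightarrow> 'o \<Rightarrow> 'o \<Rightarrow> 'y \<Rightarrow> 'y \<Rightarrow> 'y" where
  "la F a b u v \<equiv> arr_map (lax F a b) (u, v)"

abbreviation iota :: "('o, 'a, 'x, 'y, 'z) laxpsfun_scheme \<Rightarrow> 'x" where
  "iota F \<equiv> obj_map (lax_unit F) ()"

locale weakly_lax_monoidal_pseudofunctor = A: monoidal_category A + pseudofunctor A F
  for A :: "('o, 'a, 'w) moncat_scheme" (structure) and F :: "('o, 'a, 'x, 'y, 'z) laxpsfun_scheme" +
  assumes lax_functor: "\<lbrakk>a \<in> Ob A; b \<in> Ob A\<rbrakk> \<Longrightarrow>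
      is_functor (fib F a \<times>\<^sub>C fib F b) (fib F (a \<otimes> b)) (lax F a b)"
    and lax_unit_functor: "is_functor terminal_cat (fib F (unit_ob A)) (lax_unit F)"

    \<comment> \<open>pseudonaturality of the laxator\<close>
    and lax_2_nat_iso: "\<lbrakk>f \<in> hom A a a'; g \<in> hom A b b'\<rbrakk> \<Longrightarrow>
      nat_iso (fib F a \<times>\<^sub>C fib F b) (fib F (a' \<otimes> b'))
        (lax F a' b' \<circ>\<^sub>F (push F f \<times>\<^sub>F push F g)) (push F (f \<odot> g) \<circ>\<^sub>F lax F a b) (lax_2 F f g)"
    and lax_2_cmp:
      "\<lbrakk>f \<in> hom A a a'; f' \<in> hom A a' a''; g \<in> hom A b b'; g' \<in> hom A b' b'';
        X \<in> Ob (fib F a); Y \<in> Ob (fib F b); D = fib F (a'' \<otimes> b'')\<rbrakk> \<Longrightarrow>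
      pcomp F (f' \<odot> g') (f \<odot> g) (lo F a b X Y) \<cdot>\<^bsub>D\<^esub> pa F (f' \<odot> g') (lax_2 F f g (X, Y))
        \<cdot>\<^bsub>D\<^esub> lax_2 F f' g' (po F f X, po F g Y) =
      lax_2 F (f' \<cdot> f) (g' \<cdot> g) (X, Y) \<cdot>\<^bsub>D\<^esub> la F a'' b'' (pcomp F f' f X) (pcomp F g' g Y)"
    and lax_2_idn:
      "\<lbrakk>a \<in> Ob A; b \<in> Ob A; X \<in> Ob (fib F a); Y \<in> Ob (fib F b)\<rbrakk> \<Longrightarrow>
      lax_2 F (Idn A a) (Idn A b) (X, Y) \<cdot>\<^bsub>fib F (a \<otimes> b)\<^esub> la F a b (punit F a X) (punit F b Y) =
      punit F (a \<otimes> b) (lo F a b X Y)"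

    \<comment> \<open>the associativity modification\<close>
    and lax_assoc_nat_iso: "\<lbrakk>a \<in> Ob A; b \<in> Ob A; c \<in> Ob A\<rbrakk> \<Longrightarrow>
      nat_iso ((fib F a \<times>\<^sub>C fib F b) \<times>\<^sub>C fib F c) (fib F (a \<otimes> (b \<otimes> c)))
        \<lparr>obj_map = (\<lambda>((X, Y), Z). po F (associator A a b c) (lo F (a \<otimes> b) c (lo F a b X Y) Z)),
         arr_map = (\<lambda>((u, v), w). pa F (associator A a b c) (la F (a \<otimes> b) c (la F a b u v) w))\<rparr>
        \<lparr>obj_map = (\<lambda>((X, Y), Z). lo F a (b \<otimes> c) X (lo F b c Y Z)),
         arr_map = (\<lambda>((u, v), w). la F a (b \<otimes> c) u (la F b c v w))\<rparr>
        (\<lambda>((X, Y), Z). lax_assoc F a b c X Y Z)"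
    and lax_assoc_modification:
      "\<lbrakk>f \<in> hom A a a'; g \<in> hom A b b'; h \<in> hom A c c';
        X \<in> Ob (fib F a); Y \<in> Ob (fib F b); Z \<in> Ob (fib F c);
        D = fib F (a' \<otimes> (b' \<otimes> c')); L = lo F (a \<otimes> b) c (lo F a b X Y) Z\<rbrakk> \<Longrightarrow>
      lax_2 F f (g \<odot> h) (X, lo F b c Y Z)
        \<cdot>\<^bsub>D\<^esub> la F a' (b' \<otimes> c') (Idn (fib F a') (po F f X)) (lax_2 F g h (Y, Z))
        \<cdot>\<^bsub>D\<^esub> lax_assoc F a' b' c' (po F f X) (po F g Y) (po F h Z) =
      pa F (f \<odot> (g \<odot> h)) (lax_assoc F a b c X Y Z)
        \<cdot>\<^bsub>D\<^esub> inv_arrow D (pcomp F (f \<odot> (g \<odot> h)) (associator A a b c) L)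
        \<cdot>\<^bsub>D\<^esub> pcomp F (associator A a' b' c') ((f \<odot> g) \<odot> h) L
        \<cdot>\<^bsub>D\<^esub> pa F (associator A a' b' c') (lax_2 F (f \<odot> g) h (lo F a b X Y, Z))
        \<cdot>\<^bsub>D\<^esub> pa F (associator A a' b' c')
            (la F (a' \<otimes> b') c' (lax_2 F f g (X, Y)) (Idn (fib F c') (po F h Z)))"

    \<comment> \<open>the unit modifications\<close>
    and lax_lunit_nat_iso: "a \<in> Ob A \<Longrightarrow> nat_iso (fib F a) (fib F a)
        \<lparr>obj_map = (\<lambda>X. po F (lunitor A a) (lo F (unit_ob A) a (iota F) X)),
         arr_map = (\<lambda>u. pa F (lunitor A a)
           (la F (unit_ob A) a (Idn (fib F (unit_ob A)) (iota F)) u))\<rparr>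
        id_funct (lax_lunit F a)"
    and lax_lunit_modification:
      "\<lbrakk>f \<in> hom A a b; X \<in> Ob (fib F a); D = fib F b; i = unit_ob A;
        L = lo F i a (iota F) X\<rbrakk> \<Longrightarrow>
      lax_lunit F b (po F f X) =
      pa F f (lax_lunit F a X)
        \<cdot>\<^bsub>D\<^esub> inv_arrow D (pcomp F f (lunitor A a) L)
        \<cdot>\<^bsub>D\<^esub> pcomp F (lunitor A b) (Idn A i \<odot> f) L
        \<cdot>\<^bsub>D\<^esub> pa F (lunitor A b) (lax_2 F (Idn A i) f (iota F, X))
        \<cdot>\<^bsub>D\<^esub> pa F (lunitor A b) (la F i b (punit F i (iota F)) (Idn D (po F f X)))"
    and lax_runit_nat_iso: "a \<in> Ob A \<Longrightarrow> nat_iso (fib F a) (fib F a)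
        \<lparr>obj_map = (\<lambda>X. po F (runitor A a) (lo F a (unit_ob A) X (iota F))),
         arr_map = (\<lambda>u. pa F (runitor A a)
           (la F a (unit_ob A) u (Idn (fib F (unit_ob A)) (iota F))))\<rparr>
        id_funct (lax_runit F a)"
    and lax_runit_modification:
      "\<lbrakk>f \<in> hom A a b; X \<in> Ob (fib F a); D = fib F b; i = unit_ob A;
        L = lo F a i X (iota F)\<rbrakk> \<Longrightarrow>
      lax_runit F b (po F f X) =
      pa F f (lax_runit F a X)
        \<cdot>\<^bsub>D\<^esub> inv_arrow D (pcomp F f (runitor A a) L)
        \<cdot>\<^bsub>D\<^esub> pcomp F (runitor A b) (f \<odot> Idn A i) L
        \<cdot>\<^bsub>D\<^esub> pa F (runitor A b) (lax_2 F f (Idn A i) (X, iota F))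
        \<cdot>\<^bsub>D\<^esub> pa F (runitor A b) (la F b i (Idn D (po F f X)) (punit F i (iota F)))"

    \<comment> \<open>coherence: the two pastings of \<open>lax_assoc\<close> over the two sides of the pentagon agree\<close>
    and lax_pentagon:
      "\<lbrakk>a \<in> Ob A; b \<in> Ob A; c \<in> Ob A; d \<in> Ob A; W \<in> Ob (fib F a); X \<in> Ob (fib F b);
        Y \<in> Ob (fib F c); Z \<in> Ob (fib F d); D = fib F (a \<otimes> (b \<otimes> (c \<otimes> d)));
        p = associator A a b (c \<otimes> d); q = associator A (a \<otimes> b) c d;
        r = Idn A a \<odot> associator A b c d; s = associator A a (b \<otimes> c) d;
        t = associator A a b c \<odot> Idn A d;
        L = lo F ((a \<otimes> b) \<otimes> c) d (lo F (a \<otimes> b) c (lo F a b W X) Y) Z\<rbrakk> \<Longrightarrow>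
      lax_assoc F a b (c \<otimes> d) W X (lo F c d Y Z)
        \<cdot>\<^bsub>D\<^esub> pa F p (lax_assoc F (a \<otimes> b) c d (lo F a b W X) Y Z)
        \<cdot>\<^bsub>D\<^esub> inv_arrow D (pcomp F p q L) =
      la F a (b \<otimes> (c \<otimes> d)) (inv_arrow (fib F a) (punit F a W)) (lax_assoc F b c d X Y Z)
        \<cdot>\<^bsub>D\<^esub> inv_arrow D
            (lax_2 F (Idn A a) (associator A b c d) (W, lo F (b \<otimes> c) d (lo F b c X Y) Z))
        \<cdot>\<^bsub>D\<^esub> pa F r (lax_assoc F a (b \<otimes> c) d W (lo F b c X Y) Z)
        \<cdot>\<^bsub>D\<^esub> pa F r (pa F s (la F (a \<otimes> (b \<otimes> c)) d
              (lax_assoc F a b c W X Y) (inv_arrow (fib F d) (punit F d Z))))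
        \<cdot>\<^bsub>D\<^esub> pa F r (pa F s (inv_arrow (fib F ((a \<otimes> (b \<otimes> c)) \<otimes> d))
              (lax_2 F (associator A a b c) (Idn A d) (lo F (a \<otimes> b) c (lo F a b W X) Y, Z))))
        \<cdot>\<^bsub>D\<^esub> pa F r (inv_arrow (fib F (a \<otimes> ((b \<otimes> c) \<otimes> d))) (pcomp F s t L))
        \<cdot>\<^bsub>D\<^esub> inv_arrow D (pcomp F r (s \<cdot> t) L)"

    \<comment> \<open>coherence: the same for the triangle\<close>
    and lax_triangle:
      "\<lbrakk>a \<in> Ob A; b \<in> Ob A; X \<in> Ob (fib F a); Y \<in> Ob (fib F b); D = fib F (a \<otimes> b);
        i = unit_ob A; p = Idn A a \<odot> lunitor A b;
        L = lo F (a \<otimes> i) b (lo F a i X (iota F)) Y\<rbrakk> \<Longrightarrow>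
      la F a b (inv_arrow (fib F a) (punit F a X)) (lax_lunit F b Y)
        \<cdot>\<^bsub>D\<^esub> inv_arrow D (lax_2 F (Idn A a) (lunitor A b) (X, lo F i b (iota F) Y))
        \<cdot>\<^bsub>D\<^esub> pa F p (lax_assoc F a i b X (iota F) Y)
        \<cdot>\<^bsub>D\<^esub> inv_arrow D (pcomp F p (associator A a i b) L) =
      la F a b (lax_runit F a X) (inv_arrow (fib F b) (punit F b Y))
        \<cdot>\<^bsub>D\<^esub> inv_arrow D (lax_2 F (runitor A a) (Idn A b) (lo F a i X (iota F), Y))"


section \<open>The monoidal Grothendieck construction\<close>

definition monoidal_grothendieck ::
  "('o, 'a, 'w) moncat_scheme \<Rightarrow> ('o, 'a, 'x, 'y, 'z) laxpsfun_scheme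
     \<Rightarrow> ('o \<times> 'x, ('o, 'a, 'x, 'y) groth_arr) moncat" where
  "monoidal_grothendieck A F =
     (let t = (\<lambda>((a, X), (b, Y)). (a \<otimes>\<^bsub>A\<^esub> b, lo F a b X Y)); i = (unit_ob A, iota F) in
      cat.extend (grothendieck A F) (moncat.fields
        \<lparr>obj_map = t,
         arr_map = (\<lambda>(((a, X), (a', X'), (f, u)), ((b, Y), (b', Y'), (g, v))).
           (t ((a, X), (b, Y)), t ((a', X'), (b', Y')),
            (f \<odot>\<^bsub>A\<^esub> g, la F a' b' u v \<cdot>\<^bsub>fib F (a' \<otimes>\<^bsub>A\<^esub> b')\<^esub>
               inv_arrow (fib F (a' \<otimes>\<^bsub>A\<^esub> b')) (lax_2 F f g (X, Y)))))\<rparr>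
        i
        (\<lambda>(a, X) (b, Y) (c, Z). (t (t ((a, X), (b, Y)), (c, Z)), t ((a, X), t ((b, Y), (c, Z))),
           (associator A a b c, lax_assoc F a b c X Y Z)))
        (\<lambda>(a, X). (t (i, (a, X)), (a, X), (lunitor A a, lax_lunit F a X)))
        (\<lambda>(a, X). (t ((a, X), i), (a, X), (runitor A a, lax_runit F a X)))))"

text \<open>The projection to \<open>A\<close> is strict monoidal: its structure arrows are identities.\<close>

definition monoidal_groth_proj ::
  "('o, 'a, 'w) moncat_scheme \<Rightarrow> ('o \<times> 'x, ('o, 'a, 'x, 'y) groth_arr, 'o, 'a) smfunct" where
  "monoidal_groth_proj A = funct.extend groth_proj (smfunct.fields
     (\<lambda>((a, X), (b, Y)). Idn A (a \<otimes>\<^bsub>A\<^esub> b)) (Idn A (unit_ob A)))"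


section \<open>The induced pseudofunctor from monoids to monoidal categories\<close>

text \<open>Data of a pseudofunctor into MonCat: monoidal categories, strong monoidal functors, and
  the components of the monoidal natural isomorphisms \<open>mpcomp\<close> and \<open>mpunit\<close>, directed like
  \<open>pcomp\<close> and \<open>punit\<close>.\<close>

record ('o, 'a, 'x, 'y) moncat_psfun =
  mfib :: "'o \<Rightarrow> ('x, 'y) moncat"
  mpush :: "'a \<Rightarrow> ('x, 'y, 'x, 'y) smfunct"
  mpcomp :: "'a \<Rightarrow> 'a \<Rightarrow> 'x \<Rightarrow> 'y"
  mpunit :: "'o \<Rightarrow> 'x \<Rightarrow> 'y"

text \<open>Composition of a pseudofunctor on \<open>B\<close> with the (strict) 2-functor \<open>Mon\<close>.\<close>

definition Mon_after ::
  "('o, 'a, 'w) cat_scheme \<Rightarrow> ('o, 'a, 'x, 'y) moncat_psfun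
     \<Rightarrow> ('o, 'a, ('x, 'y) monoid, ('x, 'y) monoid_arr) psfun" where
  "Mon_after B H = \<lparr>
     fib = (\<lambda>a. Mon (mfib H a)),
     push = (\<lambda>f. Mon_funct (mfib H (Cod B f)) (mpush H f)),
     pcomp = (\<lambda>g f. Mon_trans (mfib H (Cod B g))
       (comp_smfunct (mfib H (Cod B g)) (mpush H g) (mpush H f)) (mpush H (g \<cdot>\<^bsub>B\<^esub> f)) (mpcomp H g f)),
     punit = (\<lambda>a. Mon_trans (mfib H a)
       (id_smfunct (mfib H a)) (mpush H (Idn B a)) (mpunit H a))\<rparr>"

text \<open>The associator from \<open>(X \<otimes> Y) \<otimes> Z = F(m)(\<phi>(F(m)(\<phi>(X, Y)), Z))\<close> to
  \<open>X \<otimes> (Y \<otimes> Z)\<close> passes through the objects (read the definition from bottom to top)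
  \<open>F(m)(\<phi>(F(m)(\<phi>(X, Y)), F(1)Z))\<close>,
  \<open>F(m)F(m \<otimes> 1)(\<phi>(\<phi>(X, Y), Z))\<close>,
  \<open>F(m (m \<otimes> 1))(\<phi>(\<phi>(X, Y), Z)) = F((m (1 \<otimes> m)) \<alpha>)(\<phi>(\<phi>(X, Y), Z))\<close>,
  \<open>F(m (1 \<otimes> m))F(\<alpha>)(\<phi>(\<phi>(X, Y), Z))\<close>,
  \<open>F(m (1 \<otimes> m))(\<phi>(X, \<phi>(Y, Z)))\<close>,
  \<open>F(m)F(1 \<otimes> m)(\<phi>(X, \<phi>(Y, Z)))\<close> and
  \<open>F(m)(\<phi>(F(1)X, F(m)(\<phi>(Y, Z))))\<close>.
  The unitors are analogous.\<close>

definition hat_ob ::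
  "('o, 'a, 'w) moncat_scheme \<Rightarrow> ('o, 'a, 'x, 'y, 'z) laxpsfun_scheme \<Rightarrow> ('o, 'a) monoid
     \<Rightarrow> ('x, 'y) moncat" where
  "hat_ob A F = (\<lambda>(M, m, e).
     (let D = fib F M; D2 = fib F (M \<otimes>\<^bsub>A\<^esub> M); one = Idn A M; i = unit_ob A;
          al = associator A M M M; n = m \<cdot>\<^bsub>A\<^esub> (one \<odot>\<^bsub>A\<^esub> m);
          t = (\<lambda>(X, Y). po F m (lo F M M X Y)) in
      cat.extend D (moncat.fields
        \<lparr>obj_map = t, arr_map = (\<lambda>(u, v). pa F m (la F M M u v))\<rparr>
        (po F e (iota F))
        (\<lambda>X Y Z.
           let L = lo F (M \<otimes>\<^bsub>A\<^esub> M) M (lo F M M X Y) Z;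
               R = lo F M (M \<otimes>\<^bsub>A\<^esub> M) X (lo F M M Y Z) in
           pa F m (la F M M (inv_arrow D (punit F M X)) (Idn D (t (Y, Z))))
           \<cdot>\<^bsub>D\<^esub> pa F m (inv_arrow D2 (lax_2 F one m (X, lo F M M Y Z)))
           \<cdot>\<^bsub>D\<^esub> inv_arrow D (pcomp F m (one \<odot>\<^bsub>A\<^esub> m) R)
           \<cdot>\<^bsub>D\<^esub> pa F n (lax_assoc F M M M X Y Z)
           \<cdot>\<^bsub>D\<^esub> inv_arrow D (pcomp F n al L)
           \<cdot>\<^bsub>D\<^esub> pcomp F m (m \<odot>\<^bsub>A\<^esub> one) L
           \<cdot>\<^bsub>D\<^esub> pa F m (lax_2 F m one (lo F M M X Y, Z))
           \<cdot>\<^bsub>D\<^esub> pa F m (la F M M (Idn D (t (X, Y))) (punit F M Z)))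
        (\<lambda>X. lax_lunit F M X
           \<cdot>\<^bsub>D\<^esub> pcomp F m (e \<odot>\<^bsub>A\<^esub> one) (lo F i M (iota F) X)
           \<cdot>\<^bsub>D\<^esub> pa F m (lax_2 F e one (iota F, X))
           \<cdot>\<^bsub>D\<^esub> pa F m (la F M M (Idn D (po F e (iota F))) (punit F M X)))
        (\<lambda>X. lax_runit F M X
           \<cdot>\<^bsub>D\<^esub> pcomp F m (one \<odot>\<^bsub>A\<^esub> e) (lo F M i X (iota F))
           \<cdot>\<^bsub>D\<^esub> pa F m (lax_2 F one e (X, iota F))
           \<cdot>\<^bsub>D\<^esub> pa F m (la F M M (punit F M X) (Idn D (po F e (iota F))))))))"

text \<open>For \<open>f : (M, m, e) \<rightarrow> (N, n, d)\<close> the structure arrow at \<open>(X, Y)\<close> is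
  \<open>F(n)(\<phi>(F(f)X, F(f)Y)) \<rightarrow> F(n)F(f \<otimes> f)(\<phi>(X, Y)) \<rightarrow> F(n (f \<otimes> f))(\<phi>(X, Y)) = F(f m)(\<phi>(X, Y))
  \<rightarrow> F(f)F(m)(\<phi>(X, Y))\<close>, and the one for the units is
  \<open>F(d)\<iota> = F(f e)\<iota> \<rightarrow> F(f)F(e)\<iota>\<close>.\<close>

definition hat_ar ::
  "('o, 'a, 'w) moncat_scheme \<Rightarrow> ('o, 'a, 'x, 'y, 'z) laxpsfun_scheme \<Rightarrow> ('o, 'a) monoid_arr
     \<Rightarrow> ('x, 'y, 'x, 'y) smfunct" where
  "hat_ar A F = (\<lambda>((M, m, e), (N, n, d), f).
     (let D = fib F N in
      funct.extend (push F f) (smfunct.fields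
        (\<lambda>(X, Y). inv_arrow D (pcomp F f m (lo F M M X Y))
           \<cdot>\<^bsub>D\<^esub> pcomp F n (f \<odot>\<^bsub>A\<^esub> f) (lo F M M X Y)
           \<cdot>\<^bsub>D\<^esub> pa F n (lax_2 F f f (X, Y)))
        (inv_arrow D (pcomp F f e (iota F))))))"

definition hat ::
  "('o, 'a, 'w) moncat_scheme \<Rightarrow> ('o, 'a, 'x, 'y, 'z) laxpsfun_scheme
     \<Rightarrow> (('o, 'a) monoid, ('o, 'a) monoid_arr, 'x, 'y) moncat_psfun" where
  "hat A F = \<lparr>mfib = hat_ob A F, mpush = hat_ar A F,
     mpcomp = (\<lambda>(_, _, g) (_, _, f). pcomp F g f), mpunit = (\<lambda>x. punit F (fst x))\<rparr>"

end

theory Submission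
  imports Defs
begin

text \<open>Every arrow of the total category \<open>E\<close> factors as an opcartesian lift \<open>lift f X\<close> followed by a
  vertical arrow \<open>ver b u\<close>, and the axioms of \<open>F\<close> say how these two kinds of arrows compose and
  tensor.  Both associativity composites of a monoid in \<open>E\<close> over \<open>(M, m, e)\<close> are vertical arrows
  following the same opcartesian arrow, so the monoid axioms in \<open>E\<close> compare the vertical parts only,
  and the comparison is the monoid axiom of the fibre \<open>F(M)\<close> with its \<open>hat\<close> structure.  The same
  argument matches the morphisms.  As the tensor product preserves opcartesian arrows, a monoid
  structure is transported along an opcartesian lift by cancellation; this replaces
  the coherence calculations in the fibres that would show \<open>hat\<close> to be a pseudofunctor.\<close>

section \<open>Categories, functors and internal monoids\<close>

text \<open>A multiplication on \<open>(M, X)\<close> in the total category, lying over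
  \<open>m\<close>, has a fibre component from \<open>F(m)(\<phi>(X, X))\<close> to
  \<open>X\<close>, and a unit over \<open>e\<close> has one from \<open>F(e)\<iota>\<close> to
  \<open>X\<close>. These are verbatim the types of a multiplication and a unit in
  \<open>hat_ob A F (M, m, e)\<close>. This is why the comparison is an isomorphism of categories
  and not merely an equivalence: it rearranges tuples, and the mathematical content is that the two
  lists of axioms agree. The obstacle is that lifts neither compose nor tensor strictly. The
  isomorphisms \<open>punit\<close>, \<open>pcomp\<close> and \<open>lax_2\<close> measure the
  failure, and the structure isomorphisms of \<open>hat\<close> are pastings of these corrections
  with \<open>lax_assoc\<close>, \<open>lax_lunit\<close> and \<open>lax_runit\<close>. A second
  constraint is that an opcartesian arrow cancels only between arrows with the same image in the
  base. The equations of base arrows are supplied by the monoid axioms and morphism conditions in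
  \<open>A\<close>; between vertical arrows over one object they hold trivially.\<close>

lemma hom_iff: "f \<in> hom C a b \<longleftrightarrow> f \<in> Ar C \<and> Dom C f = a \<and> Cod C f = b"
  by (simp add: hom_def)

context category
begin

lemma dom_in [simp]: "f \<in> Ar C \<Longrightarrow> Dom C f \<in> Ob C"
  and cod_in [simp]: "f \<in> Ar C \<Longrightarrow> Cod C f \<in> Ob C"
  using dom_cod by auto

lemma idn_ar [simp]: "a \<in> Ob C \<Longrightarrow> Idn C a \<in> Ar C"
  and dom_idn [simp]: "a \<in> Ob C \<Longrightarrow> Dom C (Idn C a) = a"
  and cod_idn [simp]: "a \<in> Ob C \<Longrightarrow> Cod C (Idn C a) = a"
  using idn_in_hom by (auto simp: hom_iff)

lemma cmp_ar [simp]: "\<lbrakk>f \<in> Ar C; g \<in> Ar C; Dom C g = Cod C f\<rbrakk> \<Longrightarrow> g \<cdot> f \<in> Ar C"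
  and dom_cmp [simp]: "\<lbrakk>f \<in> Ar C; g \<in> Ar C; Dom C g = Cod C f\<rbrakk> \<Longrightarrow> Dom C (g \<cdot> f) = Dom C f"
  and cod_cmp [simp]: "\<lbrakk>f \<in> Ar C; g \<in> Ar C; Dom C g = Cod C f\<rbrakk> \<Longrightarrow> Cod C (g \<cdot> f) = Cod C g"
  using cmp_in_hom[of f _ _ g] by (auto simp: hom_iff)

lemma idl [simp]: "\<lbrakk>f \<in> Ar C; Cod C f = b\<rbrakk> \<Longrightarrow> Idn C b \<cdot> f = f"
  and idr [simp]: "\<lbrakk>f \<in> Ar C; Dom C f = a\<rbrakk> \<Longrightarrow> f \<cdot> Idn C a = f"
  using cmp_idn_left cmp_idn_right by (auto simp: hom_iff)

lemma assoc [simp]: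
  "\<lbrakk>f \<in> Ar C; g \<in> Ar C; h \<in> Ar C; Dom C g = Cod C f; Dom C h = Cod C g\<rbrakk>
    \<Longrightarrow> (h \<cdot> g) \<cdot> f = h \<cdot> (g \<cdot> f)"
  using cmp_assoc[of f _ _ g _ h] by (auto simp: hom_iff)

text \<open>With composites normalised to the right, a product \<open>g \<cdot> f\<close> inside a
  longer composite is no longer a subterm. This carries an equation for it over to a composite with
  a tail \<open>x\<close>.\<close>

lemma cmp_tail:
  "\<lbrakk>g \<cdot> f = k; f \<in> Ar C; g \<in> Ar C; x \<in> Ar C; Dom C g = Cod C f; Dom C f = Cod C x\<rbrakk>
    \<Longrightarrow> g \<cdot> (f \<cdot> x) = k \<cdot> x"
  using assoc[of x f g] by simp

lemma inverse_unique:
  assumes "inverse_arrows C f g" "inverse_arrows C f h"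
  shows "g = h"
proof -
  have "g = g \<cdot> (f \<cdot> h)" using assms by (auto simp: inverse_arrows_def hom_iff)
  also have "\<dots> = (g \<cdot> f) \<cdot> h"
    using assms by (intro assoc[symmetric]) (auto simp: inverse_arrows_def hom_iff)
  also have "\<dots> = h" using assms by (auto simp: inverse_arrows_def hom_iff)
  finally show ?thesis .
qed

lemma inv_eqI: "inverse_arrows C f g \<Longrightarrow> inv_arrow C f = g"
  unfolding inv_arrow_def using inverse_unique by blast

lemma inv_inverse: "iso_arrow C f \<Longrightarrow> inverse_arrows C f (inv_arrow C f)"
  unfolding iso_arrow_def using inv_eqI by auto

lemma iso_ar: "iso_arrow C f \<Longrightarrow> f \<in> Ar C"
  by (auto simp: iso_arrow_def inverse_arrows_def)

lemma inv_ar [simp]: "iso_arrow C f \<Longrightarrow> inv_arrow C f \<in> Ar C"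
  and dom_inv [simp]: "iso_arrow C f \<Longrightarrow> Dom C (inv_arrow C f) = Cod C f"
  and cod_inv [simp]: "iso_arrow C f \<Longrightarrow> Cod C (inv_arrow C f) = Dom C f"
  and inv_cmp [simp]: "iso_arrow C f \<Longrightarrow> inv_arrow C f \<cdot> f = Idn C (Dom C f)"
  and cmp_inv [simp]: "iso_arrow C f \<Longrightarrow> f \<cdot> inv_arrow C f = Idn C (Cod C f)"
  using inv_inverse[of f] by (auto simp: inverse_arrows_def hom_iff)

lemma inverse_sym: "inverse_arrows C f g \<Longrightarrow> inverse_arrows C g f"
  by (auto simp: inverse_arrows_def hom_iff)

lemma iso_inv [simp]: "iso_arrow C f \<Longrightarrow> iso_arrow C (inv_arrow C f)"
  unfolding iso_arrow_def[of C "inv_arrow C f"] using inverse_sym inv_inverse by blast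

lemma inv_cmp_tail [simp]:
  "\<lbrakk>iso_arrow C f; x \<in> Ar C; Cod C x = Dom C f\<rbrakk> \<Longrightarrow> inv_arrow C f \<cdot> (f \<cdot> x) = x"
  using cmp_tail[OF inv_cmp] iso_ar by simp

lemma cmp_inv_tail [simp]:
  "\<lbrakk>iso_arrow C f; x \<in> Ar C; Cod C x = Cod C f\<rbrakk> \<Longrightarrow> f \<cdot> (inv_arrow C f \<cdot> x) = x"
  using cmp_tail[OF cmp_inv] iso_ar by simp

lemma inverse_cmp:
  assumes "iso_arrow C f" "iso_arrow C g" "Dom C g = Cod C f"
  shows "inverse_arrows C (g \<cdot> f) (inv_arrow C f \<cdot> inv_arrow C g)"
  using assms by (simp add: inverse_arrows_def hom_iff iso_ar)

lemma iso_cmp [simp]: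
  "\<lbrakk>iso_arrow C f; iso_arrow C g; Dom C g = Cod C f\<rbrakk> \<Longrightarrow> iso_arrow C (g \<cdot> f)"
  unfolding iso_arrow_def[of C "g \<cdot> f"] using inverse_cmp by blast

lemma inv_cmp_eq:
  "\<lbrakk>iso_arrow C f; iso_arrow C g; Dom C g = Cod C f\<rbrakk>
    \<Longrightarrow> inv_arrow C (g \<cdot> f) = inv_arrow C f \<cdot> inv_arrow C g"
  using inv_eqI inverse_cmp by blast

lemma inverse_idn: "a \<in> Ob C \<Longrightarrow> inverse_arrows C (Idn C a) (Idn C a)"
  by (simp add: inverse_arrows_def hom_iff)

lemma iso_idn [simp]: "a \<in> Ob C \<Longrightarrow> iso_arrow C (Idn C a)"
  using inverse_idn by (auto simp: iso_arrow_def)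

lemma inv_idn [simp]: "a \<in> Ob C \<Longrightarrow> inv_arrow C (Idn C a) = Idn C a"
  using inv_eqI inverse_idn by blast

lemma iso_cancel_right:
  assumes "v \<cdot> u = w \<cdot> u" "iso_arrow C u" "v \<in> Ar C" "w \<in> Ar C"
    "Dom C v = Cod C u" "Dom C w = Cod C u"
  shows "v = w"
proof -
  have "v = (v \<cdot> u) \<cdot> inv_arrow C u" using assms(2-) by (simp add: iso_ar)
  also have "\<dots> = (w \<cdot> u) \<cdot> inv_arrow C u" using assms(1) by simp
  also have "\<dots> = w" using assms(2-) by (simp add: iso_ar)
  finally show ?thesis .
qed

lemma iso_cancel_left:
  assumes "u \<cdot> v = u \<cdot> w" "iso_arrow C u" "v \<in> Ar C" "w \<in> Ar C"
    "Cod C v = Dom C u" "Cod C w = Dom C u"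
  shows "v = w"
  by (metis assms inv_cmp_tail)

text \<open>A commuting square is conjugated by the inverses of two parallel invertible sides. This
  yields naturality of inverse components, which the total category calls for because its
  composition and tensor product contain inverses of \<open>pcomp\<close> and
  \<open>lax_2\<close>.\<close>

lemma inv_move:
  assumes "t' \<cdot> s = s' \<cdot> t" "iso_arrow C t" "iso_arrow C t'" "s \<in> Ar C" "s' \<in> Ar C"
    "Dom C s = Dom C t" "Cod C s = Dom C t'" "Dom C s' = Cod C t" "Cod C s' = Cod C t'"
  shows "inv_arrow C t' \<cdot> s' = s \<cdot> inv_arrow C t"
proof -
  have "inv_arrow C t' \<cdot> s' = inv_arrow C t' \<cdot> ((s' \<cdot> t) \<cdot> inv_arrow C t)"
    using assms(2-) by (simp add: iso_ar)
  also have "\<dots> = inv_arrow C t' \<cdot> ((t' \<cdot> s) \<cdot> inv_arrow C t)" by (simp add: assms(1))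
  also have "\<dots> = s \<cdot> inv_arrow C t" using assms(2-) by (simp add: iso_ar)
  finally show ?thesis .
qed

end

section \<open>Functors, natural isomorphisms and products\<close>

context is_functor
begin

lemma arr_ar: "f \<in> Ar C \<Longrightarrow> arr_map S f \<in> Ar D"
  and dom_arr: "f \<in> Ar C \<Longrightarrow> Dom D (arr_map S f) = obj_map S (Dom C f)"
  and cod_arr: "f \<in> Ar C \<Longrightarrow> Cod D (arr_map S f) = obj_map S (Cod C f)"
  using arr_map_in[of f] by (auto simp: hom_iff)

lemma arr_cmp:
  "\<lbrakk>f \<in> Ar C; g \<in> Ar C; Dom C g = Cod C f\<rbrakk>
    \<Longrightarrow> arr_map S (g \<cdot>\<^bsub>C\<^esub> f) = arr_map S g \<cdot>\<^bsub>D\<^esub> arr_map S f"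
  using arr_map_cmp[of f _ _ g] by (auto simp: hom_iff)

lemma inverse_arr:
  assumes "inverse_arrows C f g"
  shows "inverse_arrows D (arr_map S f) (arr_map S g)"
  using assms by (auto simp: inverse_arrows_def hom_iff arr_ar dom_arr cod_arr
      arr_cmp[symmetric] arr_map_idn)

lemma iso_arr: "iso_arrow C f \<Longrightarrow> iso_arrow D (arr_map S f)"
  and inv_arr: "iso_arrow C f \<Longrightarrow> inv_arrow D (arr_map S f) = arr_map S (inv_arrow C f)"
  using inverse_arr[OF C.inv_inverse[of f]] D.inv_eqI by (auto simp: iso_arrow_def)

end

lemma id_is_functor: "category C \<Longrightarrow> is_functor C C id_funct"
  by (intro is_functor.intro is_functor_axioms.intro) (auto simp: id_funct_def category.idn_in_hom)

lemma comp_is_functor: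
  assumes "is_functor C D S" "is_functor D D' T"
  shows "is_functor C D' (T \<circ>\<^sub>F S)"
proof -
  interpret S: is_functor C D S by fact
  interpret T: is_functor D D' T by fact
  show ?thesis
    by unfold_locales (auto simp: comp_funct_def S.obj_map_in T.obj_map_in S.arr_map_in T.arr_map_in
        S.arr_map_idn T.arr_map_idn S.arr_map_cmp T.arr_map_cmp[OF S.arr_map_in S.arr_map_in])
qed

text \<open>Bijectivity on objects and arrows suffices: \<open>T\<close> undoes \<open>S\<close>, so
  every structure law of \<open>T\<close> is a law of \<open>S\<close> with \<open>T\<close> applied
  to both sides. This spares a separate functoriality computation for
  \<open>ungroup\<close>.\<close>

lemma inverse_is_functor:
  assumes "is_functor C D S"
    and ob: "\<And>b. b \<in> Ob D \<Longrightarrow> obj_map T b \<in> Ob C \<and> obj_map S (obj_map T b) = b"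
    and ar: "\<And>g. g \<in> Ar D \<Longrightarrow> arr_map T g \<in> Ar C \<and> arr_map S (arr_map T g) = g"
    and ob': "\<And>a. a \<in> Ob C \<Longrightarrow> obj_map T (obj_map S a) = a"
    and ar': "\<And>f. f \<in> Ar C \<Longrightarrow> arr_map T (arr_map S f) = f"
  shows "is_functor D C T"
proof -
  interpret S: is_functor C D S by fact
  have dc: "Dom C (arr_map T g) = obj_map T (Dom D g)" "Cod C (arr_map T g) = obj_map T (Cod D g)"
    if "g \<in> Ar D" for g
    using ar[OF that] S.dom_arr[of "arr_map T g"] S.cod_arr[of "arr_map T g"] ob' by auto
  show ?thesis
  proof
    show "arr_map T (Idn D b) = Idn C (obj_map T b)" if "b \<in> Ob D" for b
      using ar'[of "Idn C (obj_map T b)"] S.arr_map_idn[of "obj_map T b"] ob[OF that] by simp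
    show "arr_map T (g' \<cdot>\<^bsub>D\<^esub> g) = arr_map T g' \<cdot>\<^bsub>C\<^esub> arr_map T g"
      if "g \<in> hom D a b" "g' \<in> hom D b c" for g g' a b c
      using that ar'[of "arr_map T g' \<cdot>\<^bsub>C\<^esub> arr_map T g"] S.arr_cmp[of "arr_map T g" "arr_map T g'"]
      by (simp add: hom_iff ar dc)
  qed (use ob ar dc in \<open>auto simp: hom_iff\<close>)
qed

context nat_iso
begin

lemma component_ar: "a \<in> Ob C \<Longrightarrow> t a \<in> Ar D"
  and dom_component: "a \<in> Ob C \<Longrightarrow> Dom D (t a) = obj_map S a"
  and cod_component: "a \<in> Ob C \<Longrightarrow> Cod D (t a) = obj_map T a"
  using component by (auto simp: hom_iff)

lemma natural:
  "f \<in> Ar C \<Longrightarrow> t (Cod C f) \<cdot>\<^bsub>D\<^esub> arr_map S f = arr_map T f \<cdot>\<^bsub>D\<^esub> t (Dom C f)"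
  using naturality[of f] by (auto simp: hom_iff)

lemma inv_natural:
  "f \<in> Ar C \<Longrightarrow> inv_arrow D (t (Cod C f)) \<cdot>\<^bsub>D\<^esub> arr_map T f = arr_map S f \<cdot>\<^bsub>D\<^esub> inv_arrow D (t (Dom C f))"
  by (rule S.D.inv_move) (simp_all add: natural component_iso component_ar dom_component
      cod_component S.arr_ar T.arr_ar S.dom_arr S.cod_arr T.dom_arr T.cod_arr)

end

lemma prod_cat_sel [simp]:
  "Ob (C \<times>\<^sub>C D) = Ob C \<times> Ob D" "Ar (C \<times>\<^sub>C D) = Ar C \<times> Ar D"
  "Dom (C \<times>\<^sub>C D) (f, g) = (Dom C f, Dom D g)" "Cod (C \<times>\<^sub>C D) (f, g) = (Cod C f, Cod D g)"
  "Idn (C \<times>\<^sub>C D) (a, b) = (Idn C a, Idn D b)"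
  "Cmp (C \<times>\<^sub>C D) (f', g') (f, g) = (f' \<cdot>\<^bsub>C\<^esub> f, g' \<cdot>\<^bsub>D\<^esub> g)"
  by (simp_all add: prod_cat_def)

lemma prod_category:
  assumes "category C" "category D"
  shows "category (C \<times>\<^sub>C D)"
proof -
  interpret C: category C by fact
  interpret D: category D by fact
  show ?thesis by unfold_locales (auto simp: hom_iff)
qed

lemma inverse_prod:
  "inverse_arrows C f f' \<Longrightarrow> inverse_arrows D g g' \<Longrightarrow> inverse_arrows (C \<times>\<^sub>C D) (f, g) (f', g')"
  by (auto simp: inverse_arrows_def hom_iff)

lemma iso_prod: "iso_arrow C f \<Longrightarrow> iso_arrow D g \<Longrightarrow> iso_arrow (C \<times>\<^sub>C D) (f, g)"
  unfolding iso_arrow_def by (elim exE) (rule exI, rule inverse_prod)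

lemma inv_prod:
  assumes "category C" "category D" "iso_arrow C f" "iso_arrow D g"
  shows "inv_arrow (C \<times>\<^sub>C D) (f, g) = (inv_arrow C f, inv_arrow D g)"
  by (meson assms category.inv_eqI category.inv_inverse inverse_prod prod_category)

text \<open>Composing and inverting monoid morphisms rests on the functoriality of the tensor
  product. The locale isolates this so that the same lemmas serve \<open>A\<close>, the total
  category and the fibres with their \<open>hat\<close> structure.\<close>

locale tensor_category = category C
  for C :: "('o, 'a, 'z) moncat_scheme" (structure) +
  assumes tensor_is_functor: "is_functor (C \<times>\<^sub>C C) C (tensor C)"

sublocale monoidal_category \<subseteq> tensor_category C
  by (intro tensor_category.intro category_axioms tensor_category_axioms.intro tensor_functor)

context tensor_category
begin

interpretation tensor: is_functor "C \<times>\<^sub>C C" C "tensor C"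
  by (rule tensor_is_functor)

lemma tensor_ob [simp]: "\<lbrakk>a \<in> Ob C; b \<in> Ob C\<rbrakk> \<Longrightarrow> a \<otimes> b \<in> Ob C"
  using tensor.obj_map_in[of "(a, b)"] by simp

lemma tensor_ar [simp]: "\<lbrakk>f \<in> Ar C; g \<in> Ar C\<rbrakk> \<Longrightarrow> f \<odot> g \<in> Ar C"
  and dom_tensor [simp]: "\<lbrakk>f \<in> Ar C; g \<in> Ar C\<rbrakk> \<Longrightarrow> Dom C (f \<odot> g) = Dom C f \<otimes> Dom C g"
  and cod_tensor [simp]: "\<lbrakk>f \<in> Ar C; g \<in> Ar C\<rbrakk> \<Longrightarrow> Cod C (f \<odot> g) = Cod C f \<otimes> Cod C g"
  using tensor.arr_ar[of "(f, g)"] tensor.dom_arr[of "(f, g)"] tensor.cod_arr[of "(f, g)"] by auto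

lemma tensor_idn [simp]: "\<lbrakk>a \<in> Ob C; b \<in> Ob C\<rbrakk> \<Longrightarrow> Idn C a \<odot> Idn C b = Idn C (a \<otimes> b)"
  using tensor.arr_map_idn[of "(a, b)"] by simp

lemma tensor_cmp:
  "\<lbrakk>f \<in> Ar C; f' \<in> Ar C; g \<in> Ar C; g' \<in> Ar C; Dom C f' = Cod C f; Dom C g' = Cod C g\<rbrakk>
    \<Longrightarrow> (f' \<odot> g') \<cdot> (f \<odot> g) = (f' \<cdot> f) \<odot> (g' \<cdot> g)"
  using tensor.arr_cmp[of "(f, g)" "(f', g')"] by simp

lemma monoid_morphism_idn: "is_monoid C x \<Longrightarrow> is_monoid_morphism C x x (Idn C (fst x))"
  by (cases x) (auto simp: hom_iff)

lemma monoid_morphism_cmp: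
  assumes "is_monoid C x" "is_monoid C y" "is_monoid C z"
    "is_monoid_morphism C x y f" "is_monoid_morphism C y z g"
  shows "is_monoid_morphism C x z (g \<cdot> f)"
proof -
  obtain M m e where x: "x = (M, m, e)" by (cases x)
  obtain N n d where y: "y = (N, n, d)" by (cases y)
  obtain L l c where z: "z = (L, l, c)" by (cases z)
  note [simp] = hom_iff
  have f: "f \<in> Ar C" "Dom C f = M" "Cod C f = N" "f \<cdot> m = n \<cdot> (f \<odot> f)" "f \<cdot> e = d"
    and g: "g \<in> Ar C" "Dom C g = N" "Cod C g = L" "g \<cdot> n = l \<cdot> (g \<odot> g)" "g \<cdot> d = c"
    and m: "m \<in> Ar C" "Dom C m = M \<otimes> M" "Cod C m = M"
      "e \<in> Ar C" "Dom C e = unit_ob C" "Cod C e = M"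
    and n: "n \<in> Ar C" "Dom C n = N \<otimes> N" "Cod C n = N"
    and l: "l \<in> Ar C" "Dom C l = L \<otimes> L" "Cod C l = L"
    using assms by (auto simp: x y z)
  have "(g \<cdot> f) \<cdot> m = g \<cdot> (n \<cdot> (f \<odot> f))" using f g m by simp
  also have "\<dots> = (l \<cdot> (g \<odot> g)) \<cdot> (f \<odot> f)" using f g n by (simp flip: g(4) del: assoc add: assoc[symmetric])
  also have "\<dots> = l \<cdot> ((g \<cdot> f) \<odot> (g \<cdot> f))" using f g l by (simp add: tensor_cmp)
  finally show ?thesis using f g m by (simp add: x z)
qed

text \<open>The morphism equation of \<open>f\<close> applies once \<open>f \<odot> f\<close> and
  its inverse are inserted to the right of \<open>n\<close>. Hence an arrow of monoids is invertible
  as soon as its underlying arrow is, which later makes the components of \<open>pcomp G\<close> and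
  \<open>punit G\<close> isomorphisms.\<close>

lemma monoid_morphism_inv:
  assumes "is_monoid C x" "is_monoid C y" "is_monoid_morphism C x y f" "iso_arrow C f"
  shows "is_monoid_morphism C y x (inv_arrow C f)"
proof -
  obtain M m e where x: "x = (M, m, e)" by (cases x)
  obtain N n d where y: "y = (N, n, d)" by (cases y)
  note [simp] = hom_iff
  have f: "f \<in> Ar C" "Dom C f = M" "Cod C f = N" "f \<cdot> m = n \<cdot> (f \<odot> f)" "f \<cdot> e = d"
    and m: "m \<in> Ar C" "Dom C m = M \<otimes> M" "Cod C m = M"
      "e \<in> Ar C" "Dom C e = unit_ob C" "Cod C e = M" "M \<in> Ob C"
    and n: "n \<in> Ar C" "Dom C n = N \<otimes> N" "Cod C n = N" "N \<in> Ob C"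
    using assms by (auto simp: x y)
  let ?i = "inv_arrow C f"
  have "?i \<cdot> n = ?i \<cdot> (n \<cdot> ((f \<odot> f) \<cdot> (?i \<odot> ?i)))"
    using f m n assms(4) by (simp add: tensor_cmp)
  also have "\<dots> = ?i \<cdot> ((f \<cdot> m) \<cdot> (?i \<odot> ?i))"
    unfolding f(4) using f(1-3) m n assms(4) by simp
  also have "\<dots> = m \<cdot> (?i \<odot> ?i)" using f(1-3) m n assms(4) by simp
  finally have 1: "?i \<cdot> n = m \<cdot> (?i \<odot> ?i)" .
  have "?i \<cdot> d = e" using f m assms(4) by (simp flip: f(5))
  then show ?thesis using 1 f assms(4) by (simp add: x y)
qed

end

section \<open>The category of internal monoids\<close>

lemma Mon_sel [simp]:
  "x \<in> Ob (Mon C) \<longleftrightarrow> is_monoid C x"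
  "(x, y, f) \<in> Ar (Mon C) \<longleftrightarrow> is_monoid C x \<and> is_monoid C y \<and> is_monoid_morphism C x y f"
  "Dom (Mon C) (x, y, f) = x" "Cod (Mon C) (x, y, f) = y"
  "Idn (Mon C) x = (x, x, Idn C (fst x))"
  "Cmp (Mon C) (y', z, g) (x, y, f) = (x, z, g \<cdot>\<^bsub>C\<^esub> f)"
  by (simp_all add: Mon_def)

lemma monoid_morphism_hom: "is_monoid_morphism C x y f \<Longrightarrow> f \<in> hom C (fst x) (fst y)"
  by (cases x; cases y) auto

lemma is_monoid_fst: "is_monoid C x \<Longrightarrow> fst x \<in> Ob C"
  by (cases x) auto

text \<open>The typing part of \<open>is_monoid\<close>. It is separated from the axioms because the
  correspondence of triples in the total category with pairs of triples, and the typing of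
  pushforwards, must be available before the axioms on the two sides can be compared.\<close>

fun monoid_data :: "('o, 'a, 'z) moncat_scheme \<Rightarrow> ('o, 'a) monoid \<Rightarrow> bool" where
  "monoid_data C (M, m, e) \<longleftrightarrow>
     M \<in> Ob C \<and> m \<in> hom C (M \<otimes>\<^bsub>C\<^esub> M) M \<and> e \<in> hom C (unit_ob C) M"

lemma is_monoid_data: "is_monoid C x \<Longrightarrow> monoid_data C x"
  by (cases x) simp

context tensor_category
begin

lemma monoid_data_idn: "monoid_data C x \<Longrightarrow> is_monoid_morphism C x x (Idn C (fst x))"
  by (cases x) (auto simp: hom_iff)

lemma Mon_category: "category (Mon C)"
proof
  show "f \<in> Ar (Mon C) \<Longrightarrow> Dom (Mon C) f \<in> Ob (Mon C) \<and> Cod (Mon C) f \<in> Ob (Mon C)" for f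
    by (cases f) auto
  show "a \<in> Ob (Mon C) \<Longrightarrow> Idn (Mon C) a \<in> hom (Mon C) a a" for a
    using monoid_morphism_idn by (auto simp: hom_iff)
  show "f \<in> hom (Mon C) a b \<Longrightarrow> g \<in> hom (Mon C) b c \<Longrightarrow> g \<cdot>\<^bsub>Mon C\<^esub> f \<in> hom (Mon C) a c" for f g a b c
    by (cases f; cases g) (auto simp: hom_iff intro: monoid_morphism_cmp
        simp del: is_monoid.simps is_monoid_morphism.simps)
  show "f \<in> hom (Mon C) a b \<Longrightarrow> Idn (Mon C) b \<cdot>\<^bsub>Mon C\<^esub> f = f"
    "f \<in> hom (Mon C) a b \<Longrightarrow> f \<cdot>\<^bsub>Mon C\<^esub> Idn (Mon C) a = f" for f a b
    using monoid_morphism_hom by (cases f; fastforce simp: hom_iff)+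
  show "\<lbrakk>f \<in> hom (Mon C) a b; g \<in> hom (Mon C) b c; h \<in> hom (Mon C) c d\<rbrakk>
      \<Longrightarrow> (h \<cdot>\<^bsub>Mon C\<^esub> g) \<cdot>\<^bsub>Mon C\<^esub> f = h \<cdot>\<^bsub>Mon C\<^esub> g \<cdot>\<^bsub>Mon C\<^esub> f" for f g h a b c d
    by (cases f; cases g; cases h) (auto simp: hom_iff dest!: monoid_morphism_hom)
qed

lemma Mon_inverse:
  assumes "is_monoid C x" "is_monoid C y" "is_monoid_morphism C x y f" "iso_arrow C f"
  shows "inverse_arrows (Mon C) (x, y, f) (y, x, inv_arrow C f)"
  using assms monoid_morphism_inv[OF assms] monoid_morphism_hom[OF assms(3)]
  by (auto simp: inverse_arrows_def hom_iff)

end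

section \<open>The Grothendieck construction\<close>

context pseudofunctor
begin

text \<open>The fibres are a family of categories indexed by \<open>Ob B\<close>; each rule
  therefore carries the membership of the index as a premise.\<close>

lemmas fib_rules [simp] =
  category.dom_in[OF fib_category] category.cod_in[OF fib_category]
  category.idn_ar[OF fib_category] category.dom_idn[OF fib_category]
  category.cod_idn[OF fib_category] category.cmp_ar[OF fib_category]
  category.dom_cmp[OF fib_category] category.cod_cmp[OF fib_category]
  category.idl[OF fib_category] category.idr[OF fib_category]
  category.assoc[OF fib_category] category.inv_ar[OF fib_category]
  category.dom_inv[OF fib_category] category.cod_inv[OF fib_category]
  category.inv_cmp[OF fib_category] category.cmp_inv[OF fib_category]
  category.iso_inv[OF fib_category] category.inv_cmp_tail[OF fib_category]
  category.cmp_inv_tail[OF fib_category] category.iso_cmp[OF fib_category]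
  category.iso_idn[OF fib_category] category.inv_idn[OF fib_category]

lemma po_ob [simp]:
  "\<lbrakk>f \<in> Ar B; X \<in> Ob (fib F (Dom B f)); Cod B f = b\<rbrakk> \<Longrightarrow> po F f X \<in> Ob (fib F b)"
  using is_functor.obj_map_in[OF push_functor] by (auto simp: hom_iff)

context
  fixes f a b
  assumes f: "f \<in> Ar B" "Dom B f = a" "Cod B f = b"
begin

interpretation is_functor "fib F a" "fib F b" "push F f"
  using f by (simp add: push_functor hom_iff)

lemma pa_ar [simp]: "u \<in> Ar (fib F a) \<Longrightarrow> pa F f u \<in> Ar (fib F b)"
  and dom_pa [simp]: "u \<in> Ar (fib F a) \<Longrightarrow> Dom (fib F b) (pa F f u) = po F f (Dom (fib F a) u)"
  and cod_pa [simp]: "u \<in> Ar (fib F a) \<Longrightarrow> Cod (fib F b) (pa F f u) = po F f (Cod (fib F a) u)"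
  by (rule arr_ar dom_arr cod_arr, assumption)+

lemma pa_idn [simp]: "X \<in> Ob (fib F a) \<Longrightarrow> pa F f (Idn (fib F a) X) = Idn (fib F b) (po F f X)"
  by (rule arr_map_idn)

lemma pa_cmp:
  "\<lbrakk>u \<in> Ar (fib F a); v \<in> Ar (fib F a); Dom (fib F a) v = Cod (fib F a) u\<rbrakk>
    \<Longrightarrow> pa F f (v \<cdot>\<^bsub>fib F a\<^esub> u) = pa F f v \<cdot>\<^bsub>fib F b\<^esub> pa F f u"
  by (rule arr_cmp)

lemma iso_pa [simp]: "iso_arrow (fib F a) u \<Longrightarrow> iso_arrow (fib F b) (pa F f u)"
  and inv_pa: "iso_arrow (fib F a) u \<Longrightarrow>
    inv_arrow (fib F b) (pa F f u) = pa F f (inv_arrow (fib F a) u)"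
  by (rule iso_arr inv_arr, assumption)+

end

context
  fixes f g a c
  assumes f: "f \<in> Ar B" "Dom B f = a" and g: "g \<in> Ar B" "Dom B g = Cod B f" "Cod B g = c"
begin

interpretation nat_iso "fib F a" "fib F c" "push F g \<circ>\<^sub>F push F f" "push F (g \<cdot> f)" "pcomp F g f"
  using f g by (simp add: pcomp_nat_iso hom_iff)

lemma pcomp_ar [simp]: "X \<in> Ob (fib F a) \<Longrightarrow> pcomp F g f X \<in> Ar (fib F c)"
  and dom_pcomp [simp]: "X \<in> Ob (fib F a) \<Longrightarrow> Dom (fib F c) (pcomp F g f X) = po F g (po F f X)"
  and cod_pcomp [simp]: "X \<in> Ob (fib F a) \<Longrightarrow> Cod (fib F c) (pcomp F g f X) = po F (g \<cdot> f) X"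
  and iso_pcomp [simp]: "X \<in> Ob (fib F a) \<Longrightarrow> iso_arrow (fib F c) (pcomp F g f X)"
  using component_ar dom_component cod_component component_iso by (simp_all add: comp_funct_def)

lemma pcomp_natural:
  "\<lbrakk>u \<in> Ar (fib F a); Dom (fib F a) u = X; Cod (fib F a) u = Y\<rbrakk> \<Longrightarrow>
    pcomp F g f Y \<cdot>\<^bsub>fib F c\<^esub> pa F g (pa F f u) = pa F (g \<cdot> f) u \<cdot>\<^bsub>fib F c\<^esub> pcomp F g f X"
  using natural[of u] by (simp add: comp_funct_def)

lemma inv_pcomp_natural:
  "\<lbrakk>u \<in> Ar (fib F a); Dom (fib F a) u = X; Cod (fib F a) u = Y\<rbrakk> \<Longrightarrow>
    inv_arrow (fib F c) (pcomp F g f Y) \<cdot>\<^bsub>fib F c\<^esub> pa F (g \<cdot> f) u =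
    pa F g (pa F f u) \<cdot>\<^bsub>fib F c\<^esub> inv_arrow (fib F c) (pcomp F g f X)"
  using inv_natural[of u] by (simp add: comp_funct_def)

end

context
  fixes a
  assumes a: "a \<in> Ob B"
begin

interpretation nat_iso "fib F a" "fib F a" id_funct "push F (Idn B a)" "punit F a"
  using a by (rule punit_nat_iso)

lemma punit_ar [simp]: "X \<in> Ob (fib F a) \<Longrightarrow> punit F a X \<in> Ar (fib F a)"
  and dom_punit [simp]: "X \<in> Ob (fib F a) \<Longrightarrow> Dom (fib F a) (punit F a X) = X"
  and cod_punit [simp]: "X \<in> Ob (fib F a) \<Longrightarrow> Cod (fib F a) (punit F a X) = po F (Idn B a) X"
  and iso_punit [simp]: "X \<in> Ob (fib F a) \<Longrightarrow> iso_arrow (fib F a) (punit F a X)"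
  using component_ar dom_component cod_component component_iso by (simp_all add: id_funct_def)

lemma punit_natural:
  "\<lbrakk>u \<in> Ar (fib F a); Dom (fib F a) u = X; Cod (fib F a) u = Y\<rbrakk> \<Longrightarrow>
    punit F a Y \<cdot>\<^bsub>fib F a\<^esub> u = pa F (Idn B a) u \<cdot>\<^bsub>fib F a\<^esub> punit F a X"
  using natural[of u] by (simp add: id_funct_def)

lemma inv_punit_natural:
  "\<lbrakk>u \<in> Ar (fib F a); Dom (fib F a) u = X; Cod (fib F a) u = Y\<rbrakk> \<Longrightarrow>
    inv_arrow (fib F a) (punit F a Y) \<cdot>\<^bsub>fib F a\<^esub> pa F (Idn B a) u =
    u \<cdot>\<^bsub>fib F a\<^esub> inv_arrow (fib F a) (punit F a X)"
  using inv_natural[of u] by (simp add: id_funct_def)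

end

text \<open>Composition in the Grothendieck construction contains the inverses of
  \<open>pcomp\<close>, so the coherence law is inverted once here. The two unit laws below are
  inverted for the same reason.\<close>

lemma inv_pcomp_assoc:
  assumes "f \<in> Ar B" "g \<in> Ar B" "h \<in> Ar B" "Dom B g = Cod B f" "Dom B h = Cod B g"
    "X \<in> Ob (fib F (Dom B f))" "Cod B h = d"
  shows "inv_arrow (fib F d) (pcomp F h g (po F f X)) \<cdot>\<^bsub>fib F d\<^esub> inv_arrow (fib F d) (pcomp F (h \<cdot> g) f X) =
    pa F h (inv_arrow (fib F (Cod B g)) (pcomp F g f X)) \<cdot>\<^bsub>fib F d\<^esub>
    inv_arrow (fib F d) (pcomp F h (g \<cdot> f) X)"
proof -
  have "inv_arrow (fib F d) (pcomp F (h \<cdot> g) f X \<cdot>\<^bsub>fib F d\<^esub> pcomp F h g (po F f X)) =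
      inv_arrow (fib F d) (pcomp F h (g \<cdot> f) X \<cdot>\<^bsub>fib F d\<^esub> pa F h (pcomp F g f X))"
    using pcomp_assoc[of f _ _ g _ h d X] assms by (simp add: hom_iff)
  then show ?thesis
    using assms by (auto simp: category.inv_cmp_eq[OF fib_category] inv_pa)
qed

lemma inv_punit_right [simp]:
  assumes "f \<in> Ar B" "X \<in> Ob (fib F a)" "Dom B f = a" "Cod B f = b"
  shows "pa F f (inv_arrow (fib F a) (punit F a X)) \<cdot>\<^bsub>fib F b\<^esub>
    inv_arrow (fib F b) (pcomp F f (Idn B a) X) = Idn (fib F b) (po F f X)"
proof -
  have "inv_arrow (fib F b) (pcomp F f (Idn B a) X \<cdot>\<^bsub>fib F b\<^esub> pa F f (punit F a X)) =
      Idn (fib F b) (po F f X)"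
    using pcomp_punit_right[of f a b X] assms by (auto simp: hom_iff)
  then show ?thesis
    using assms by (auto simp: category.inv_cmp_eq[OF fib_category] inv_pa)
qed

lemma inv_punit_left [simp]:
  assumes "f \<in> Ar B" "X \<in> Ob (fib F (Dom B f))" "Cod B f = b"
  shows "inv_arrow (fib F b) (punit F b (po F f X)) \<cdot>\<^bsub>fib F b\<^esub>
    inv_arrow (fib F b) (pcomp F (Idn B b) f X) = Idn (fib F b) (po F f X)"
proof -
  have "inv_arrow (fib F b) (pcomp F (Idn B b) f X \<cdot>\<^bsub>fib F b\<^esub> punit F b (po F f X)) =
      Idn (fib F b) (po F f X)"
    using pcomp_punit_left[of f _ b X] assms by (auto simp: hom_iff)
  then show ?thesis
    using assms by (auto simp: category.inv_cmp_eq[OF fib_category])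
qed

text \<open>The embedding of the fibre over \<open>a\<close> into the total category. An arrow over
  \<open>Idn B a\<close> has a fibre component starting at \<open>F(1)X\<close> instead of
  \<open>X\<close>, hence the inverse of \<open>punit\<close>.\<close>

definition ver :: "'o \<Rightarrow> 'y \<Rightarrow> ('o, 'a, 'x, 'y) groth_arr" where
  "ver a u = ((a, Dom (fib F a) u), (a, Cod (fib F a) u),
     (Idn B a, u \<cdot>\<^bsub>fib F a\<^esub> inv_arrow (fib F a) (punit F a (Dom (fib F a) u))))"

text \<open>The arrows of the standard cleavage of the Grothendieck construction.\<close>

definition lift :: "'a \<Rightarrow> 'x \<Rightarrow> ('o, 'a, 'x, 'y) groth_arr" where
  "lift f X = ((Dom B f, X), (Cod B f, po F f X), (f, Idn (fib F (Cod B f)) (po F f X)))"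

end

lemma groth_arr_exhaust:
  obtains a X b Y f u where "x = ((a, X), (b, Y), (f, u))"
  by (metis surj_pair)

abbreviation base :: "('o, 'a, 'x, 'y) groth_arr \<Rightarrow> 'a" where
  "base x \<equiv> fst (snd (snd x))"

text \<open>The category fields of \<open>E\<close> are tied to \<open>grothendieck B F\<close> one
  by one, so that \<open>E\<close> may be the record extension
  \<open>monoidal_grothendieck A F\<close>. A second instance, with base \<open>Mon A\<close>, is
  the target of the comparison isomorphism.\<close>

locale groth_category = pseudofunctor B F
  for B :: "('o, 'a, 'w) cat_scheme" (structure) and F :: "('o, 'a, 'x, 'y, 'z) psfun_scheme" +
  fixes E :: "('o \<times> 'x, ('o, 'a, 'x, 'y) groth_arr, 'e) cat_scheme"
  assumes groth_sel: "Ob E = Ob (grothendieck B F)" "Ar E = Ar (grothendieck B F)"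
    "Dom E = Dom (grothendieck B F)" "Cod E = Cod (grothendieck B F)"
    "Idn E = Idn (grothendieck B F)" "Cmp E = Cmp (grothendieck B F)"
begin

section \<open>The total category\<close>

lemma E_ob [simp]: "(a, X) \<in> Ob E \<longleftrightarrow> a \<in> Ob B \<and> X \<in> Ob (fib F a)"
  by (simp add: groth_sel grothendieck_def)

lemma E_ar: "((a, X), (b, Y), (f, u)) \<in> Ar E \<longleftrightarrow>
    f \<in> Ar B \<and> Dom B f = a \<and> Cod B f = b \<and> X \<in> Ob (fib F a) \<and>
    u \<in> Ar (fib F b) \<and> Dom (fib F b) u = po F f X \<and> Cod (fib F b) u = Y"
  by (auto simp: groth_sel grothendieck_def hom_iff)

lemma E_dom [simp]: "Dom E (p, s) = p"
  and E_cod [simp]: "Cod E (p, q, r) = q"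
  by (simp_all add: groth_sel grothendieck_def)

lemma E_idn: "Idn E (a, X) = ((a, X), (a, X), (Idn B a, inv_arrow (fib F a) (punit F a X)))"
  by (simp add: groth_sel grothendieck_def)

lemma E_cmp: "(q', (c, Z), (g, v)) \<cdot>\<^bsub>E\<^esub> ((a, X), q, (f, u)) =
    ((a, X), (c, Z), (g \<cdot> f,
      v \<cdot>\<^bsub>fib F c\<^esub> pa F g u \<cdot>\<^bsub>fib F c\<^esub> inv_arrow (fib F c) (pcomp F g f X)))"
  by (simp add: groth_sel grothendieck_def)

lemma E_category: "category E"
proof
  show "f \<in> Ar E \<Longrightarrow> Dom E f \<in> Ob E \<and> Cod E f \<in> Ob E" for f
    by (cases f rule: groth_arr_exhaust) (auto simp: E_ar)
  show "a \<in> Ob E \<Longrightarrow> Idn E a \<in> hom E a a" for a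
    by (cases a) (auto simp: E_ar hom_iff E_idn)
  show "g \<cdot>\<^bsub>E\<^esub> f \<in> hom E a c" if "f \<in> hom E a b" "g \<in> hom E b c" for f g a b c
    using that by (cases f rule: groth_arr_exhaust; cases g rule: groth_arr_exhaust)
        (auto simp: hom_iff E_cmp E_ar)
  show "Idn E b \<cdot>\<^bsub>E\<^esub> x = x" if "x \<in> hom E a b" for x a b
  proof -
    obtain a1 X b1 Y f u where [simp]: "x = ((a1, X), (b1, Y), (f, u))" by (cases x rule: groth_arr_exhaust)
    have x: "f \<in> Ar B" "Dom B f = a1" "Cod B f = b1" "X \<in> Ob (fib F a1)"
      "u \<in> Ar (fib F b1)" "Dom (fib F b1) u = po F f X" "Cod (fib F b1) u = Y" "b = (b1, Y)"
      using that by (auto simp: hom_iff E_ar)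
    then have "inv_arrow (fib F b1) (punit F b1 Y) \<cdot>\<^bsub>fib F b1\<^esub> pa F (Idn B b1) u
        \<cdot>\<^bsub>fib F b1\<^esub> inv_arrow (fib F b1) (pcomp F (Idn B b1) f X) = 
      (inv_arrow (fib F b1) (punit F b1 Y) \<cdot>\<^bsub>fib F b1\<^esub> pa F (Idn B b1) u)
        \<cdot>\<^bsub>fib F b1\<^esub> inv_arrow (fib F b1) (pcomp F (Idn B b1) f X)"
      by auto
    also have "\<dots> = u"
      by (subst inv_punit_natural[where X = "po F f X"]) (use x in auto)
    finally show ?thesis using x by (simp add: E_idn E_cmp)
  qed
  show "x \<cdot>\<^bsub>E\<^esub> Idn E a = x" if "x \<in> hom E a b" for x a b
    using that by (cases x rule: groth_arr_exhaust) (auto simp: hom_iff E_ar E_idn E_cmp)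
  show "(z \<cdot>\<^bsub>E\<^esub> y) \<cdot>\<^bsub>E\<^esub> x = z \<cdot>\<^bsub>E\<^esub> y \<cdot>\<^bsub>E\<^esub> x"
    if "x \<in> hom E p q" "y \<in> hom E q r" "z \<in> hom E r s" for x y z p q r s
  proof -
    obtain a X b Y f u where [simp]: "x = ((a, X), (b, Y), (f, u))" by (cases x rule: groth_arr_exhaust)
    obtain b' Y' c Z g v where [simp]: "y = ((b', Y'), (c, Z), (g, v))" by (cases y rule: groth_arr_exhaust)
    obtain c' Z' d W h w where [simp]: "z = ((c', Z'), (d, W), (h, w))" by (cases z rule: groth_arr_exhaust)
    let ?D = "fib F d"
    have [simp]: "f \<in> Ar B" "Dom B f = a" "Cod B f = b" "X \<in> Ob (fib F a)"
      "u \<in> Ar (fib F b)" "Dom (fib F b) u = po F f X" "Cod (fib F b) u = Y"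
      "g \<in> Ar B" "Dom B g = b" "Cod B g = c" "Y \<in> Ob (fib F b)"
      "v \<in> Ar (fib F c)" "Dom (fib F c) v = po F g Y" "Cod (fib F c) v = Z"
      "h \<in> Ar B" "Dom B h = c" "Cod B h = d" "Z \<in> Ob (fib F c)"
      "w \<in> Ar (fib F d)" "Dom (fib F d) w = po F h Z" "Cod (fib F d) w = W"
      "b' = b" "Y' = Y" "c' = c" "Z' = Z"
      "a \<in> Ob B" "b \<in> Ob B" "c \<in> Ob B" "d \<in> Ob B"
      using that by (auto simp: hom_iff E_ar)
    let ?i = "inv_arrow ?D"
    \<comment> \<open>The expanded composites differ in the place of \<open>u\<close> and in the
      bracketing of the coherence isomorphisms: naturality of the inverse of
      \<open>pcomp F h g\<close> moves \<open>u\<close>, and \<open>inv_pcomp_assoc\<close> regroups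
      the rest.\<close>
    have "w \<cdot>\<^bsub>?D\<^esub> pa F h v \<cdot>\<^bsub>?D\<^esub> ?i (pcomp F h g Y) \<cdot>\<^bsub>?D\<^esub> pa F (h \<cdot> g) u \<cdot>\<^bsub>?D\<^esub> ?i (pcomp F (h \<cdot> g) f X)
      = w \<cdot>\<^bsub>?D\<^esub> pa F h v \<cdot>\<^bsub>?D\<^esub> (?i (pcomp F h g Y) \<cdot>\<^bsub>?D\<^esub> pa F (h \<cdot> g) u) \<cdot>\<^bsub>?D\<^esub> ?i (pcomp F (h \<cdot> g) f X)"
      by simp
    also have "\<dots> = w \<cdot>\<^bsub>?D\<^esub> pa F h v \<cdot>\<^bsub>?D\<^esub> pa F h (pa F g u) \<cdot>\<^bsub>?D\<^esub>
        ?i (pcomp F h g (po F f X)) \<cdot>\<^bsub>?D\<^esub> ?i (pcomp F (h \<cdot> g) f X)"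
      by (subst inv_pcomp_natural[where X = "po F f X"]) auto
    also have "\<dots> = w \<cdot>\<^bsub>?D\<^esub> pa F h v \<cdot>\<^bsub>?D\<^esub> pa F h (pa F g u) \<cdot>\<^bsub>?D\<^esub>
        pa F h (inv_arrow (fib F c) (pcomp F g f X)) \<cdot>\<^bsub>?D\<^esub> ?i (pcomp F h (g \<cdot> f) X)"
      by (subst inv_pcomp_assoc) auto
    finally show ?thesis by (auto simp: E_cmp pa_cmp)
  qed
qed

sublocale E: category E
  by (rule E_category)

section \<open>Vertical arrows, lifts and opcartesian arrows\<close>

lemma ver_ar [simp]: "\<lbrakk>a \<in> Ob B; u \<in> Ar (fib F a)\<rbrakk> \<Longrightarrow> ver a u \<in> Ar E"
  by (auto simp: ver_def E_ar)

lemma dom_ver [simp]: "Dom E (ver a u) = (a, Dom (fib F a) u)"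
  and cod_ver [simp]: "Cod E (ver a u) = (a, Cod (fib F a) u)"
  by (simp_all add: ver_def)

lemma lift_ar [simp]: "\<lbrakk>f \<in> Ar B; X \<in> Ob (fib F (Dom B f))\<rbrakk> \<Longrightarrow> lift f X \<in> Ar E"
  by (auto simp: lift_def E_ar)

lemma dom_lift [simp]: "Dom E (lift f X) = (Dom B f, X)"
  and cod_lift [simp]: "Cod E (lift f X) = (Cod B f, po F f X)"
  by (simp_all add: lift_def)

lemma ver_cmp_arr:
  assumes "(p, (b, Y), (f, u)) \<in> Ar E" "w \<in> Ar (fib F b)" "Dom (fib F b) w = Y"
  shows "ver b w \<cdot>\<^bsub>E\<^esub> (p, (b, Y), (f, u)) = (p, (b, Cod (fib F b) w), (f, w \<cdot>\<^bsub>fib F b\<^esub> u))"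
proof -
  obtain a X where [simp]: "p = (a, X)" by (cases p)
  have x: "f \<in> Ar B" "Dom B f = a" "Cod B f = b" "X \<in> Ob (fib F a)" "b \<in> Ob B"
      "u \<in> Ar (fib F b)" "Dom (fib F b) u = po F f X" "Cod (fib F b) u = Y"
    using assms by (auto simp: E_ar)
  \<comment> \<open>Read in components, the left identity law of \<open>E\<close> is the equation
    that absorbs the unit isomorphism contained in \<open>ver b w\<close>.\<close>
  have "inv_arrow (fib F b) (punit F b Y) \<cdot>\<^bsub>fib F b\<^esub> pa F (Idn B b) u
        \<cdot>\<^bsub>fib F b\<^esub> inv_arrow (fib F b) (pcomp F (Idn B b) f X) = u"
    using E.idl[OF assms(1)] x by (simp add: E_idn E_cmp)
  then show ?thesis using x assms by (auto simp: ver_def E_cmp)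
qed

lemma arr_cmp_ver:
  assumes "((a, X), q, (f, u)) \<in> Ar E" "w \<in> Ar (fib F a)" "Cod (fib F a) w = X"
  shows "((a, X), q, (f, u)) \<cdot>\<^bsub>E\<^esub> ver a w =
    ((a, Dom (fib F a) w), q, (f, u \<cdot>\<^bsub>fib F (Cod B f)\<^esub> pa F f w))"
proof -
  obtain b Y where [simp]: "q = (b, Y)" by (cases q)
  have x: "f \<in> Ar B" "Dom B f = a" "Cod B f = b" "X \<in> Ob (fib F a)" "b \<in> Ob B" "a \<in> Ob B"
      "u \<in> Ar (fib F b)" "Dom (fib F b) u = po F f X" "Cod (fib F b) u = Y"
    using assms by (auto simp: E_ar)
  show ?thesis using x assms by (auto simp: ver_def E_cmp pa_cmp)
qed

lemma ver_cmp:
  assumes "a \<in> Ob B" "u \<in> Ar (fib F a)" "v \<in> Ar (fib F a)" "Dom (fib F a) v = Cod (fib F a) u"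
  shows "ver a (v \<cdot>\<^bsub>fib F a\<^esub> u) = ver a v \<cdot>\<^bsub>E\<^esub> ver a u"
  using ver_cmp_arr[of "(a, Dom (fib F a) u)" a "Cod (fib F a) u" "Idn B a"
      "u \<cdot>\<^bsub>fib F a\<^esub> inv_arrow (fib F a) (punit F a (Dom (fib F a) u))" v] ver_ar[of a u] assms
  by (simp add: ver_def)

lemma ver_idn [simp]: "\<lbrakk>a \<in> Ob B; X \<in> Ob (fib F a)\<rbrakk> \<Longrightarrow> ver a (Idn (fib F a) X) = Idn E (a, X)"
  by (simp add: ver_def E_idn)

lemma ver_cmp_lift:
  assumes "f \<in> Ar B" "X \<in> Ob (fib F (Dom B f))" "Cod B f = b" "u \<in> Ar (fib F b)"
    "Dom (fib F b) u = po F f X"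
  shows "ver b u \<cdot>\<^bsub>E\<^esub> lift f X = ((Dom B f, X), (b, Cod (fib F b) u), (f, u))"
  using assms lift_ar[of f X] by (auto simp: lift_def ver_cmp_arr)

lemma arr_cases:
  assumes "x \<in> Ar E"
  obtains b u f X where "x = ver b u \<cdot>\<^bsub>E\<^esub> lift f X" "f \<in> Ar B" "Cod B f = b"
    "X \<in> Ob (fib F (Dom B f))" "u \<in> Ar (fib F b)" "Dom (fib F b) u = po F f X" "b \<in> Ob B"
proof -
  obtain a X b Y f u where x: "x = ((a, X), (b, Y), (f, u))" by (cases x rule: groth_arr_exhaust)
  with assms show ?thesis
    by (intro that[of b u f X]) (auto simp: E_ar ver_cmp_lift)
qed

text \<open>This square determines \<open>pa F f u\<close>: it is the vertical arrow that
  \<open>u\<close> induces between the lifts of \<open>f\<close>. It lets vertical parts be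
  collected on the left of lifts.\<close>

lemma lift_cmp_ver:
  assumes "f \<in> Ar B" "u \<in> Ar (fib F (Dom B f))" "Cod (fib F (Dom B f)) u = Y" "Dom B f = a" "Cod B f = b"
  shows "lift f Y \<cdot>\<^bsub>E\<^esub> ver a u = ver b (pa F f u) \<cdot>\<^bsub>E\<^esub> lift f (Dom (fib F a) u)"
proof -
  have "a \<in> Ob B" "b \<in> Ob B" using assms by auto
  then show ?thesis
    using assms lift_ar[of f Y] by (auto simp: lift_def[of f Y] arr_cmp_ver ver_cmp_lift)
qed

text \<open>The cleavage by lifts need not be split, and \<open>pcomp\<close> is its defect.
  \<open>ver_pcomp\<close> and \<open>ver_inv_pcomp\<close> read the same relation in the two
  directions in which coherence composites use it.\<close>

lemma lift_cmp_lift: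
  assumes "f \<in> Ar B" "g \<in> Ar B" "Dom B g = Cod B f" "X \<in> Ob (fib F (Dom B f))" "Cod B g = c"
    "po F f X = Y"
  shows "lift g Y \<cdot>\<^bsub>E\<^esub> lift f X = ver c (inv_arrow (fib F c) (pcomp F g f X)) \<cdot>\<^bsub>E\<^esub> lift (g \<cdot> f) X"
proof -
  have "c \<in> Ob B" using assms by auto
  then show ?thesis using assms by (auto simp: ver_cmp_lift) (auto simp: lift_def E_cmp)
qed

lemma ver_inv:
  "\<lbrakk>iso_arrow (fib F a) u; ver a u \<cdot>\<^bsub>E\<^esub> x = y; x \<in> Ar E; Cod E x = (a, Dom (fib F a) u); a \<in> Ob B\<rbrakk>
    \<Longrightarrow> ver a (inv_arrow (fib F a) u) \<cdot>\<^bsub>E\<^esub> y = x"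
  using category.iso_ar[OF fib_category, of a u]
  by (auto simp: E.assoc[symmetric] ver_cmp[symmetric] simp del: E.assoc)

lemma ver_pcomp:
  assumes "f \<in> Ar B" "g \<in> Ar B" "Dom B g = Cod B f" "X \<in> Ob (fib F (Dom B f))" "Cod B g = c"
    "po F f X = Y"
  shows "ver c (pcomp F g f X) \<cdot>\<^bsub>E\<^esub> lift g Y \<cdot>\<^bsub>E\<^esub> lift f X = lift (g \<cdot> f) X"
proof -
  have "c \<in> Ob B" using assms by auto
  then show ?thesis unfolding lift_cmp_lift[OF assms]
    using assms by (auto simp: E.assoc[symmetric] ver_cmp[symmetric] simp del: E.assoc)
qed

lemma ver_inv_pcomp:
  assumes "f \<in> Ar B" "g \<in> Ar B" "Dom B g = Cod B f" "X \<in> Ob (fib F (Dom B f))" "Cod B g = c"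
  shows "ver c (inv_arrow (fib F c) (pcomp F g f X)) \<cdot>\<^bsub>E\<^esub> lift (g \<cdot> f) X =
    lift g (po F f X) \<cdot>\<^bsub>E\<^esub> lift f X"
  using lift_cmp_lift[OF assms refl] by simp

text \<open>The unit counterpart of \<open>lift_cmp_lift\<close>: a lift of an identity is in
  general not an identity of \<open>E\<close>, and the unit isomorphism is the defect.\<close>

lemma ver_punit: "\<lbrakk>a \<in> Ob B; X \<in> Ob (fib F a)\<rbrakk> \<Longrightarrow> ver a (punit F a X) = lift (Idn B a) X"
  by (simp add: ver_def lift_def)

lemma ver_inv_punit:
  "\<lbrakk>a \<in> Ob B; X \<in> Ob (fib F a)\<rbrakk> \<Longrightarrow>
    ver a (inv_arrow (fib F a) (punit F a X)) \<cdot>\<^bsub>E\<^esub> lift (Idn B a) X = Idn E (a, X)"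
  by (simp flip: ver_punit ver_cmp)

text \<open>Equality of the images gives equal domains, hence the same invertible
  \<open>punit\<close> factor on both sides, which cancels.\<close>

lemma ver_inject:
  assumes "ver a u = ver a v" "a \<in> Ob B" "u \<in> Ar (fib F a)" "v \<in> Ar (fib F a)"
  shows "u = v"
proof (rule category.iso_cancel_right[OF fib_category])
  let ?i = "inv_arrow (fib F a) (punit F a (Dom (fib F a) u))"
  show "u \<cdot>\<^bsub>fib F a\<^esub> ?i = v \<cdot>\<^bsub>fib F a\<^esub> ?i" "iso_arrow (fib F a) ?i"
    using assms by (auto simp: ver_def)
qed (use assms in \<open>auto simp: ver_def\<close>)

text \<open>Opcartesian arrows of a Grothendieck construction are those with invertible fibre
  component. The definition states this directly; the uniqueness half of the universal property is
  recovered as \<open>opcartesian_cancel\<close>.\<close>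

definition opcartesian :: "('o, 'a, 'x, 'y) groth_arr \<Rightarrow> bool" where
  "opcartesian x \<longleftrightarrow> (\<exists>b u f X. x = ver b u \<cdot>\<^bsub>E\<^esub> lift f X \<and> f \<in> Ar B \<and> Cod B f = b \<and>
    X \<in> Ob (fib F (Dom B f)) \<and> iso_arrow (fib F b) u \<and> Dom (fib F b) u = po F f X)"

lemma opcartesianI:
  "\<lbrakk>f \<in> Ar B; Cod B f = b; X \<in> Ob (fib F (Dom B f)); iso_arrow (fib F b) u;
    Dom (fib F b) u = po F f X\<rbrakk> \<Longrightarrow> opcartesian (ver b u \<cdot>\<^bsub>E\<^esub> lift f X)"
  unfolding opcartesian_def by blast

lemma opcartesian_lift:
  assumes "f \<in> Ar B" "X \<in> Ob (fib F (Dom B f))"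
  shows "opcartesian (lift f X)"
proof -
  have "opcartesian (ver (Cod B f) (Idn (fib F (Cod B f)) (po F f X)) \<cdot>\<^bsub>E\<^esub> lift f X)"
    by (rule opcartesianI) (use assms in auto)
  then show ?thesis using assms by simp
qed

lemma opcartesian_cmp:
  assumes "opcartesian x" "opcartesian y" "Dom E y = Cod E x"
  shows "opcartesian (y \<cdot>\<^bsub>E\<^esub> x)"
proof -
  obtain b u f X where x: "x = ver b u \<cdot>\<^bsub>E\<^esub> lift f X" "f \<in> Ar B" "Cod B f = b"
    "X \<in> Ob (fib F (Dom B f))" "iso_arrow (fib F b) u" "Dom (fib F b) u = po F f X"
    using assms(1) unfolding opcartesian_def by blast
  obtain c v g Y where y: "y = ver c v \<cdot>\<^bsub>E\<^esub> lift g Y" "g \<in> Ar B" "Cod B g = c"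
    "Y \<in> Ob (fib F (Dom B g))" "iso_arrow (fib F c) v" "Dom (fib F c) v = po F g Y"
    using assms(2) unfolding opcartesian_def by blast
  have b: "b \<in> Ob B" "c \<in> Ob B" using x y by auto
  have u: "u \<in> Ar (fib F b)" "v \<in> Ar (fib F c)" using x y b category.iso_ar[OF fib_category] by auto
  have d: "Dom B g = b" "Cod (fib F b) u = Y" using assms(3) x y u b by auto
  \<comment> \<open>By the composition formula of the total category, the fibre component of
    \<open>y\<close> after \<open>x\<close> is a composite of \<open>v\<close>, an image of
    \<open>u\<close> and an inverse of \<open>pcomp\<close>, all invertible.\<close>
  have "opcartesian (ver c (v \<cdot>\<^bsub>fib F c\<^esub> pa F g u \<cdot>\<^bsub>fib F c\<^esub> inv_arrow (fib F c) (pcomp F g f X))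
      \<cdot>\<^bsub>E\<^esub> lift (g \<cdot> f) X)"
    by (rule opcartesianI) (use x y b u d in auto)
  also have "ver c (v \<cdot>\<^bsub>fib F c\<^esub> pa F g u \<cdot>\<^bsub>fib F c\<^esub> inv_arrow (fib F c) (pcomp F g f X))
      \<cdot>\<^bsub>E\<^esub> lift (g \<cdot> f) X = ver c v \<cdot>\<^bsub>E\<^esub> (ver c (pa F g u) \<cdot>\<^bsub>E\<^esub> lift g (po F f X)) \<cdot>\<^bsub>E\<^esub> lift f X"
    using x y b u d by (simp add: ver_cmp ver_inv_pcomp)
  also have "ver c (pa F g u) \<cdot>\<^bsub>E\<^esub> lift g (po F f X) = lift g Y \<cdot>\<^bsub>E\<^esub> ver b u"
    using x y b u d by (simp add: lift_cmp_ver)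
  finally show ?thesis using x y b u d by simp
qed

lemma opcartesian_ar: "opcartesian x \<Longrightarrow> x \<in> Ar E"
  unfolding opcartesian_def using category.iso_ar[OF fib_category] by fastforce

text \<open>Uniqueness in the universal property holds among arrows with a prescribed image in the
  base: the base arrow of \<open>x\<close> need not be epic, so \<open>base y = base z\<close>
  cannot be deduced from the equation of composites.\<close>

lemma opcartesian_cancel:
  assumes "opcartesian x" "y \<cdot>\<^bsub>E\<^esub> x = z \<cdot>\<^bsub>E\<^esub> x" "base y = base z" "y \<in> Ar E" "z \<in> Ar E"
    "Dom E y = Cod E x" "Dom E z = Cod E x"
  shows "y = z"
proof -
  obtain b u f X where x: "x = ver b u \<cdot>\<^bsub>E\<^esub> lift f X" "f \<in> Ar B" "Cod B f = b"
    "X \<in> Ob (fib F (Dom B f))" "iso_arrow (fib F b) u" "Dom (fib F b) u = po F f X"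
    using assms(1) unfolding opcartesian_def by blast
  have b: "b \<in> Ob B" using x by auto
  have u: "u \<in> Ar (fib F b)" using x b category.iso_ar[OF fib_category] by auto
  have x': "x = ((Dom B f, X), (b, Cod (fib F b) u), (f, u))"
    using x u by (simp add: ver_cmp_lift)
  obtain b1 Y1 c1 Z1 g1 v1 where y: "y = ((b1, Y1), (c1, Z1), (g1, v1))" by (cases y rule: groth_arr_exhaust)
  obtain b2 Y2 c2 Z2 g2 v2 where z: "z = ((b2, Y2), (c2, Z2), (g2, v2))" by (cases z rule: groth_arr_exhaust)
  have e [simp]: "g2 = g1" "b1 = b" "b2 = b" "Y1 = Cod (fib F b) u" "Y2 = Cod (fib F b) u"
    using assms by (auto simp: x' y z)
  have yz: "g1 \<in> Ar B" "Dom B g1 = b" "Cod B g1 = c1" "c2 = c1" "v1 \<in> Ar (fib F c1)" "v2 \<in> Ar (fib F c1)"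
    "Dom (fib F c1) v1 = po F g1 (Cod (fib F b) u)" "Dom (fib F c1) v2 = po F g1 (Cod (fib F b) u)"
    "Cod (fib F c1) v1 = Z1" "Cod (fib F c1) v2 = Z2" "c1 \<in> Ob B"
    using assms(4,5) by (auto simp: y z E_ar)
  \<comment> \<open>By the composition formula \<open>?k\<close> is the common right factor of the
    fibre components of both composites.\<close>
  let ?k = "pa F g1 u \<cdot>\<^bsub>fib F c1\<^esub> inv_arrow (fib F c1) (pcomp F g1 f X)"
  have k: "iso_arrow (fib F c1) ?k" "Cod (fib F c1) ?k = po F g1 (Cod (fib F b) u)"
    using x u yz by auto
  have "v1 \<cdot>\<^bsub>fib F c1\<^esub> ?k = v2 \<cdot>\<^bsub>fib F c1\<^esub> ?k"
    using assms(2) yz by (simp add: x' y z E_cmp)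
  from category.iso_cancel_right[OF fib_category this k(1)] have "v1 = v2"
    using yz k(2) by simp
  then show ?thesis using yz by (simp add: y z)
qed

end

section \<open>The monoidal Grothendieck construction\<close>

context monoidal_category
begin

lemma unit_in [simp]: "unit_ob C \<in> Ob C"
  by (rule unit_ob_in)

lemma associator_ar [simp]:
  assumes "a \<in> Ob C" "b \<in> Ob C" "c \<in> Ob C"
  shows "associator C a b c \<in> Ar C" "Dom C (associator C a b c) = (a \<otimes> b) \<otimes> c"
    "Cod C (associator C a b c) = a \<otimes> (b \<otimes> c)"
  using nat_iso.component_ar[OF associator_nat_iso, of "((a, b), c)"]
    nat_iso.dom_component[OF associator_nat_iso, of "((a, b), c)"]
    nat_iso.cod_component[OF associator_nat_iso, of "((a, b), c)"] assms by auto

lemma associator_natural: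
  assumes "f \<in> Ar C" "g \<in> Ar C" "h \<in> Ar C"
  shows "associator C (Cod C f) (Cod C g) (Cod C h) \<cdot> ((f \<odot> g) \<odot> h) =
    (f \<odot> (g \<odot> h)) \<cdot> associator C (Dom C f) (Dom C g) (Dom C h)"
  using nat_iso.natural[OF associator_nat_iso, of "((f, g), h)"] assms by auto

lemma lunitor_ar [simp]:
  assumes "a \<in> Ob C"
  shows "lunitor C a \<in> Ar C" "Dom C (lunitor C a) = unit_ob C \<otimes> a" "Cod C (lunitor C a) = a"
  using nat_iso.component_ar[OF lunitor_nat_iso, of a] nat_iso.dom_component[OF lunitor_nat_iso, of a]
    nat_iso.cod_component[OF lunitor_nat_iso, of a] assms by (auto simp: id_funct_def)

lemma lunitor_natural:
  "f \<in> Ar C \<Longrightarrow> lunitor C (Cod C f) \<cdot> (Idn C (unit_ob C) \<odot> f) = f \<cdot> lunitor C (Dom C f)"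
  using nat_iso.natural[OF lunitor_nat_iso, of f] by (auto simp: id_funct_def)

lemma runitor_ar [simp]:
  assumes "a \<in> Ob C"
  shows "runitor C a \<in> Ar C" "Dom C (runitor C a) = a \<otimes> unit_ob C" "Cod C (runitor C a) = a"
  using nat_iso.component_ar[OF runitor_nat_iso, of a] nat_iso.dom_component[OF runitor_nat_iso, of a]
    nat_iso.cod_component[OF runitor_nat_iso, of a] assms by (auto simp: id_funct_def)

lemma runitor_natural:
  "f \<in> Ar C \<Longrightarrow> runitor C (Cod C f) \<cdot> (f \<odot> Idn C (unit_ob C)) = f \<cdot> runitor C (Dom C f)"
  using nat_iso.natural[OF runitor_nat_iso, of f] by (auto simp: id_funct_def)

end

context groth_category
begin

text \<open>\<open>lift_cmp_ver\<close> with a tail. In right-nested composites it carries a factor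
  of the shape \<open>pa F f u\<close> across the lift of \<open>f\<close>, where \<open>u\<close>
  meets the next factor and can be absorbed.\<close>

lemma ver_pa_slide:
  assumes "f \<in> Ar B" "Dom B f = a" "Cod B f = b" "u \<in> Ar (fib F a)" "Dom (fib F a) u = X"
    "Cod (fib F a) u = Y" "x \<in> Ar E" "Cod E x = (a, X)"
  shows "ver b (pa F f u) \<cdot>\<^bsub>E\<^esub> lift f X \<cdot>\<^bsub>E\<^esub> x = lift f Y \<cdot>\<^bsub>E\<^esub> ver a u \<cdot>\<^bsub>E\<^esub> x"
proof -
  have [simp]: "a \<in> Ob B" "b \<in> Ob B" "Y \<in> Ob (fib F a)" "X \<in> Ob (fib F a)" using assms by auto
  have "ver b (pa F f u) \<cdot>\<^bsub>E\<^esub> lift f X = lift f Y \<cdot>\<^bsub>E\<^esub> ver a u"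
    using assms by (simp add: lift_cmp_ver)
  from E.cmp_tail[OF this] show ?thesis using assms by simp
qed

lemma iso_ver: "\<lbrakk>iso_arrow (fib F a) u; a \<in> Ob B\<rbrakk> \<Longrightarrow> iso_arrow E (ver a u)"
  unfolding iso_arrow_def[of E]
  by (rule exI[of _ "ver a (inv_arrow (fib F a) u)"], insert category.iso_ar[OF fib_category, of a u])
    (simp add: inverse_arrows_def hom_iff ver_cmp[symmetric])

end

section \<open>Typing, naturality and inverted laws of the lax structure\<close>

context weakly_lax_monoidal_pseudofunctor
begin

context
  fixes a b
  assumes ab: "a \<in> Ob A" "b \<in> Ob A"
begin

interpretation is_functor "fib F a \<times>\<^sub>C fib F b" "fib F (a \<otimes> b)" "lax F a b"
  using ab by (rule lax_functor)

lemma lo_ob [simp]: "\<lbrakk>X \<in> Ob (fib F a); Y \<in> Ob (fib F b)\<rbrakk> \<Longrightarrow> lo F a b X Y \<in> Ob (fib F (a \<otimes> b))"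
  using obj_map_in[of "(X, Y)"] by simp

lemma la_ar [simp]:
  assumes "u \<in> Ar (fib F a)" "v \<in> Ar (fib F b)"
  shows "la F a b u v \<in> Ar (fib F (a \<otimes> b))"
    "Dom (fib F (a \<otimes> b)) (la F a b u v) = lo F a b (Dom (fib F a) u) (Dom (fib F b) v)"
    "Cod (fib F (a \<otimes> b)) (la F a b u v) = lo F a b (Cod (fib F a) u) (Cod (fib F b) v)"
  using arr_ar[of "(u, v)"] dom_arr[of "(u, v)"] cod_arr[of "(u, v)"] assms by auto

lemma la_idn [simp]: "\<lbrakk>X \<in> Ob (fib F a); Y \<in> Ob (fib F b)\<rbrakk> \<Longrightarrow>
    la F a b (Idn (fib F a) X) (Idn (fib F b) Y) = Idn (fib F (a \<otimes> b)) (lo F a b X Y)"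
  using arr_map_idn[of "(X, Y)"] by simp

lemma la_cmp:
  "\<lbrakk>u \<in> Ar (fib F a); u' \<in> Ar (fib F a); Dom (fib F a) u' = Cod (fib F a) u;
    v \<in> Ar (fib F b); v' \<in> Ar (fib F b); Dom (fib F b) v' = Cod (fib F b) v\<rbrakk> \<Longrightarrow>
    la F a b u' v' \<cdot>\<^bsub>fib F (a \<otimes> b)\<^esub> la F a b u v =
    la F a b (u' \<cdot>\<^bsub>fib F a\<^esub> u) (v' \<cdot>\<^bsub>fib F b\<^esub> v)"
  using arr_cmp[of "(u, v)" "(u', v')"] by simp

lemma iso_la [simp]: "\<lbrakk>iso_arrow (fib F a) u; iso_arrow (fib F b) v\<rbrakk> \<Longrightarrow>
    iso_arrow (fib F (a \<otimes> b)) (la F a b u v)"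
  and inv_la: "\<lbrakk>iso_arrow (fib F a) u; iso_arrow (fib F b) v\<rbrakk> \<Longrightarrow>
    inv_arrow (fib F (a \<otimes> b)) (la F a b u v) =
    la F a b (inv_arrow (fib F a) u) (inv_arrow (fib F b) v)"
  using iso_arr[OF iso_prod] inv_arr[OF iso_prod] ab by (auto simp: inv_prod fib_category)

end

lemma iota_ob [simp]: "iota F \<in> Ob (fib F (unit_ob A))"
  using is_functor.obj_map_in[OF lax_unit_functor] by (simp add: terminal_cat_def)

context
  fixes f g a b
  assumes fg: "f \<in> Ar A" "Cod A f = a" "g \<in> Ar A" "Cod A g = b"
begin

interpretation nat_iso "fib F (Dom A f) \<times>\<^sub>C fib F (Dom A g)" "fib F (a \<otimes> b)"
  "lax F a b \<circ>\<^sub>F (push F f \<times>\<^sub>F push F g)" "push F (f \<odot> g) \<circ>\<^sub>F lax F (Dom A f) (Dom A g)"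
  "lax_2 F f g"
  using fg by (intro lax_2_nat_iso) (auto simp: hom_iff)

lemma lax_2_ar [simp]:
  assumes "X \<in> Ob (fib F (Dom A f))" "Y \<in> Ob (fib F (Dom A g))"
  shows "lax_2 F f g (X, Y) \<in> Ar (fib F (a \<otimes> b))"
    "Dom (fib F (a \<otimes> b)) (lax_2 F f g (X, Y)) = lo F a b (po F f X) (po F g Y)"
    "Cod (fib F (a \<otimes> b)) (lax_2 F f g (X, Y)) = po F (f \<odot> g) (lo F (Dom A f) (Dom A g) X Y)"
    "iso_arrow (fib F (a \<otimes> b)) (lax_2 F f g (X, Y))"
  using component_ar[of "(X, Y)"] dom_component[of "(X, Y)"] cod_component[of "(X, Y)"]
    component_iso[of "(X, Y)"] assms by (auto simp: comp_funct_def prod_funct_def)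

lemma inv_lax_2_natural:
  assumes "u \<in> Ar (fib F (Dom A f))" "v \<in> Ar (fib F (Dom A g))"
    "Dom (fib F (Dom A f)) u = X" "Dom (fib F (Dom A g)) v = Y"
    "Cod (fib F (Dom A f)) u = X'" "Cod (fib F (Dom A g)) v = Y'"
  shows "inv_arrow (fib F (a \<otimes> b)) (lax_2 F f g (X', Y')) \<cdot>\<^bsub>fib F (a \<otimes> b)\<^esub>
      pa F (f \<odot> g) (la F (Dom A f) (Dom A g) u v) =
    la F a b (pa F f u) (pa F g v) \<cdot>\<^bsub>fib F (a \<otimes> b)\<^esub>
      inv_arrow (fib F (a \<otimes> b)) (lax_2 F f g (X, Y))"
  using inv_natural[of "(u, v)"] assms by (auto simp: comp_funct_def prod_funct_def)

end

text \<open>The tensor product of arrows of the total category contains the inverse of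
  \<open>lax_2\<close>, so the compatibility of \<open>lax_2\<close> with composition is wanted in
  inverted form; likewise \<open>inv_lax_2_idn\<close> for identities.\<close>

lemma inv_lax_2_cmp:
  assumes "f \<in> Ar A" "f' \<in> Ar A" "Dom A f' = Cod A f" "g \<in> Ar A" "g' \<in> Ar A" "Dom A g' = Cod A g"
    "Cod A f' = a" "Cod A g' = b"
    "X \<in> Ob (fib F (Dom A f))" "Y \<in> Ob (fib F (Dom A g))" "D = fib F (a \<otimes> b)"
  shows "inv_arrow D (lax_2 F f' g' (po F f X, po F g Y)) \<cdot>\<^bsub>D\<^esub>
      pa F (f' \<odot> g') (inv_arrow (fib F (Cod A f \<otimes> Cod A g)) (lax_2 F f g (X, Y))) \<cdot>\<^bsub>D\<^esub>
      inv_arrow D (pcomp F (f' \<odot> g') (f \<odot> g) (lo F (Dom A f) (Dom A g) X Y)) =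
    la F a b (inv_arrow (fib F a) (pcomp F f' f X)) (inv_arrow (fib F b) (pcomp F g' g Y)) \<cdot>\<^bsub>D\<^esub>
      inv_arrow D (lax_2 F (f' \<cdot> f) (g' \<cdot> g) (X, Y))"
proof -
  have ab: "a \<in> Ob A" "b \<in> Ob A" using assms by auto
  have "inv_arrow D (pcomp F (f' \<odot> g') (f \<odot> g) (lo F (Dom A f) (Dom A g) X Y)
      \<cdot>\<^bsub>D\<^esub> pa F (f' \<odot> g') (lax_2 F f g (X, Y)) \<cdot>\<^bsub>D\<^esub> lax_2 F f' g' (po F f X, po F g Y)) =
    inv_arrow D (lax_2 F (f' \<cdot> f) (g' \<cdot> g) (X, Y)
      \<cdot>\<^bsub>D\<^esub> la F a b (pcomp F f' f X) (pcomp F g' g Y))"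
    using lax_2_cmp[of f _ _ f' a g _ _ g' b X Y D] assms by (simp add: hom_iff)
  then show ?thesis
    using assms ab by (simp add: category.inv_cmp_eq[OF fib_category] inv_pa inv_la)
qed

lemma inv_lax_2_idn:
  assumes "a \<in> Ob A" "b \<in> Ob A" "X \<in> Ob (fib F a)" "Y \<in> Ob (fib F b)"
  shows "la F a b (inv_arrow (fib F a) (punit F a X)) (inv_arrow (fib F b) (punit F b Y))
      \<cdot>\<^bsub>fib F (a \<otimes> b)\<^esub> inv_arrow (fib F (a \<otimes> b)) (lax_2 F (Idn A a) (Idn A b) (X, Y)) =
    inv_arrow (fib F (a \<otimes> b)) (punit F (a \<otimes> b) (lo F a b X Y))"
  using assms by (simp add: lax_2_idn[symmetric] category.inv_cmp_eq[OF fib_category] inv_la)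

context
  fixes a b c
  assumes abc: "a \<in> Ob A" "b \<in> Ob A" "c \<in> Ob A"
begin

interpretation nat_iso "(fib F a \<times>\<^sub>C fib F b) \<times>\<^sub>C fib F c" "fib F (a \<otimes> (b \<otimes> c))"
        "\<lparr>obj_map = (\<lambda>((X, Y), Z). po F (associator A a b c) (lo F (a \<otimes> b) c (lo F a b X Y) Z)),
         arr_map = (\<lambda>((u, v), w). pa F (associator A a b c) (la F (a \<otimes> b) c (la F a b u v) w))\<rparr>"
        "\<lparr>obj_map = (\<lambda>((X, Y), Z). lo F a (b \<otimes> c) X (lo F b c Y Z)),
         arr_map = (\<lambda>((u, v), w). la F a (b \<otimes> c) u (la F b c v w))\<rparr>"
        "(\<lambda>((X, Y), Z). lax_assoc F a b c X Y Z)"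
  using abc by (rule lax_assoc_nat_iso)

lemma lax_assoc_ar [simp]:
  assumes "X \<in> Ob (fib F a)" "Y \<in> Ob (fib F b)" "Z \<in> Ob (fib F c)"
  shows "lax_assoc F a b c X Y Z \<in> Ar (fib F (a \<otimes> (b \<otimes> c)))"
    "Dom (fib F (a \<otimes> (b \<otimes> c))) (lax_assoc F a b c X Y Z) =
      po F (associator A a b c) (lo F (a \<otimes> b) c (lo F a b X Y) Z)"
    "Cod (fib F (a \<otimes> (b \<otimes> c))) (lax_assoc F a b c X Y Z) = lo F a (b \<otimes> c) X (lo F b c Y Z)"
    "iso_arrow (fib F (a \<otimes> (b \<otimes> c))) (lax_assoc F a b c X Y Z)"
  using component_ar[of "((X, Y), Z)"] dom_component[of "((X, Y), Z)"]
    cod_component[of "((X, Y), Z)"] component_iso[of "((X, Y), Z)"] assms by auto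

lemma lax_assoc_natural:
  assumes "u \<in> Ar (fib F a)" "v \<in> Ar (fib F b)" "w \<in> Ar (fib F c)" "D = fib F (a \<otimes> (b \<otimes> c))"
  shows "lax_assoc F a b c (Cod (fib F a) u) (Cod (fib F b) v) (Cod (fib F c) w) \<cdot>\<^bsub>D\<^esub>
      pa F (associator A a b c) (la F (a \<otimes> b) c (la F a b u v) w) =
    la F a (b \<otimes> c) u (la F b c v w) \<cdot>\<^bsub>D\<^esub>
      lax_assoc F a b c (Dom (fib F a) u) (Dom (fib F b) v) (Dom (fib F c) w)"
  using natural[of "((u, v), w)"] assms by auto

end

context
  fixes a
  assumes a: "a \<in> Ob A"
begin

interpretation l: nat_iso "fib F a" "fib F a"
        "\<lparr>obj_map = (\<lambda>X. po F (lunitor A a) (lo F (unit_ob A) a (iota F) X)),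
         arr_map = (\<lambda>u. pa F (lunitor A a)
           (la F (unit_ob A) a (Idn (fib F (unit_ob A)) (iota F)) u))\<rparr>"
        id_funct "lax_lunit F a"
  using a by (rule lax_lunit_nat_iso)

interpretation r: nat_iso "fib F a" "fib F a"
        "\<lparr>obj_map = (\<lambda>X. po F (runitor A a) (lo F a (unit_ob A) X (iota F))),
         arr_map = (\<lambda>u. pa F (runitor A a)
           (la F a (unit_ob A) u (Idn (fib F (unit_ob A)) (iota F))))\<rparr>"
        id_funct "lax_runit F a"
  using a by (rule lax_runit_nat_iso)

lemma lax_unit_ar [simp]:
  assumes "X \<in> Ob (fib F a)"
  shows "lax_lunit F a X \<in> Ar (fib F a)" "Cod (fib F a) (lax_lunit F a X) = X"
    "Dom (fib F a) (lax_lunit F a X) = po F (lunitor A a) (lo F (unit_ob A) a (iota F) X)"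
    "lax_runit F a X \<in> Ar (fib F a)" "Cod (fib F a) (lax_runit F a X) = X"
    "Dom (fib F a) (lax_runit F a X) = po F (runitor A a) (lo F a (unit_ob A) X (iota F))"
  using l.component_ar[of X] l.dom_component[of X] l.cod_component[of X]
    r.component_ar[of X] r.dom_component[of X] r.cod_component[of X] assms
  by (auto simp: id_funct_def)

lemma lax_lunit_natural:
  assumes "u \<in> Ar (fib F a)"
  shows "lax_lunit F a (Cod (fib F a) u) \<cdot>\<^bsub>fib F a\<^esub> pa F (lunitor A a)
      (la F (unit_ob A) a (Idn (fib F (unit_ob A)) (iota F)) u) =
    u \<cdot>\<^bsub>fib F a\<^esub> lax_lunit F a (Dom (fib F a) u)"
  using l.natural[of u] assms by (auto simp: id_funct_def)

lemma lax_runit_natural: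
  assumes "u \<in> Ar (fib F a)"
  shows "lax_runit F a (Cod (fib F a) u) \<cdot>\<^bsub>fib F a\<^esub> pa F (runitor A a)
      (la F a (unit_ob A) u (Idn (fib F (unit_ob A)) (iota F))) =
    u \<cdot>\<^bsub>fib F a\<^esub> lax_runit F a (Dom (fib F a) u)"
  using r.natural[of u] assms by (auto simp: id_funct_def)

end

section \<open>The tensor product of the total category\<close>

abbreviation E where "E \<equiv> monoidal_grothendieck A F"

sublocale groth_category A F E
  by unfold_locales (simp_all add: monoidal_grothendieck_def Let_def cat.defs moncat.defs)

lemma E_tensor_ob: "(a, X) \<otimes>\<^bsub>E\<^esub> (b, Y) = (a \<otimes> b, lo F a b X Y)"
  and E_tensor_ar: "((a, X), (a', X'), (f, u)) \<odot>\<^bsub>E\<^esub> ((b, Y), (b', Y'), (g, v)) =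
    ((a \<otimes> b, lo F a b X Y), (a' \<otimes> b', lo F a' b' X' Y'),
      (f \<odot> g, la F a' b' u v \<cdot>\<^bsub>fib F (a' \<otimes> b')\<^esub>
        inv_arrow (fib F (a' \<otimes> b')) (lax_2 F f g (X, Y))))"
  and E_unit: "unit_ob E = (unit_ob A, iota F)"
  and E_associator: "associator E (a, X) (b, Y) (c, Z) =
    (((a \<otimes> b) \<otimes> c, lo F (a \<otimes> b) c (lo F a b X Y) Z),
     (a \<otimes> (b \<otimes> c), lo F a (b \<otimes> c) X (lo F b c Y Z)),
     (associator A a b c, lax_assoc F a b c X Y Z))"
  and E_lunitor: "lunitor E (a, X) =
    ((unit_ob A \<otimes> a, lo F (unit_ob A) a (iota F) X), (a, X), (lunitor A a, lax_lunit F a X))"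
  and E_runitor: "runitor E (a, X) =
    ((a \<otimes> unit_ob A, lo F a (unit_ob A) X (iota F)), (a, X), (runitor A a, lax_runit F a X))"
  by (simp_all add: monoidal_grothendieck_def Let_def cat.defs moncat.defs)

lemma E_tensor_functor: "is_functor (E \<times>\<^sub>C E) E (tensor E)"
proof -
  interpret EE: category "E \<times>\<^sub>C E" by (rule prod_category; rule E_category)
  show ?thesis
  proof
    show "obj_map (tensor E) p \<in> Ob E" if "p \<in> Ob (E \<times>\<^sub>C E)" for p
      using that by (auto simp: E_tensor_ob)
    show "arr_map (tensor E) p \<in> hom E (obj_map (tensor E) r) (obj_map (tensor E) s)"
      if "p \<in> hom (E \<times>\<^sub>C E) r s" for p r s
    proof -
      obtain x y where "p = (x, y)" by (cases p)
      with that show ?thesis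
        by (cases x rule: groth_arr_exhaust; cases y rule: groth_arr_exhaust)
          (auto simp: hom_iff E_ar E_tensor_ar E_tensor_ob)
    qed
    show "arr_map (tensor E) (Idn (E \<times>\<^sub>C E) p) = Idn E (obj_map (tensor E) p)"
      if "p \<in> Ob (E \<times>\<^sub>C E)" for p
      using that by (auto simp: E_tensor_ob E_tensor_ar E_idn inv_lax_2_idn)
    show "arr_map (tensor E) (q \<cdot>\<^bsub>E \<times>\<^sub>C E\<^esub> p) = arr_map (tensor E) q \<cdot>\<^bsub>E\<^esub> arr_map (tensor E) p"
      if "p \<in> hom (E \<times>\<^sub>C E) r s" "q \<in> hom (E \<times>\<^sub>C E) s t" for p q r s t
    proof -
      obtain x y x' y' where [simp]: "p = (x, y)" "q = (x', y')" by (cases p; cases q)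
      obtain a X c Z f u where [simp]: "x = ((a, X), (c, Z), (f, u))" by (cases x rule: groth_arr_exhaust)
      obtain b Y d W g v where [simp]: "y = ((b, Y), (d, W), (g, v))" by (cases y rule: groth_arr_exhaust)
      obtain c0 Z0 c' Z' f' u' where [simp]: "x' = ((c0, Z0), (c', Z'), (f', u'))"
        by (cases x' rule: groth_arr_exhaust)
      obtain d0 W0 d' W' g' v' where [simp]: "y' = ((d0, W0), (d', W'), (g', v'))"
        by (cases y' rule: groth_arr_exhaust)
      have [simp]: "c0 = c" "d0 = d" "Z0 = Z" "W0 = W"
        "f \<in> Ar A" "Dom A f = a" "Cod A f = c" "X \<in> Ob (fib F a)"
        "u \<in> Ar (fib F c)" "Dom (fib F c) u = po F f X" "Cod (fib F c) u = Z"
        "g \<in> Ar A" "Dom A g = b" "Cod A g = d" "Y \<in> Ob (fib F b)"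
        "v \<in> Ar (fib F d)" "Dom (fib F d) v = po F g Y" "Cod (fib F d) v = W"
        "f' \<in> Ar A" "Dom A f' = c" "Cod A f' = c'" "Z \<in> Ob (fib F c)"
        "u' \<in> Ar (fib F c')" "Dom (fib F c') u' = po F f' Z" "Cod (fib F c') u' = Z'"
        "g' \<in> Ar A" "Dom A g' = d" "Cod A g' = d'" "W \<in> Ob (fib F d)"
        "v' \<in> Ar (fib F d')" "Dom (fib F d') v' = po F g' W" "Cod (fib F d') v' = W'"
        "a \<in> Ob A" "b \<in> Ob A" "c \<in> Ob A" "d \<in> Ob A" "c' \<in> Ob A" "d' \<in> Ob A"
        using that by (auto simp: hom_iff E_ar)
      let ?D = "fib F (c' \<otimes> d')" and ?D' = "fib F (c \<otimes> d)"
      let ?i = "inv_arrow ?D" and ?P = "lo F a b X Y"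
      let ?u = "inv_arrow (fib F c') (pcomp F f' f X)" and ?v = "inv_arrow (fib F d') (pcomp F g' g Y)"
      have "la F c' d' u' v' \<cdot>\<^bsub>?D\<^esub> ?i (lax_2 F f' g' (Z, W)) \<cdot>\<^bsub>?D\<^esub> pa F (f' \<odot> g')
          (la F c d u v \<cdot>\<^bsub>?D'\<^esub> inv_arrow ?D' (lax_2 F f g (X, Y))) \<cdot>\<^bsub>?D\<^esub> ?i (pcomp F (f' \<odot> g') (f \<odot> g) ?P)
        = la F c' d' u' v' \<cdot>\<^bsub>?D\<^esub> (?i (lax_2 F f' g' (Z, W)) \<cdot>\<^bsub>?D\<^esub> pa F (f' \<odot> g') (la F c d u v)) \<cdot>\<^bsub>?D\<^esub>
          pa F (f' \<odot> g') (inv_arrow ?D' (lax_2 F f g (X, Y))) \<cdot>\<^bsub>?D\<^esub> ?i (pcomp F (f' \<odot> g') (f \<odot> g) ?P)"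
        by (simp add: pa_cmp)
      \<comment> \<open>Naturality of \<open>lax_2\<close> brings the fibre parts \<open>u\<close>
        and \<open>v\<close> to the left. What is left is the interchange law for pure lifts, which
        is \<open>inv_lax_2_cmp\<close>.\<close>
      also have "?i (lax_2 F f' g' (Z, W)) \<cdot>\<^bsub>?D\<^esub> pa F (f' \<odot> g') (la F c d u v) =
          la F c' d' (pa F f' u) (pa F g' v) \<cdot>\<^bsub>?D\<^esub> ?i (lax_2 F f' g' (po F f X, po F g Y))"
        using inv_lax_2_natural[of f' c' g' d' u v] by simp
      also have "la F c' d' u' v' \<cdot>\<^bsub>?D\<^esub>
          (la F c' d' (pa F f' u) (pa F g' v) \<cdot>\<^bsub>?D\<^esub> ?i (lax_2 F f' g' (po F f X, po F g Y))) \<cdot>\<^bsub>?D\<^esub>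
          pa F (f' \<odot> g') (inv_arrow ?D' (lax_2 F f g (X, Y))) \<cdot>\<^bsub>?D\<^esub> ?i (pcomp F (f' \<odot> g') (f \<odot> g) ?P) =
        la F c' d' u' v' \<cdot>\<^bsub>?D\<^esub> la F c' d' (pa F f' u) (pa F g' v) \<cdot>\<^bsub>?D\<^esub>
          (?i (lax_2 F f' g' (po F f X, po F g Y)) \<cdot>\<^bsub>?D\<^esub> pa F (f' \<odot> g') (inv_arrow ?D' (lax_2 F f g (X, Y)))
            \<cdot>\<^bsub>?D\<^esub> ?i (pcomp F (f' \<odot> g') (f \<odot> g) ?P))"
        by simp
      also have "?i (lax_2 F f' g' (po F f X, po F g Y)) \<cdot>\<^bsub>?D\<^esub>
          pa F (f' \<odot> g') (inv_arrow ?D' (lax_2 F f g (X, Y))) \<cdot>\<^bsub>?D\<^esub> ?i (pcomp F (f' \<odot> g') (f \<odot> g) ?P) =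
        la F c' d' ?u ?v \<cdot>\<^bsub>?D\<^esub> ?i (lax_2 F (f' \<cdot> f) (g' \<cdot> g) (X, Y))"
        using inv_lax_2_cmp[of f f' g g' c' d' X Y ?D] by simp
      also have "la F c' d' u' v' \<cdot>\<^bsub>?D\<^esub> la F c' d' (pa F f' u) (pa F g' v) \<cdot>\<^bsub>?D\<^esub>
          la F c' d' ?u ?v \<cdot>\<^bsub>?D\<^esub> ?i (lax_2 F (f' \<cdot> f) (g' \<cdot> g) (X, Y)) =
        (la F c' d' u' v' \<cdot>\<^bsub>?D\<^esub> la F c' d' (pa F f' u) (pa F g' v) \<cdot>\<^bsub>?D\<^esub> la F c' d' ?u ?v) \<cdot>\<^bsub>?D\<^esub>
          ?i (lax_2 F (f' \<cdot> f) (g' \<cdot> g) (X, Y))"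
        by simp
      also have "la F c' d' u' v' \<cdot>\<^bsub>?D\<^esub> la F c' d' (pa F f' u) (pa F g' v) \<cdot>\<^bsub>?D\<^esub> la F c' d' ?u ?v =
        la F c' d' (u' \<cdot>\<^bsub>fib F c'\<^esub> pa F f' u \<cdot>\<^bsub>fib F c'\<^esub> ?u) (v' \<cdot>\<^bsub>fib F d'\<^esub> pa F g' v \<cdot>\<^bsub>fib F d'\<^esub> ?v)"
        by (simp add: la_cmp)
      finally show ?thesis
        by (simp add: E_cmp E_tensor_ar A.tensor_cmp)
    qed
  qed
qed

sublocale E: tensor_category E
  by (intro tensor_category.intro E_category tensor_category_axioms.intro E_tensor_functor)

text \<open>The unit coherence \<open>inv_lax_2_idn\<close> absorbs the \<open>lax_2\<close> of two
  identities, so that on vertical arrows the laxator alone remains.\<close>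

lemma ver_tensor_ver:
  assumes "a \<in> Ob A" "b \<in> Ob A" "u \<in> Ar (fib F a)" "v \<in> Ar (fib F b)"
  shows "ver a u \<odot>\<^bsub>E\<^esub> ver b v = ver (a \<otimes> b) (la F a b u v)"
proof -
  let ?D = "fib F (a \<otimes> b)" and ?X = "Dom (fib F a) u" and ?Y = "Dom (fib F b) v"
  let ?i = "inv_arrow (fib F a) (punit F a ?X)" and ?j = "inv_arrow (fib F b) (punit F b ?Y)"
  have "la F a b (u \<cdot>\<^bsub>fib F a\<^esub> ?i) (v \<cdot>\<^bsub>fib F b\<^esub> ?j) \<cdot>\<^bsub>?D\<^esub>
      inv_arrow ?D (lax_2 F (Idn A a) (Idn A b) (?X, ?Y)) =
    la F a b u v \<cdot>\<^bsub>?D\<^esub> la F a b ?i ?j \<cdot>\<^bsub>?D\<^esub> inv_arrow ?D (lax_2 F (Idn A a) (Idn A b) (?X, ?Y))"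
    using assms by (simp flip: la_cmp)
  also have "\<dots> = la F a b u v \<cdot>\<^bsub>?D\<^esub> inv_arrow ?D (punit F (a \<otimes> b) (lo F a b ?X ?Y))"
    using assms by (simp add: inv_lax_2_idn)
  finally show ?thesis using assms by (simp add: ver_def E_tensor_ar)
qed

text \<open>Tensor counterpart of \<open>lift_cmp_lift\<close>: \<open>lax_2\<close> is the defect
  of the lifts with respect to the tensor product.\<close>

lemma ver_lax_2:
  assumes "f \<in> Ar A" "g \<in> Ar A" "X \<in> Ob (fib F (Dom A f))" "Y \<in> Ob (fib F (Dom A g))"
    "Cod A f = a" "Cod A g = b"
  shows "ver (a \<otimes> b) (lax_2 F f g (X, Y)) \<cdot>\<^bsub>E\<^esub> (lift f X \<odot>\<^bsub>E\<^esub> lift g Y) =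
    lift (f \<odot> g) (lo F (Dom A f) (Dom A g) X Y)"
proof -
  have ab: "a \<in> Ob A" "b \<in> Ob A" using assms by auto
  have "lift f X \<odot>\<^bsub>E\<^esub> lift g Y \<in> Ar E" using assms by simp
  then show ?thesis
    using assms ab by (simp add: lift_def E_tensor_ar ver_cmp_arr)
qed

lemma ver_inv_lax_2:
  assumes "f \<in> Ar A" "g \<in> Ar A" "X \<in> Ob (fib F (Dom A f))" "Y \<in> Ob (fib F (Dom A g))"
    "Cod A f = a" "Cod A g = b"
  shows "ver (a \<otimes> b) (inv_arrow (fib F (a \<otimes> b)) (lax_2 F f g (X, Y))) \<cdot>\<^bsub>E\<^esub>
    lift (f \<odot> g) (lo F (Dom A f) (Dom A g) X Y) = lift f X \<odot>\<^bsub>E\<^esub> lift g Y"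
proof -
  have ab: "a \<in> Ob A" "b \<in> Ob A" using assms by auto
  then show ?thesis
    using assms by (intro ver_inv ver_lax_2) (auto simp: E_tensor_ob)
qed

section \<open>Associator and unitors of the total category\<close>

lemma associator_eq:
  assumes "a \<in> Ob A" "b \<in> Ob A" "c \<in> Ob A" "X \<in> Ob (fib F a)" "Y \<in> Ob (fib F b)" "Z \<in> Ob (fib F c)"
  shows "associator E (a, X) (b, Y) (c, Z) = ver (a \<otimes> (b \<otimes> c)) (lax_assoc F a b c X Y Z) \<cdot>\<^bsub>E\<^esub>
    lift (associator A a b c) (lo F (a \<otimes> b) c (lo F a b X Y) Z)"
  using assms by (simp add: ver_cmp_lift E_associator)

lemma lunitor_eq:
  assumes "a \<in> Ob A" "X \<in> Ob (fib F a)"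
  shows "lunitor E (a, X) = ver a (lax_lunit F a X) \<cdot>\<^bsub>E\<^esub>
    lift (lunitor A a) (lo F (unit_ob A) a (iota F) X)"
  using assms by (simp add: ver_cmp_lift E_lunitor)

lemma runitor_eq:
  assumes "a \<in> Ob A" "X \<in> Ob (fib F a)"
  shows "runitor E (a, X) = ver a (lax_runit F a X) \<cdot>\<^bsub>E\<^esub>
    lift (runitor A a) (lo F a (unit_ob A) X (iota F))"
  using assms by (simp add: ver_cmp_lift E_runitor)

text \<open>The preservation of opcartesian arrows that a monoidal opfibration demands. The fibre
  component of the tensor product is \<open>la\<close> applied to two isomorphisms, after the
  inverse of \<open>lax_2\<close>.\<close>

lemma opcartesian_tensor:
  assumes "opcartesian x" "opcartesian y"
  shows "opcartesian (x \<odot>\<^bsub>E\<^esub> y)"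
proof -
  obtain a u f X where x: "x = ver a u \<cdot>\<^bsub>E\<^esub> lift f X" "f \<in> Ar A" "Cod A f = a"
    "X \<in> Ob (fib F (Dom A f))" "iso_arrow (fib F a) u" "Dom (fib F a) u = po F f X"
    using assms(1) unfolding opcartesian_def by blast
  obtain b v g Y where y: "y = ver b v \<cdot>\<^bsub>E\<^esub> lift g Y" "g \<in> Ar A" "Cod A g = b"
    "Y \<in> Ob (fib F (Dom A g))" "iso_arrow (fib F b) v" "Dom (fib F b) v = po F g Y"
    using assms(2) unfolding opcartesian_def by blast
  have b: "a \<in> Ob A" "b \<in> Ob A" using x y by auto
  have u: "u \<in> Ar (fib F a)" "v \<in> Ar (fib F b)" using x y b category.iso_ar[OF fib_category] by auto
  let ?D = "fib F (a \<otimes> b)"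
  have "opcartesian (ver (a \<otimes> b) (la F a b u v \<cdot>\<^bsub>?D\<^esub> inv_arrow ?D (lax_2 F f g (X, Y))) \<cdot>\<^bsub>E\<^esub>
      lift (f \<odot> g) (lo F (Dom A f) (Dom A g) X Y))"
    by (rule opcartesianI) (use x y b u in auto)
  also have "ver (a \<otimes> b) (la F a b u v \<cdot>\<^bsub>?D\<^esub> inv_arrow ?D (lax_2 F f g (X, Y))) \<cdot>\<^bsub>E\<^esub>
      lift (f \<odot> g) (lo F (Dom A f) (Dom A g) X Y) = (ver a u \<odot>\<^bsub>E\<^esub> ver b v) \<cdot>\<^bsub>E\<^esub> (lift f X \<odot>\<^bsub>E\<^esub> lift g Y)"
    using x y b u by (simp add: ver_cmp ver_inv_lax_2 ver_tensor_ver)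
  finally show ?thesis using x y b u by (simp add: E.tensor_cmp)
qed

text \<open>Both sides of each modification axiom, transported into \<open>E\<close>, are composites of a vertical
  arrow with a tensor product of opcartesian lifts.\<close>

lemma associator_lift:
  assumes "f \<in> Ar A" "g \<in> Ar A" "h \<in> Ar A"
    and "Dom A f = a" "Dom A g = b" "Dom A h = c" "Cod A f = a'" "Cod A g = b'" "Cod A h = c'"
    and "X \<in> Ob (fib F a)" "Y \<in> Ob (fib F b)" "Z \<in> Ob (fib F c)"
  shows "associator E (a', po F f X) (b', po F g Y) (c', po F h Z) \<cdot>\<^bsub>E\<^esub>
      ((lift f X \<odot>\<^bsub>E\<^esub> lift g Y) \<odot>\<^bsub>E\<^esub> lift h Z) =
    (lift f X \<odot>\<^bsub>E\<^esub> (lift g Y \<odot>\<^bsub>E\<^esub> lift h Z)) \<cdot>\<^bsub>E\<^esub> associator E (a, X) (b, Y) (c, Z)"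
proof -
  have o [simp]: "a \<in> Ob A" "b \<in> Ob A" "c \<in> Ob A" "a' \<in> Ob A" "b' \<in> Ob A" "c' \<in> Ob A"
    using assms by auto
  note [simp] = assms E_tensor_ob
  let ?d = "a' \<otimes> (b' \<otimes> c')"
  let ?D = "fib F ?d"
  let ?k = "f \<odot> (g \<odot> h)" and ?k' = "(f \<odot> g) \<odot> h"
  let ?al = "associator A a b c" and ?al' = "associator A a' b' c'"
  let ?L = "lo F (a \<otimes> b) c (lo F a b X Y) Z"
  let ?L1 = "lo F (a' \<otimes> b') c' (lo F a' b' (po F f X) (po F g Y)) (po F h Z)"
  let ?L2 = "lo F (a' \<otimes> b') c' (po F (f \<odot> g) (lo F a b X Y)) (po F h Z)"
  let ?T = "(lift f X \<odot>\<^bsub>E\<^esub> lift g Y) \<odot>\<^bsub>E\<^esub> lift h Z"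
  let ?S = "lift f X \<odot>\<^bsub>E\<^esub> (lift g Y \<odot>\<^bsub>E\<^esub> lift h Z)"
  let ?t1 = "la F (a' \<otimes> b') c' (lax_2 F f g (X, Y)) (Idn (fib F c') (po F h Z))"
  let ?t2 = "lax_2 F (f \<odot> g) h (lo F a b X Y, Z)"
  let ?p1 = "la F a' (b' \<otimes> c') (Idn (fib F a') (po F f X)) (lax_2 F g h (Y, Z))"
  let ?p2 = "lax_2 F f (g \<odot> h) (X, lo F b c Y Z)"
  let ?i = "inv_arrow ?D (pcomp F ?k ?al ?L)"
  have k: "?al' \<cdot> ?k' = ?k \<cdot> ?al"
    using A.associator_natural[of f g h] by simp
  have t1: "ver ((a' \<otimes> b') \<otimes> c') ?t1 \<cdot>\<^bsub>E\<^esub> ?T = lift (f \<odot> g) (lo F a b X Y) \<odot>\<^bsub>E\<^esub> lift h Z"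
    by (simp add: ver_tensor_ver[symmetric] E.tensor_cmp ver_lax_2)
  have p1: "ver ?d ?p1 \<cdot>\<^bsub>E\<^esub> ?S = lift f X \<odot>\<^bsub>E\<^esub> lift (g \<odot> h) (lo F b c Y Z)"
    by (simp add: ver_tensor_ver[symmetric] E.tensor_cmp ver_lax_2)
  \<comment> \<open>Composing with \<open>?p1\<close> and \<open>?p2\<close> completes the fibre
    part to the left side of \<open>lax_assoc_modification\<close>. Both are invertible and are
    cancelled at the end.\<close>
  have "ver ?d ?p2 \<cdot>\<^bsub>E\<^esub> ver ?d ?p1 \<cdot>\<^bsub>E\<^esub> associator E (a', po F f X) (b', po F g Y) (c', po F h Z) \<cdot>\<^bsub>E\<^esub> ?T
    = ver ?d (?p2 \<cdot>\<^bsub>?D\<^esub> ?p1 \<cdot>\<^bsub>?D\<^esub> lax_assoc F a' b' c' (po F f X) (po F g Y) (po F h Z)) \<cdot>\<^bsub>E\<^esub>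
        lift ?al' ?L1 \<cdot>\<^bsub>E\<^esub> ?T"
    by (simp add: ver_cmp associator_eq)
  also have "?p2 \<cdot>\<^bsub>?D\<^esub> ?p1 \<cdot>\<^bsub>?D\<^esub> lax_assoc F a' b' c' (po F f X) (po F g Y) (po F h Z) =
      pa F ?k (lax_assoc F a b c X Y Z) \<cdot>\<^bsub>?D\<^esub> ?i \<cdot>\<^bsub>?D\<^esub> pcomp F ?al' ?k' ?L \<cdot>\<^bsub>?D\<^esub>
      pa F ?al' ?t2 \<cdot>\<^bsub>?D\<^esub> pa F ?al' ?t1"
    by (rule lax_assoc_modification) (simp_all add: hom_iff)
  also have "ver ?d \<dots> \<cdot>\<^bsub>E\<^esub> lift ?al' ?L1 \<cdot>\<^bsub>E\<^esub> ?T =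
      ver ?d (pa F ?k (lax_assoc F a b c X Y Z)) \<cdot>\<^bsub>E\<^esub> ver ?d ?i \<cdot>\<^bsub>E\<^esub>
      ver ?d (pcomp F ?al' ?k' ?L) \<cdot>\<^bsub>E\<^esub> ver ?d (pa F ?al' ?t2) \<cdot>\<^bsub>E\<^esub>
      ver ?d (pa F ?al' ?t1) \<cdot>\<^bsub>E\<^esub> lift ?al' ?L1 \<cdot>\<^bsub>E\<^esub> ?T"
    by (simp add: ver_cmp k)
  also have "ver ?d (pa F ?al' ?t1) \<cdot>\<^bsub>E\<^esub> lift ?al' ?L1 \<cdot>\<^bsub>E\<^esub> ?T =
      lift ?al' ?L2 \<cdot>\<^bsub>E\<^esub> (lift (f \<odot> g) (lo F a b X Y) \<odot>\<^bsub>E\<^esub> lift h Z)"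
    by (subst ver_pa_slide[where a = "(a' \<otimes> b') \<otimes> c'" and Y = ?L2]) (simp_all add: t1)
  also have "ver ?d (pa F ?al' ?t2) \<cdot>\<^bsub>E\<^esub> \<dots> = lift ?al' (po F ?k' ?L) \<cdot>\<^bsub>E\<^esub> lift ?k' ?L"
    by (subst ver_pa_slide[where a = "(a' \<otimes> b') \<otimes> c'" and Y = "po F ?k' ?L"]) (simp_all add: ver_lax_2)
  also have "ver ?d (pcomp F ?al' ?k' ?L) \<cdot>\<^bsub>E\<^esub> \<dots> = lift (?k \<cdot> ?al) ?L"
    by (simp add: ver_pcomp flip: k)
  also have "ver ?d ?i \<cdot>\<^bsub>E\<^esub> \<dots> = lift ?k (po F ?al ?L) \<cdot>\<^bsub>E\<^esub> lift ?al ?L"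
    by (rule ver_inv_pcomp) simp_all
  also have "ver ?d (pa F ?k (lax_assoc F a b c X Y Z)) \<cdot>\<^bsub>E\<^esub> \<dots> =
      lift ?k (lo F a (b \<otimes> c) X (lo F b c Y Z)) \<cdot>\<^bsub>E\<^esub> associator E (a, X) (b, Y) (c, Z)"
    by (subst ver_pa_slide[where a = "a \<otimes> (b \<otimes> c)" and Y = "lo F a (b \<otimes> c) X (lo F b c Y Z)"])
      (simp_all add: associator_eq)
  also have "lift ?k (lo F a (b \<otimes> c) X (lo F b c Y Z)) = ver ?d ?p2 \<cdot>\<^bsub>E\<^esub> ver ?d ?p1 \<cdot>\<^bsub>E\<^esub> ?S"
    by (simp add: p1 ver_lax_2)
  finally have "ver ?d ?p2 \<cdot>\<^bsub>E\<^esub> ver ?d ?p1 \<cdot>\<^bsub>E\<^esub>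
      associator E (a', po F f X) (b', po F g Y) (c', po F h Z) \<cdot>\<^bsub>E\<^esub> ?T =
    ver ?d ?p2 \<cdot>\<^bsub>E\<^esub> ver ?d ?p1 \<cdot>\<^bsub>E\<^esub> ?S \<cdot>\<^bsub>E\<^esub> associator E (a, X) (b, Y) (c, Z)"
    by (simp add: associator_eq)
  then have "ver ?d ?p1 \<cdot>\<^bsub>E\<^esub> associator E (a', po F f X) (b', po F g Y) (c', po F h Z) \<cdot>\<^bsub>E\<^esub> ?T =
    ver ?d ?p1 \<cdot>\<^bsub>E\<^esub> ?S \<cdot>\<^bsub>E\<^esub> associator E (a, X) (b, Y) (c, Z)"
    by (rule E.iso_cancel_left) (simp_all add: iso_ver associator_eq)
  then show ?thesis
    by (rule E.iso_cancel_left) (simp_all add: iso_ver associator_eq)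
qed

lemma associator_E_ar [simp]:
  assumes "p \<in> Ob E" "q \<in> Ob E" "r \<in> Ob E"
  shows "associator E p q r \<in> Ar E" "Dom E (associator E p q r) = (p \<otimes>\<^bsub>E\<^esub> q) \<otimes>\<^bsub>E\<^esub> r"
    "Cod E (associator E p q r) = p \<otimes>\<^bsub>E\<^esub> (q \<otimes>\<^bsub>E\<^esub> r)"
  using assms by (cases p; cases q; cases r; simp add: associator_eq E_tensor_ob)+

lemma associator_ver:
  assumes "a \<in> Ob A" "b \<in> Ob A" "c \<in> Ob A" "u \<in> Ar (fib F a)" "v \<in> Ar (fib F b)" "w \<in> Ar (fib F c)"
    "Dom (fib F a) u = X" "Dom (fib F b) v = Y" "Dom (fib F c) w = Z"
    "Cod (fib F a) u = X'" "Cod (fib F b) v = Y'" "Cod (fib F c) w = Z'"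
  shows "associator E (a, X') (b, Y') (c, Z') \<cdot>\<^bsub>E\<^esub> ((ver a u \<odot>\<^bsub>E\<^esub> ver b v) \<odot>\<^bsub>E\<^esub> ver c w) =
    (ver a u \<odot>\<^bsub>E\<^esub> (ver b v \<odot>\<^bsub>E\<^esub> ver c w)) \<cdot>\<^bsub>E\<^esub> associator E (a, X) (b, Y) (c, Z)"
proof -
  have o [simp]: "X \<in> Ob (fib F a)" "Y \<in> Ob (fib F b)" "Z \<in> Ob (fib F c)"
    "X' \<in> Ob (fib F a)" "Y' \<in> Ob (fib F b)" "Z' \<in> Ob (fib F c)"
    using assms by auto
  note [simp] = assms
  let ?d = "a \<otimes> (b \<otimes> c)" and ?al = "associator A a b c"
  have "associator E (a, X') (b, Y') (c, Z') \<cdot>\<^bsub>E\<^esub> ((ver a u \<odot>\<^bsub>E\<^esub> ver b v) \<odot>\<^bsub>E\<^esub> ver c w) =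
      ver ?d (lax_assoc F a b c X' Y' Z' \<cdot>\<^bsub>fib F ?d\<^esub> pa F ?al (la F (a \<otimes> b) c (la F a b u v) w)) \<cdot>\<^bsub>E\<^esub>
      lift ?al (lo F (a \<otimes> b) c (lo F a b X Y) Z)"
    by (simp add: associator_eq ver_tensor_ver lift_cmp_ver ver_cmp)
  also have "\<dots> = ver ?d (la F a (b \<otimes> c) u (la F b c v w) \<cdot>\<^bsub>fib F ?d\<^esub> lax_assoc F a b c X Y Z) \<cdot>\<^bsub>E\<^esub>
      lift ?al (lo F (a \<otimes> b) c (lo F a b X Y) Z)"
    using lax_assoc_natural[of a b c u v w "fib F ?d"] by simp
  also have "\<dots> = (ver a u \<odot>\<^bsub>E\<^esub> (ver b v \<odot>\<^bsub>E\<^esub> ver c w)) \<cdot>\<^bsub>E\<^esub> associator E (a, X) (b, Y) (c, Z)"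
    by (simp add: associator_eq ver_tensor_ver ver_cmp)
  finally show ?thesis .
qed

text \<open>Factoring each argument splits the naturality square into one for vertical arrows, where
  it is naturality of \<open>lax_assoc\<close> in the fibres, and one for lifts, where it is the
  modification axiom.\<close>

lemma E_associator_natural:
  assumes "x \<in> Ar E" "y \<in> Ar E" "z \<in> Ar E"
  shows "associator E (Cod E x) (Cod E y) (Cod E z) \<cdot>\<^bsub>E\<^esub> ((x \<odot>\<^bsub>E\<^esub> y) \<odot>\<^bsub>E\<^esub> z) =
    (x \<odot>\<^bsub>E\<^esub> (y \<odot>\<^bsub>E\<^esub> z)) \<cdot>\<^bsub>E\<^esub> associator E (Dom E x) (Dom E y) (Dom E z)"
  using assms(1)
proof (cases rule: arr_cases)
  case x: (1 a u f X)
  show ?thesis using assms(2)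
  proof (cases rule: arr_cases)
    case y: (1 b v g Y)
    show ?thesis using assms(3)
    proof (cases rule: arr_cases)
      case z: (1 c w h Z)
      note [simp] = x(2-) y(2-) z(2-)
      let ?v = "(ver a u \<odot>\<^bsub>E\<^esub> ver b v) \<odot>\<^bsub>E\<^esub> ver c w" and ?l = "(lift f X \<odot>\<^bsub>E\<^esub> lift g Y) \<odot>\<^bsub>E\<^esub> lift h Z"
      let ?v' = "ver a u \<odot>\<^bsub>E\<^esub> (ver b v \<odot>\<^bsub>E\<^esub> ver c w)" and ?l' = "lift f X \<odot>\<^bsub>E\<^esub> (lift g Y \<odot>\<^bsub>E\<^esub> lift h Z)"
      let ?m = "associator E (a, po F f X) (b, po F g Y) (c, po F h Z)"
      have "(x \<odot>\<^bsub>E\<^esub> y) \<odot>\<^bsub>E\<^esub> z = ?v \<cdot>\<^bsub>E\<^esub> ?l" "x \<odot>\<^bsub>E\<^esub> (y \<odot>\<^bsub>E\<^esub> z) = ?v' \<cdot>\<^bsub>E\<^esub> ?l'"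
        by (simp_all add: E.tensor_cmp x(1) y(1) z(1))
      moreover have "associator E (Cod E x) (Cod E y) (Cod E z) \<cdot>\<^bsub>E\<^esub> ?v = ?v' \<cdot>\<^bsub>E\<^esub> ?m"
        by (simp add: x(1) y(1) z(1)) (rule associator_ver, simp_all)
      moreover have "?m \<cdot>\<^bsub>E\<^esub> ?l = ?l' \<cdot>\<^bsub>E\<^esub> associator E (Dom E x) (Dom E y) (Dom E z)"
        by (simp add: x(1) y(1) z(1)) (rule associator_lift, simp_all)
      ultimately show ?thesis
        using E.cmp_tail[of "associator E (Cod E x) (Cod E y) (Cod E z)" ?v "?v' \<cdot>\<^bsub>E\<^esub> ?m" ?l]
        by (simp add: E_tensor_ob x(1) y(1) z(1))
    qed
  qed
qed

lemma unit_E_in [simp]: "unit_ob E \<in> Ob E"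
  by (simp add: E_unit)

lemma unitor_E_ar [simp]:
  assumes "p \<in> Ob E"
  shows "lunitor E p \<in> Ar E" "Dom E (lunitor E p) = unit_ob E \<otimes>\<^bsub>E\<^esub> p" "Cod E (lunitor E p) = p"
    "runitor E p \<in> Ar E" "Dom E (runitor E p) = p \<otimes>\<^bsub>E\<^esub> unit_ob E" "Cod E (runitor E p) = p"
  using assms by (cases p; simp add: lunitor_eq runitor_eq E_tensor_ob E_unit)+

text \<open>The same splitting as for the associator, carried out in one calculation:
  \<open>lax_lunit_natural\<close> handles the vertical part \<open>u\<close> and
  \<open>lax_lunit_modification\<close> the lift of \<open>f\<close>.\<close>

lemma E_lunitor_natural:
  assumes "x \<in> Ar E"
  shows "lunitor E (Cod E x) \<cdot>\<^bsub>E\<^esub> (Idn E (unit_ob E) \<odot>\<^bsub>E\<^esub> x) = x \<cdot>\<^bsub>E\<^esub> lunitor E (Dom E x)"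
  using assms
proof (cases rule: arr_cases)
  case x: (1 b u f X)
  define a where "a = Dom A f"
  note [simp] = x(2-) E_tensor_ob a_def[symmetric]
  have a [simp]: "a \<in> Ob A" "X \<in> Ob (fib F a)" using x by (auto simp: a_def simp del: a_def[symmetric])
  let ?I = "unit_ob A" and ?D = "fib F b"
  let ?one = "Idn A ?I" and ?one' = "Idn (fib F ?I) (iota F)"
  let ?L = "lo F ?I a (iota F) X" and ?L' = "lo F ?I b (iota F) (po F f X)"
  let ?t1 = "la F ?I b (punit F ?I (iota F)) (Idn ?D (po F f X))"
  let ?t2 = "lax_2 F ?one f (iota F, X)"
  let ?la = "lunitor A a" and ?la' = "lunitor A b"
  have k: "?la' \<cdot> (?one \<odot> f) = f \<cdot> ?la" using A.lunitor_natural[of f] by simp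
  have u: "Idn E (?I, iota F) = ver ?I ?one'" by simp
  have e: "Idn E (?I, iota F) \<odot>\<^bsub>E\<^esub> x = ver (?I \<otimes> b) (la F ?I b ?one' u) \<cdot>\<^bsub>E\<^esub> (Idn E (?I, iota F) \<odot>\<^bsub>E\<^esub> lift f X)"
    by (simp add: x(1) ver_tensor_ver[symmetric] E.tensor_cmp)
  have "lunitor E (Cod E x) \<cdot>\<^bsub>E\<^esub> (Idn E (unit_ob E) \<odot>\<^bsub>E\<^esub> x) =
      ver b (lax_lunit F b (Cod ?D u)) \<cdot>\<^bsub>E\<^esub> (lift ?la' (lo F ?I b (iota F) (Cod ?D u)) \<cdot>\<^bsub>E\<^esub>
        ver (?I \<otimes> b) (la F ?I b ?one' u)) \<cdot>\<^bsub>E\<^esub> (Idn E (?I, iota F) \<odot>\<^bsub>E\<^esub> lift f X)"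
    unfolding E_unit e by (simp add: x(1) lunitor_eq)
  also have "lift ?la' (lo F ?I b (iota F) (Cod ?D u)) \<cdot>\<^bsub>E\<^esub> ver (?I \<otimes> b) (la F ?I b ?one' u) =
      ver b (pa F ?la' (la F ?I b ?one' u)) \<cdot>\<^bsub>E\<^esub> lift ?la' ?L'"
    by (simp add: lift_cmp_ver)
  also have "ver b (lax_lunit F b (Cod ?D u)) \<cdot>\<^bsub>E\<^esub> (ver b (pa F ?la' (la F ?I b ?one' u)) \<cdot>\<^bsub>E\<^esub> lift ?la' ?L') \<cdot>\<^bsub>E\<^esub>
      (Idn E (?I, iota F) \<odot>\<^bsub>E\<^esub> lift f X) =
    ver b (lax_lunit F b (Cod ?D u) \<cdot>\<^bsub>?D\<^esub> pa F ?la' (la F ?I b ?one' u)) \<cdot>\<^bsub>E\<^esub> lift ?la' ?L' \<cdot>\<^bsub>E\<^esub>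
      (Idn E (?I, iota F) \<odot>\<^bsub>E\<^esub> lift f X)"
    by (simp add: ver_cmp)
  also have "lax_lunit F b (Cod ?D u) \<cdot>\<^bsub>?D\<^esub> pa F ?la' (la F ?I b ?one' u) = u \<cdot>\<^bsub>?D\<^esub> lax_lunit F b (po F f X)"
    by (simp add: lax_lunit_natural)
  also have "lax_lunit F b (po F f X) = pa F f (lax_lunit F a X) \<cdot>\<^bsub>?D\<^esub>
      inv_arrow ?D (pcomp F f ?la ?L) \<cdot>\<^bsub>?D\<^esub> pcomp F ?la' (?one \<odot> f) ?L \<cdot>\<^bsub>?D\<^esub> pa F ?la' ?t2 \<cdot>\<^bsub>?D\<^esub> pa F ?la' ?t1"
    by (rule lax_lunit_modification) (simp_all add: hom_iff)
  also have "ver b (u \<cdot>\<^bsub>?D\<^esub> \<dots>) \<cdot>\<^bsub>E\<^esub> lift ?la' ?L' \<cdot>\<^bsub>E\<^esub> (Idn E (?I, iota F) \<odot>\<^bsub>E\<^esub> lift f X) =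
      ver b u \<cdot>\<^bsub>E\<^esub> ver b (pa F f (lax_lunit F a X)) \<cdot>\<^bsub>E\<^esub> ver b (inv_arrow ?D (pcomp F f ?la ?L)) \<cdot>\<^bsub>E\<^esub>
      ver b (pcomp F ?la' (?one \<odot> f) ?L) \<cdot>\<^bsub>E\<^esub> ver b (pa F ?la' ?t2) \<cdot>\<^bsub>E\<^esub> ver b (pa F ?la' ?t1) \<cdot>\<^bsub>E\<^esub>
      lift ?la' ?L' \<cdot>\<^bsub>E\<^esub> (Idn E (?I, iota F) \<odot>\<^bsub>E\<^esub> lift f X)"
    by (simp add: ver_cmp k)
  \<comment> \<open>The factor \<open>?t1\<close> contains \<open>punit\<close>, which by
    \<open>ver_punit\<close> turns the identity of the unit object into a lift of
    \<open>?one\<close>. Only then is the tensor product one of two lifts, as \<open>lax_2\<close>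
    requires.\<close>
  also have "ver b (pa F ?la' ?t1) \<cdot>\<^bsub>E\<^esub> lift ?la' ?L' \<cdot>\<^bsub>E\<^esub> (Idn E (?I, iota F) \<odot>\<^bsub>E\<^esub> lift f X) =
      lift ?la' (lo F ?I b (po F ?one (iota F)) (po F f X)) \<cdot>\<^bsub>E\<^esub> (lift ?one (iota F) \<odot>\<^bsub>E\<^esub> lift f X)"
    by (subst ver_pa_slide[where a = "?I \<otimes> b" and Y = "lo F ?I b (po F ?one (iota F)) (po F f X)"])
      (simp_all add: ver_tensor_ver[symmetric] E.tensor_cmp ver_punit)
  also have "ver b (pa F ?la' ?t2) \<cdot>\<^bsub>E\<^esub> \<dots> = lift ?la' (po F (?one \<odot> f) ?L) \<cdot>\<^bsub>E\<^esub> lift (?one \<odot> f) ?L"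
    by (subst ver_pa_slide[where a = "?I \<otimes> b" and Y = "po F (?one \<odot> f) ?L"]) (simp_all add: ver_lax_2)
  also have "ver b (pcomp F ?la' (?one \<odot> f) ?L) \<cdot>\<^bsub>E\<^esub> \<dots> = lift (f \<cdot> ?la) ?L"
    by (simp add: ver_pcomp flip: k)
  also have "ver b (inv_arrow ?D (pcomp F f ?la ?L)) \<cdot>\<^bsub>E\<^esub> \<dots> = lift f (po F ?la ?L) \<cdot>\<^bsub>E\<^esub> lift ?la ?L"
    by (rule ver_inv_pcomp) simp_all
  also have "ver b (pa F f (lax_lunit F a X)) \<cdot>\<^bsub>E\<^esub> \<dots> = lift f X \<cdot>\<^bsub>E\<^esub> lunitor E (a, X)"
    by (subst ver_pa_slide[where a = a and Y = X]) (simp_all add: lunitor_eq)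
  finally show ?thesis by (simp add: x(1))
qed

text \<open>Mirror image of \<open>E_lunitor_natural\<close>.\<close>

lemma E_runitor_natural:
  assumes "x \<in> Ar E"
  shows "runitor E (Cod E x) \<cdot>\<^bsub>E\<^esub> (x \<odot>\<^bsub>E\<^esub> Idn E (unit_ob E)) = x \<cdot>\<^bsub>E\<^esub> runitor E (Dom E x)"
  using assms
proof (cases rule: arr_cases)
  case x: (1 b u f X)
  define a where "a = Dom A f"
  note [simp] = x(2-) E_tensor_ob a_def[symmetric]
  have a [simp]: "a \<in> Ob A" "X \<in> Ob (fib F a)" using x by (auto simp: a_def simp del: a_def[symmetric])
  let ?I = "unit_ob A" and ?D = "fib F b"
  let ?one = "Idn A ?I" and ?one' = "Idn (fib F ?I) (iota F)"
  let ?L = "lo F a ?I X (iota F)" and ?L' = "lo F b ?I (po F f X) (iota F)"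
  let ?t1 = "la F b ?I (Idn ?D (po F f X)) (punit F ?I (iota F))"
  let ?t2 = "lax_2 F f ?one (X, iota F)"
  let ?la = "runitor A a" and ?la' = "runitor A b"
  have k: "?la' \<cdot> (f \<odot> ?one) = f \<cdot> ?la" using A.runitor_natural[of f] by simp
  have e: "x \<odot>\<^bsub>E\<^esub> Idn E (?I, iota F) = ver (b \<otimes> ?I) (la F b ?I u ?one') \<cdot>\<^bsub>E\<^esub> (lift f X \<odot>\<^bsub>E\<^esub> Idn E (?I, iota F))"
    by (simp add: x(1) ver_tensor_ver[symmetric] E.tensor_cmp)
  have "runitor E (Cod E x) \<cdot>\<^bsub>E\<^esub> (x \<odot>\<^bsub>E\<^esub> Idn E (unit_ob E)) =
      ver b (lax_runit F b (Cod ?D u)) \<cdot>\<^bsub>E\<^esub> (lift ?la' (lo F b ?I (Cod ?D u) (iota F)) \<cdot>\<^bsub>E\<^esub>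
        ver (b \<otimes> ?I) (la F b ?I u ?one')) \<cdot>\<^bsub>E\<^esub> (lift f X \<odot>\<^bsub>E\<^esub> Idn E (?I, iota F))"
    unfolding E_unit e by (simp add: x(1) runitor_eq)
  also have "lift ?la' (lo F b ?I (Cod ?D u) (iota F)) \<cdot>\<^bsub>E\<^esub> ver (b \<otimes> ?I) (la F b ?I u ?one') =
      ver b (pa F ?la' (la F b ?I u ?one')) \<cdot>\<^bsub>E\<^esub> lift ?la' ?L'"
    by (simp add: lift_cmp_ver)
  also have "ver b (lax_runit F b (Cod ?D u)) \<cdot>\<^bsub>E\<^esub> (ver b (pa F ?la' (la F b ?I u ?one')) \<cdot>\<^bsub>E\<^esub> lift ?la' ?L') \<cdot>\<^bsub>E\<^esub>
      (lift f X \<odot>\<^bsub>E\<^esub> Idn E (?I, iota F)) =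
    ver b (lax_runit F b (Cod ?D u) \<cdot>\<^bsub>?D\<^esub> pa F ?la' (la F b ?I u ?one')) \<cdot>\<^bsub>E\<^esub> lift ?la' ?L' \<cdot>\<^bsub>E\<^esub>
      (lift f X \<odot>\<^bsub>E\<^esub> Idn E (?I, iota F))"
    by (simp add: ver_cmp)
  also have "lax_runit F b (Cod ?D u) \<cdot>\<^bsub>?D\<^esub> pa F ?la' (la F b ?I u ?one') = u \<cdot>\<^bsub>?D\<^esub> lax_runit F b (po F f X)"
    by (simp add: lax_runit_natural)
  also have "lax_runit F b (po F f X) = pa F f (lax_runit F a X) \<cdot>\<^bsub>?D\<^esub>
      inv_arrow ?D (pcomp F f ?la ?L) \<cdot>\<^bsub>?D\<^esub> pcomp F ?la' (f \<odot> ?one) ?L \<cdot>\<^bsub>?D\<^esub> pa F ?la' ?t2 \<cdot>\<^bsub>?D\<^esub> pa F ?la' ?t1"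
    by (rule lax_runit_modification) (simp_all add: hom_iff)
  also have "ver b (u \<cdot>\<^bsub>?D\<^esub> \<dots>) \<cdot>\<^bsub>E\<^esub> lift ?la' ?L' \<cdot>\<^bsub>E\<^esub> (lift f X \<odot>\<^bsub>E\<^esub> Idn E (?I, iota F)) =
      ver b u \<cdot>\<^bsub>E\<^esub> ver b (pa F f (lax_runit F a X)) \<cdot>\<^bsub>E\<^esub> ver b (inv_arrow ?D (pcomp F f ?la ?L)) \<cdot>\<^bsub>E\<^esub>
      ver b (pcomp F ?la' (f \<odot> ?one) ?L) \<cdot>\<^bsub>E\<^esub> ver b (pa F ?la' ?t2) \<cdot>\<^bsub>E\<^esub> ver b (pa F ?la' ?t1) \<cdot>\<^bsub>E\<^esub>
      lift ?la' ?L' \<cdot>\<^bsub>E\<^esub> (lift f X \<odot>\<^bsub>E\<^esub> Idn E (?I, iota F))"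
    by (simp add: ver_cmp k)
  also have "ver b (pa F ?la' ?t1) \<cdot>\<^bsub>E\<^esub> lift ?la' ?L' \<cdot>\<^bsub>E\<^esub> (lift f X \<odot>\<^bsub>E\<^esub> Idn E (?I, iota F)) =
      lift ?la' (lo F b ?I (po F f X) (po F ?one (iota F))) \<cdot>\<^bsub>E\<^esub> (lift f X \<odot>\<^bsub>E\<^esub> lift ?one (iota F))"
    by (subst ver_pa_slide[where a = "b \<otimes> ?I" and Y = "lo F b ?I (po F f X) (po F ?one (iota F))"])
      (simp_all add: ver_tensor_ver[symmetric] E.tensor_cmp ver_punit)
  also have "ver b (pa F ?la' ?t2) \<cdot>\<^bsub>E\<^esub> \<dots> = lift ?la' (po F (f \<odot> ?one) ?L) \<cdot>\<^bsub>E\<^esub> lift (f \<odot> ?one) ?L"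
    by (subst ver_pa_slide[where a = "b \<otimes> ?I" and Y = "po F (f \<odot> ?one) ?L"]) (simp_all add: ver_lax_2)
  also have "ver b (pcomp F ?la' (f \<odot> ?one) ?L) \<cdot>\<^bsub>E\<^esub> \<dots> = lift (f \<cdot> ?la) ?L"
    by (simp add: ver_pcomp flip: k)
  also have "ver b (inv_arrow ?D (pcomp F f ?la ?L)) \<cdot>\<^bsub>E\<^esub> \<dots> = lift f (po F ?la ?L) \<cdot>\<^bsub>E\<^esub> lift ?la ?L"
    by (rule ver_inv_pcomp) simp_all
  also have "ver b (pa F f (lax_runit F a X)) \<cdot>\<^bsub>E\<^esub> \<dots> = lift f X \<cdot>\<^bsub>E\<^esub> runitor E (a, X)"
    by (subst ver_pa_slide[where a = a and Y = X]) (simp_all add: runitor_eq)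
  finally show ?thesis by (simp add: x(1))
qed

end

section \<open>Monoids in the total category\<close>

context groth_category
begin

lemma base_cmp [simp]: "base (y \<cdot>\<^bsub>E\<^esub> x) = base y \<cdot> base x"
  by (cases x rule: groth_arr_exhaust; cases y rule: groth_arr_exhaust) (simp add: E_cmp)

lemma base_idn [simp]: "base (Idn E p) = Idn B (fst p)"
  by (cases p) (simp add: E_idn)

lemma base_ver [simp]: "base (ver a u) = Idn B a"
  and base_lift [simp]: "base (lift f X) = f"
  by (simp_all add: ver_def lift_def)

text \<open>An identity of \<open>E\<close> is a lift of an identity corrected by the inverse of
  \<open>punit\<close>, hence of the required form.\<close>

lemma opcartesian_idn: "p \<in> Ob E \<Longrightarrow> opcartesian (Idn E p)"
proof (cases p)
  case (Pair a X)
  moreover assume "p \<in> Ob E"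
  ultimately have "a \<in> Ob B" "X \<in> Ob (fib F a)" by auto
  moreover from this have "opcartesian (ver a (inv_arrow (fib F a) (punit F a X)) \<cdot>\<^bsub>E\<^esub> lift (Idn B a) X)"
    by (intro opcartesianI) auto
  ultimately show ?thesis using Pair by (simp add: ver_inv_punit)
qed

text \<open>Both vertical arrows lie over the same identity, so the side condition of
  \<open>opcartesian_cancel\<close> is automatic. This turns equations in the total category into
  equations in one fibre.\<close>

lemma ver_opcartesian_eq:
  assumes "opcartesian c" "Cod E c = (b, Y)" "u \<in> Ar (fib F b)" "v \<in> Ar (fib F b)"
    "Dom (fib F b) u = Y" "Dom (fib F b) v = Y"
  shows "ver b u \<cdot>\<^bsub>E\<^esub> c = ver b v \<cdot>\<^bsub>E\<^esub> c \<longleftrightarrow> u = v"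
proof
  assume e: "ver b u \<cdot>\<^bsub>E\<^esub> c = ver b v \<cdot>\<^bsub>E\<^esub> c"
  have b: "b \<in> Ob B" using E.cod_in[OF opcartesian_ar[OF assms(1)]] assms(2) by simp
  have "ver b u = ver b v"
    by (rule opcartesian_cancel[OF assms(1) e]) (use assms b in auto)
  then show "u = v" using ver_inject assms b by blast
qed simp

end

context weakly_lax_monoidal_pseudofunctor
begin

section \<open>The strict projection and the \<open>hat\<close> structure on the fibres\<close>

lemma base_tensor [simp]: "base (x \<odot>\<^bsub>E\<^esub> y) = base x \<odot> base y"
  by (cases x rule: groth_arr_exhaust; cases y rule: groth_arr_exhaust) (simp add: E_tensor_ar)

lemma base_associator [simp]: "base (associator E p q r) = associator A (fst p) (fst q) (fst r)"
  by (cases p; cases q; cases r) (simp add: E_associator)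

lemma base_unitors [simp]: "base (lunitor E p) = lunitor A (fst p)" "base (runitor E p) = runitor A (fst p)"
  by (cases p; simp add: E_lunitor E_runitor)+

lemma hat_sel [simp]:
  "Ob (hat_ob A F a) = Ob (fib F (fst a))" "Ar (hat_ob A F a) = Ar (fib F (fst a))"
  "Dom (hat_ob A F a) = Dom (fib F (fst a))" "Cod (hat_ob A F a) = Cod (fib F (fst a))"
  "Idn (hat_ob A F a) = Idn (fib F (fst a))" "Cmp (hat_ob A F a) = Cmp (fib F (fst a))"
  by (cases a; simp add: hat_ob_def Let_def cat.defs moncat.defs)+

lemma inverse_hat [simp]:
  "inverse_arrows (hat_ob A F a) = inverse_arrows (fib F (fst a))"
  "iso_arrow (hat_ob A F a) = iso_arrow (fib F (fst a))"
  "inv_arrow (hat_ob A F a) = inv_arrow (fib F (fst a))"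
  by (auto simp: fun_eq_iff inverse_arrows_def iso_arrow_def inv_arrow_def hom_iff)

lemma hat_tensor_ob: "X \<otimes>\<^bsub>hat_ob A F (M, m, e)\<^esub> Y = po F m (lo F M M X Y)"
  and hat_tensor_ar: "u \<odot>\<^bsub>hat_ob A F (M, m, e)\<^esub> v = pa F m (la F M M u v)"
  and hat_unit: "unit_ob (hat_ob A F (M, m, e)) = po F e (iota F)"
  by (simp_all add: hat_ob_def Let_def cat.defs moncat.defs)

lemma hat_tensor_category:
  assumes "monoid_data A a"
  shows "tensor_category (hat_ob A F a)"
proof -
  obtain M m e where a: "a = (M, m, e)" by (cases a)
  have [simp]: "M \<in> Ob A" "m \<in> Ar A" "Dom A m = M \<otimes> M" "Cod A m = M"
    using assms by (auto simp: a hom_iff)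
  let ?H = "hat_ob A F (M, m, e)"
  have H: "category ?H"
    by unfold_locales (auto simp: hom_iff)
  interpret HH: category "?H \<times>\<^sub>C ?H" by (rule prod_category; rule H)
  interpret H: category ?H by (rule H)
  have "is_functor (?H \<times>\<^sub>C ?H) ?H (tensor ?H)"
  proof
    show "obj_map (tensor ?H) p \<in> Ob ?H" if "p \<in> Ob (?H \<times>\<^sub>C ?H)" for p
      using that by (auto simp: hat_tensor_ob)
    show "arr_map (tensor ?H) p \<in> hom ?H (obj_map (tensor ?H) q) (obj_map (tensor ?H) r)"
      if "p \<in> hom (?H \<times>\<^sub>C ?H) q r" for p q r
      using that by (cases p) (auto simp: hat_tensor_ob hat_tensor_ar hom_iff)
    show "arr_map (tensor ?H) (Idn (?H \<times>\<^sub>C ?H) p) = Idn ?H (obj_map (tensor ?H) p)"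
      if "p \<in> Ob (?H \<times>\<^sub>C ?H)" for p
      using that by (auto simp: hat_tensor_ob hat_tensor_ar)
    show "arr_map (tensor ?H) (q \<cdot>\<^bsub>?H \<times>\<^sub>C ?H\<^esub> p) = arr_map (tensor ?H) q \<cdot>\<^bsub>?H\<^esub> arr_map (tensor ?H) p"
      if "p \<in> hom (?H \<times>\<^sub>C ?H) r s" "q \<in> hom (?H \<times>\<^sub>C ?H) s t" for p q r s t
      using that by (cases p; cases q) (auto simp: hat_tensor_ar hom_iff la_cmp[symmetric] pa_cmp)
  qed
  then show ?thesis
    unfolding a by (intro tensor_category.intro tensor_category_axioms.intro H)
qed

text \<open>Applied to the opcartesian arrow on the left, the factors of the associator of \<open>hat\<close> are absorbed
  one by one, each by the composition or tensor law of lifts that it witnesses.\<close>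

lemma hat_associator:
  fixes M m e X Y Z
  defines "H \<equiv> hat_ob A F (M, m, e)"
  assumes m [simp]: "M \<in> Ob A" "m \<in> Ar A" "Dom A m = M \<otimes> M" "Cod A m = M"
    and m_assoc: "m \<cdot> (m \<odot> Idn A M) = m \<cdot> (Idn A M \<odot> m) \<cdot> associator A M M M"
    and o [simp]: "X \<in> Ob (fib F M)" "Y \<in> Ob (fib F M)" "Z \<in> Ob (fib F M)"
  shows "associator H X Y Z \<in> Ar (fib F M)" (is ?ar)
    "Dom (fib F M) (associator H X Y Z) = (X \<otimes>\<^bsub>H\<^esub> Y) \<otimes>\<^bsub>H\<^esub> Z" (is ?dom)
    "Cod (fib F M) (associator H X Y Z) = X \<otimes>\<^bsub>H\<^esub> (Y \<otimes>\<^bsub>H\<^esub> Z)" (is ?cod)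
    "ver M (associator H X Y Z) \<cdot>\<^bsub>E\<^esub> lift m (lo F M M (po F m (lo F M M X Y)) Z) \<cdot>\<^bsub>E\<^esub>
        (lift m (lo F M M X Y) \<odot>\<^bsub>E\<^esub> Idn E (M, Z)) =
      lift m (lo F M M X (po F m (lo F M M Y Z))) \<cdot>\<^bsub>E\<^esub>
        (Idn E (M, X) \<odot>\<^bsub>E\<^esub> lift m (lo F M M Y Z)) \<cdot>\<^bsub>E\<^esub> associator E (M, X) (M, Y) (M, Z)" (is ?eq)
proof -
  note [simp] = E_tensor_ob
  let ?D = "fib F M" and ?D2 = "fib F (M \<otimes> M)" and ?one = "Idn A M" and ?al = "associator A M M M"
  let ?n = "m \<cdot> (?one \<odot> m)"
  let ?P = "lo F M M X Y" and ?Q = "lo F M M Y Z"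
  let ?L = "lo F (M \<otimes> M) M ?P Z" and ?R = "lo F M (M \<otimes> M) X ?Q"
  let ?u1 = "la F M M (Idn ?D (po F m ?P)) (punit F M Z)"
  let ?u2 = "lax_2 F m ?one (?P, Z)"
  let ?u3 = "pcomp F m (m \<odot> ?one) ?L"
  let ?u4 = "inv_arrow ?D (pcomp F ?n ?al ?L)"
  let ?u5 = "lax_assoc F M M M X Y Z"
  let ?u6 = "inv_arrow ?D (pcomp F m (?one \<odot> m) ?R)"
  let ?u7 = "inv_arrow ?D2 (lax_2 F ?one m (X, ?Q))"
  let ?u8 = "la F M M (inv_arrow ?D (punit F M X)) (Idn ?D (po F m ?Q))"
  let ?T = "lift m ?P \<odot>\<^bsub>E\<^esub> Idn E (M, Z)"
  have as: "associator H X Y Z = pa F m ?u8 \<cdot>\<^bsub>?D\<^esub> pa F m ?u7 \<cdot>\<^bsub>?D\<^esub> ?u6 \<cdot>\<^bsub>?D\<^esub> pa F ?n ?u5 \<cdot>\<^bsub>?D\<^esub> ?u4 \<cdot>\<^bsub>?D\<^esub>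
      ?u3 \<cdot>\<^bsub>?D\<^esub> pa F m ?u2 \<cdot>\<^bsub>?D\<^esub> pa F m ?u1"
    by (simp add: H_def hat_ob_def Let_def cat.defs moncat.defs)
  have n: "?n \<cdot> ?al = m \<cdot> (m \<odot> ?one)" using m_assoc by simp
  \<comment> \<open>The base composite is kept in the bracketing \<open>?n \<cdot> ?al\<close>, in
    which \<open>pcomp F ?n ?al\<close> refers to it; hence associativity in \<open>A\<close> is
    switched off as a rewrite rule.\<close>
  have n' [simp]: "m \<cdot> (m \<odot> ?one) = ?n \<cdot> ?al" using m_assoc by simp
  note A.assoc [simp del]
  show ?ar ?dom ?cod
    unfolding as by (simp_all add: H_def hat_tensor_ob)
  have "ver M (associator H X Y Z) \<cdot>\<^bsub>E\<^esub> lift m (lo F M M (po F m ?P) Z) \<cdot>\<^bsub>E\<^esub> ?T =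
      ver M (pa F m ?u8) \<cdot>\<^bsub>E\<^esub> ver M (pa F m ?u7) \<cdot>\<^bsub>E\<^esub> ver M ?u6 \<cdot>\<^bsub>E\<^esub> ver M (pa F ?n ?u5) \<cdot>\<^bsub>E\<^esub> ver M ?u4 \<cdot>\<^bsub>E\<^esub>
      ver M ?u3 \<cdot>\<^bsub>E\<^esub> ver M (pa F m ?u2) \<cdot>\<^bsub>E\<^esub> ver M (pa F m ?u1) \<cdot>\<^bsub>E\<^esub>
      lift m (lo F M M (po F m ?P) Z) \<cdot>\<^bsub>E\<^esub> ?T"
    unfolding as by (simp add: ver_cmp)
  also have "ver M (pa F m ?u1) \<cdot>\<^bsub>E\<^esub> lift m (lo F M M (po F m ?P) Z) \<cdot>\<^bsub>E\<^esub> ?T =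
      lift m (lo F M M (po F m ?P) (po F ?one Z)) \<cdot>\<^bsub>E\<^esub> (lift m ?P \<odot>\<^bsub>E\<^esub> lift ?one Z)"
    by (subst ver_pa_slide[where a = "M \<otimes> M" and Y = "lo F M M (po F m ?P) (po F ?one Z)"])
      (simp_all add: ver_tensor_ver[symmetric] E.tensor_cmp ver_punit)
  also have "ver M (pa F m ?u2) \<cdot>\<^bsub>E\<^esub> \<dots> = lift m (po F (m \<odot> ?one) ?L) \<cdot>\<^bsub>E\<^esub> lift (m \<odot> ?one) ?L"
    by (subst ver_pa_slide[where a = "M \<otimes> M" and Y = "po F (m \<odot> ?one) ?L"]) (simp_all add: ver_lax_2)
  also have "ver M ?u3 \<cdot>\<^bsub>E\<^esub> \<dots> = lift (?n \<cdot> ?al) ?L"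
    by (simp add: ver_pcomp)
  also have "ver M ?u4 \<cdot>\<^bsub>E\<^esub> \<dots> = lift ?n (po F ?al ?L) \<cdot>\<^bsub>E\<^esub> lift ?al ?L"
    by (rule ver_inv_pcomp) simp_all
  also have "ver M (pa F ?n ?u5) \<cdot>\<^bsub>E\<^esub> \<dots> = lift ?n ?R \<cdot>\<^bsub>E\<^esub> associator E (M, X) (M, Y) (M, Z)"
    by (subst ver_pa_slide[where a = "M \<otimes> (M \<otimes> M)" and Y = ?R]) (simp_all add: associator_eq)
  also have "ver M ?u6 \<cdot>\<^bsub>E\<^esub> \<dots> = (ver M ?u6 \<cdot>\<^bsub>E\<^esub> lift ?n ?R) \<cdot>\<^bsub>E\<^esub> associator E (M, X) (M, Y) (M, Z)"
    by simp
  also have "ver M ?u6 \<cdot>\<^bsub>E\<^esub> lift ?n ?R = lift m (po F (?one \<odot> m) ?R) \<cdot>\<^bsub>E\<^esub> lift (?one \<odot> m) ?R"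
    by (rule ver_inv_pcomp) simp_all
  also have "ver M (pa F m ?u7) \<cdot>\<^bsub>E\<^esub> (lift m (po F (?one \<odot> m) ?R) \<cdot>\<^bsub>E\<^esub> lift (?one \<odot> m) ?R) \<cdot>\<^bsub>E\<^esub>
      associator E (M, X) (M, Y) (M, Z) =
    lift m (lo F M M (po F ?one X) (po F m ?Q)) \<cdot>\<^bsub>E\<^esub> (ver (M \<otimes> M) ?u7 \<cdot>\<^bsub>E\<^esub> lift (?one \<odot> m) ?R) \<cdot>\<^bsub>E\<^esub>
      associator E (M, X) (M, Y) (M, Z)"
    using ver_pa_slide[where f = m and a = "M \<otimes> M" and Y = "lo F M M (po F ?one X) (po F m ?Q)" and
        u = ?u7 and b = M and X = "po F (?one \<odot> m) ?R" and
        x = "lift (?one \<odot> m) ?R \<cdot>\<^bsub>E\<^esub> associator E (M, X) (M, Y) (M, Z)"] by simp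
  also have "ver (M \<otimes> M) ?u7 \<cdot>\<^bsub>E\<^esub> lift (?one \<odot> m) ?R = lift ?one X \<odot>\<^bsub>E\<^esub> lift m ?Q"
    using ver_inv_lax_2[of ?one m X ?Q M M] by simp
  also have "ver M (pa F m ?u8) \<cdot>\<^bsub>E\<^esub> lift m (lo F M M (po F ?one X) (po F m ?Q)) \<cdot>\<^bsub>E\<^esub>
      (lift ?one X \<odot>\<^bsub>E\<^esub> lift m ?Q) \<cdot>\<^bsub>E\<^esub> associator E (M, X) (M, Y) (M, Z) =
    lift m (lo F M M X (po F m ?Q)) \<cdot>\<^bsub>E\<^esub> (ver (M \<otimes> M) ?u8 \<cdot>\<^bsub>E\<^esub> (lift ?one X \<odot>\<^bsub>E\<^esub> lift m ?Q)) \<cdot>\<^bsub>E\<^esub>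
      associator E (M, X) (M, Y) (M, Z)"
    using ver_pa_slide[where f = m and a = "M \<otimes> M" and Y = "lo F M M X (po F m ?Q)" and
        u = ?u8 and b = M and X = "lo F M M (po F ?one X) (po F m ?Q)" and
        x = "(lift ?one X \<odot>\<^bsub>E\<^esub> lift m ?Q) \<cdot>\<^bsub>E\<^esub> associator E (M, X) (M, Y) (M, Z)"] by simp
  also have "ver (M \<otimes> M) ?u8 \<cdot>\<^bsub>E\<^esub> (lift ?one X \<odot>\<^bsub>E\<^esub> lift m ?Q) = Idn E (M, X) \<odot>\<^bsub>E\<^esub> lift m ?Q"
    by (simp add: ver_tensor_ver[symmetric] E.tensor_cmp ver_inv_punit)
  finally show ?eq .
qed

text \<open>The factors are absorbed as for the associator. By the unit axiom of \<open>M\<close>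
  the base composite is the left unitor of \<open>A\<close>, so the last lift is one over
  \<open>lunitor A M\<close>, which together with \<open>lax_lunit\<close> forms the left unitor of
  \<open>E\<close>.\<close>

lemma hat_lunitor:
  fixes M m e X
  defines "H \<equiv> hat_ob A F (M, m, e)"
  assumes m [simp]: "M \<in> Ob A" "m \<in> Ar A" "Dom A m = M \<otimes> M" "Cod A m = M"
    "e \<in> Ar A" "Dom A e = unit_ob A" "Cod A e = M"
    and m_unit [simp]: "m \<cdot> (e \<odot> Idn A M) = lunitor A M"
    and o [simp]: "X \<in> Ob (fib F M)"
  shows "lunitor H X \<in> Ar (fib F M)" (is ?ar)
    "Dom (fib F M) (lunitor H X) = unit_ob H \<otimes>\<^bsub>H\<^esub> X" (is ?dom)
    "Cod (fib F M) (lunitor H X) = X" (is ?cod)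
    "ver M (lunitor H X) \<cdot>\<^bsub>E\<^esub> lift m (lo F M M (po F e (iota F)) X) \<cdot>\<^bsub>E\<^esub>
        (lift e (iota F) \<odot>\<^bsub>E\<^esub> Idn E (M, X)) = lunitor E (M, X)" (is ?eq)
proof -
  note [simp] = E_tensor_ob
  let ?D = "fib F M" and ?one = "Idn A M"
  let ?L = "lo F (unit_ob A) M (iota F) X" and ?P = "po F e (iota F)"
  let ?u1 = "la F M M (Idn ?D ?P) (punit F M X)"
  let ?u2 = "lax_2 F e ?one (iota F, X)"
  let ?u3 = "pcomp F m (e \<odot> ?one) ?L"
  let ?T = "lift e (iota F) \<odot>\<^bsub>E\<^esub> Idn E (M, X)"
  have as: "lunitor H X = lax_lunit F M X \<cdot>\<^bsub>?D\<^esub> ?u3 \<cdot>\<^bsub>?D\<^esub> pa F m ?u2 \<cdot>\<^bsub>?D\<^esub> pa F m ?u1"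
    by (simp add: H_def hat_ob_def Let_def cat.defs moncat.defs)
  show ?ar ?dom ?cod
    unfolding as by (simp_all add: H_def hat_tensor_ob hat_unit)
  have "ver M (lunitor H X) \<cdot>\<^bsub>E\<^esub> lift m (lo F M M ?P X) \<cdot>\<^bsub>E\<^esub> ?T =
      ver M (lax_lunit F M X) \<cdot>\<^bsub>E\<^esub> ver M ?u3 \<cdot>\<^bsub>E\<^esub> ver M (pa F m ?u2) \<cdot>\<^bsub>E\<^esub> ver M (pa F m ?u1) \<cdot>\<^bsub>E\<^esub>
      lift m (lo F M M ?P X) \<cdot>\<^bsub>E\<^esub> ?T"
    unfolding as by (simp add: ver_cmp)
  also have "ver M (pa F m ?u1) \<cdot>\<^bsub>E\<^esub> lift m (lo F M M ?P X) \<cdot>\<^bsub>E\<^esub> ?T =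
      lift m (lo F M M ?P (po F ?one X)) \<cdot>\<^bsub>E\<^esub> (lift e (iota F) \<odot>\<^bsub>E\<^esub> lift ?one X)"
    by (subst ver_pa_slide[where a = "M \<otimes> M" and Y = "lo F M M ?P (po F ?one X)"])
      (simp_all add: ver_tensor_ver[symmetric] E.tensor_cmp ver_punit E_unit)
  also have "ver M (pa F m ?u2) \<cdot>\<^bsub>E\<^esub> \<dots> = lift m (po F (e \<odot> ?one) ?L) \<cdot>\<^bsub>E\<^esub> lift (e \<odot> ?one) ?L"
    by (subst ver_pa_slide[where a = "M \<otimes> M" and Y = "po F (e \<odot> ?one) ?L"]) (simp_all add: ver_lax_2)
  also have "ver M ?u3 \<cdot>\<^bsub>E\<^esub> \<dots> = lift (lunitor A M) ?L"
    by (simp add: ver_pcomp)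
  finally show ?eq by (simp add: lunitor_eq)
qed

text \<open>Mirror image of \<open>hat_lunitor\<close>, with the right unit axiom of
  \<open>M\<close>.\<close>

lemma hat_runitor:
  fixes M m e X
  defines "H \<equiv> hat_ob A F (M, m, e)"
  assumes m [simp]: "M \<in> Ob A" "m \<in> Ar A" "Dom A m = M \<otimes> M" "Cod A m = M"
    "e \<in> Ar A" "Dom A e = unit_ob A" "Cod A e = M"
    and m_unit [simp]: "m \<cdot> (Idn A M \<odot> e) = runitor A M"
    and o [simp]: "X \<in> Ob (fib F M)"
  shows "runitor H X \<in> Ar (fib F M)" (is ?ar)
    "Dom (fib F M) (runitor H X) = X \<otimes>\<^bsub>H\<^esub> unit_ob H" (is ?dom)
    "Cod (fib F M) (runitor H X) = X" (is ?cod)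
    "ver M (runitor H X) \<cdot>\<^bsub>E\<^esub> lift m (lo F M M X (po F e (iota F))) \<cdot>\<^bsub>E\<^esub>
        (Idn E (M, X) \<odot>\<^bsub>E\<^esub> lift e (iota F)) = runitor E (M, X)" (is ?eq)
proof -
  note [simp] = E_tensor_ob
  let ?D = "fib F M" and ?one = "Idn A M"
  let ?L = "lo F M (unit_ob A) X (iota F)" and ?P = "po F e (iota F)"
  let ?u1 = "la F M M (punit F M X) (Idn ?D ?P)"
  let ?u2 = "lax_2 F ?one e (X, iota F)"
  let ?u3 = "pcomp F m (?one \<odot> e) ?L"
  let ?T = "Idn E (M, X) \<odot>\<^bsub>E\<^esub> lift e (iota F)"
  have as: "runitor H X = lax_runit F M X \<cdot>\<^bsub>?D\<^esub> ?u3 \<cdot>\<^bsub>?D\<^esub> pa F m ?u2 \<cdot>\<^bsub>?D\<^esub> pa F m ?u1"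
    by (simp add: H_def hat_ob_def Let_def cat.defs moncat.defs)
  show ?ar ?dom ?cod
    unfolding as by (simp_all add: H_def hat_tensor_ob hat_unit)
  have "ver M (runitor H X) \<cdot>\<^bsub>E\<^esub> lift m (lo F M M X ?P) \<cdot>\<^bsub>E\<^esub> ?T =
      ver M (lax_runit F M X) \<cdot>\<^bsub>E\<^esub> ver M ?u3 \<cdot>\<^bsub>E\<^esub> ver M (pa F m ?u2) \<cdot>\<^bsub>E\<^esub> ver M (pa F m ?u1) \<cdot>\<^bsub>E\<^esub>
      lift m (lo F M M X ?P) \<cdot>\<^bsub>E\<^esub> ?T"
    unfolding as by (simp add: ver_cmp)
  also have "ver M (pa F m ?u1) \<cdot>\<^bsub>E\<^esub> lift m (lo F M M X ?P) \<cdot>\<^bsub>E\<^esub> ?T =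
      lift m (lo F M M (po F ?one X) ?P) \<cdot>\<^bsub>E\<^esub> (lift ?one X \<odot>\<^bsub>E\<^esub> lift e (iota F))"
    by (subst ver_pa_slide[where a = "M \<otimes> M" and Y = "lo F M M (po F ?one X) ?P"])
      (simp_all add: ver_tensor_ver[symmetric] E.tensor_cmp ver_punit E_unit)
  also have "ver M (pa F m ?u2) \<cdot>\<^bsub>E\<^esub> \<dots> = lift m (po F (?one \<odot> e) ?L) \<cdot>\<^bsub>E\<^esub> lift (?one \<odot> e) ?L"
    by (subst ver_pa_slide[where a = "M \<otimes> M" and Y = "po F (?one \<odot> e) ?L"]) (simp_all add: ver_lax_2)
  also have "ver M ?u3 \<cdot>\<^bsub>E\<^esub> \<dots> = lift (runitor A M) ?L"
    by (simp add: ver_pcomp)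
  finally show ?eq by (simp add: runitor_eq)
qed

section \<open>Monoids of the total category over a monoid of the base\<close>

definition tot :: "('o, 'a) monoid \<Rightarrow> ('x, 'y) monoid \<Rightarrow> ('o \<times> 'x, ('o, 'a, 'x, 'y) groth_arr) monoid" where
  "tot = (\<lambda>(M, m, e) (X, \<mu>, \<eta>). ((M, X), ((M \<otimes> M, lo F M M X X), (M, X), (m, \<mu>)),
     ((unit_ob A, iota F), (M, X), (e, \<eta>))))"

lemma tot_eq:
  assumes "monoid_data A (M, m, e)" "monoid_data (hat_ob A F (M, m, e)) (X, \<mu>, \<eta>)"
  shows "tot (M, m, e) (X, \<mu>, \<eta>) = ((M, X), ver M \<mu> \<cdot>\<^bsub>E\<^esub> lift m (lo F M M X X), ver M \<eta> \<cdot>\<^bsub>E\<^esub> lift e (iota F))"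
  using assms by (simp add: tot_def hom_iff hat_tensor_ob hat_unit ver_cmp_lift)

lemma monoid_data_tot:
  "monoid_data E (tot a x) \<longleftrightarrow> monoid_data A a \<and> monoid_data (hat_ob A F a) x"
proof -
  obtain M m e X \<mu> \<eta> where "a = (M, m, e)" "x = (X, \<mu>, \<eta>)" by (cases a; cases x)
  then show ?thesis
    by (auto simp: tot_def hom_iff E_ar E_tensor_ob E_unit hat_tensor_ob hat_unit)
qed

text \<open>The typing conditions determine the domain and codomain entries of the raw arrows, which
  leaves the base and fibre components as free data.\<close>

lemma monoid_data_is_tot:
  assumes "monoid_data E p"
  obtains a x where "p = tot a x"
proof -
  obtain M X m e where p: "p = ((M, X), m, e)" by (cases p) auto
  obtain a1 X1 b1 Y1 m1 \<mu> where m: "m = ((a1, X1), (b1, Y1), (m1, \<mu>))" by (cases m rule: groth_arr_exhaust)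
  obtain a2 X2 b2 Y2 e2 \<eta> where e: "e = ((a2, X2), (b2, Y2), (e2, \<eta>))" by (cases e rule: groth_arr_exhaust)
  have "p = tot (M, m1, e2) (X, \<mu>, \<eta>)"
    using assms by (auto simp: p m e tot_def hom_iff E_tensor_ob E_unit)
  then show ?thesis by (rule that)
qed

lemma is_monoid_base: "is_monoid E (tot a x) \<Longrightarrow> is_monoid A a"
proof -
  assume h: "is_monoid E (tot a x)"
  obtain M m e X \<mu> \<eta> where ax: "a = (M, m, e)" "x = (X, \<mu>, \<eta>)" by (cases a; cases x)
  have d: "monoid_data A a" using is_monoid_data[OF h] monoid_data_tot by blast
  let ?m = "((M \<otimes> M, lo F M M X X), (M, X), (m, \<mu>))" and ?e = "((unit_ob A, iota F), (M, X), (e, \<eta>))"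
  let ?i = "Idn E (M, X)"
  have "?m \<cdot>\<^bsub>E\<^esub> (?m \<odot>\<^bsub>E\<^esub> ?i) = ?m \<cdot>\<^bsub>E\<^esub> (?i \<odot>\<^bsub>E\<^esub> ?m) \<cdot>\<^bsub>E\<^esub> associator E (M, X) (M, X) (M, X)"
    "?m \<cdot>\<^bsub>E\<^esub> (?e \<odot>\<^bsub>E\<^esub> ?i) = lunitor E (M, X)" "?m \<cdot>\<^bsub>E\<^esub> (?i \<odot>\<^bsub>E\<^esub> ?e) = runitor E (M, X)"
    using h by (simp_all add: ax tot_def)
  \<comment> \<open>\<open>base\<close> commutes strictly with composition, tensor product,
    identities and structure isomorphisms, so each axiom in \<open>E\<close> maps to the same axiom
    in \<open>A\<close>.\<close>
  from this[THEN arg_cong[where f = base]] d show ?thesis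
    by (simp add: ax)
qed

lemma is_monoid_tot:
  assumes a: "is_monoid A a" and x: "monoid_data (hat_ob A F a) x"
  shows "is_monoid E (tot a x) \<longleftrightarrow> is_monoid (hat_ob A F a) x"
proof -
  obtain M m e X \<mu> \<eta> where ax: "a = (M, m, e)" "x = (X, \<mu>, \<eta>)" by (cases a; cases x)
  let ?H = "hat_ob A F (M, m, e)" and ?D = "fib F M"
  have [simp]: "M \<in> Ob A" "m \<in> Ar A" "Dom A m = M \<otimes> M" "Cod A m = M"
    "e \<in> Ar A" "Dom A e = unit_ob A" "Cod A e = M"
    and eqs: "m \<cdot> (m \<odot> Idn A M) = m \<cdot> (Idn A M \<odot> m) \<cdot> associator A M M M"
    "m \<cdot> (e \<odot> Idn A M) = lunitor A M" "m \<cdot> (Idn A M \<odot> e) = runitor A M"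
    using a by (auto simp: ax hom_iff)
  let ?P = "lo F M M X X"
  have [simp]: "X \<in> Ob ?D" "\<mu> \<in> Ar ?D" "Dom ?D \<mu> = po F m ?P" "Cod ?D \<mu> = X"
    "\<eta> \<in> Ar ?D" "Dom ?D \<eta> = po F e (iota F)" "Cod ?D \<eta> = X"
    using x by (auto simp: ax hom_iff hat_tensor_ob hat_unit)
  note [simp] = E_tensor_ob
  \<comment> \<open>The arrows \<open>c\<close>, \<open>c'\<close> and \<open>c''\<close> are what
    remains of the three axiom composites once all fibre parts have moved to the left. Writing
    \<open>X\<close> for \<open>(M, X)\<close>, they start at
    \<open>(X \<otimes> X) \<otimes> X\<close>, at the unit tensored with \<open>X\<close>, and at
    \<open>X\<close> tensored with the unit.\<close>
  define c where "c = lift m (lo F M M (po F m ?P) X) \<cdot>\<^bsub>E\<^esub> (lift m ?P \<odot>\<^bsub>E\<^esub> Idn E (M, X))"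
  define c' where "c' = lift m (lo F M M (po F e (iota F)) X) \<cdot>\<^bsub>E\<^esub> (lift e (iota F) \<odot>\<^bsub>E\<^esub> Idn E (M, X))"
  define c'' where "c'' = lift m (lo F M M X (po F e (iota F))) \<cdot>\<^bsub>E\<^esub> (Idn E (M, X) \<odot>\<^bsub>E\<^esub> lift e (iota F))"
  have opc: "opcartesian c" "opcartesian c'" "opcartesian c''"
    unfolding c_def c'_def c''_def
    by (intro opcartesian_cmp opcartesian_lift opcartesian_tensor opcartesian_idn; simp)+
  have cod: "Cod E c = (M, po F m (lo F M M (po F m ?P) X))"
    "Cod E c' = (M, po F m (lo F M M (po F e (iota F)) X))"
    "Cod E c'' = (M, po F m (lo F M M X (po F e (iota F))))"
    unfolding c_def c'_def c''_def by simp_all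
  let ?m = "ver M \<mu> \<cdot>\<^bsub>E\<^esub> lift m ?P" and ?e = "ver M \<eta> \<cdot>\<^bsub>E\<^esub> lift e (iota F)" and ?i = "Idn E (M, X)"
  let ?j = "Idn ?D X" and ?as = "associator ?H X X X"
  note as = hat_associator[of M m X X X e] and lu = hat_lunitor[of M m e X] and ru = hat_runitor[of M m e X]
  note as = as[OF _ _ _ _ eqs(1), simplified hat_tensor_ob, simplified]
    and lu = lu[OF _ _ _ _ _ _ _ eqs(2), simplified hat_tensor_ob hat_unit, simplified]
    and ru = ru[OF _ _ _ _ _ _ _ eqs(3), simplified hat_tensor_ob hat_unit, simplified]
  have split_i: "(ver M u \<cdot>\<^bsub>E\<^esub> y) \<odot>\<^bsub>E\<^esub> ?i = ver (M \<otimes> M) (la F M M u ?j) \<cdot>\<^bsub>E\<^esub> (y \<odot>\<^bsub>E\<^esub> ?i)"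
    "?i \<odot>\<^bsub>E\<^esub> (ver M u \<cdot>\<^bsub>E\<^esub> y) = ver (M \<otimes> M) (la F M M ?j u) \<cdot>\<^bsub>E\<^esub> (?i \<odot>\<^bsub>E\<^esub> y)"
    if "u \<in> Ar ?D" "y \<in> Ar E" "Cod E y = (M, Dom ?D u)" for u y
    using that by (simp_all add: ver_tensor_ver[symmetric] E.tensor_cmp)
  have slide: "?m \<cdot>\<^bsub>E\<^esub> (ver (M \<otimes> M) u \<cdot>\<^bsub>E\<^esub> y) = ver M (\<mu> \<cdot>\<^bsub>?D\<^esub> pa F m u) \<cdot>\<^bsub>E\<^esub> lift m Z \<cdot>\<^bsub>E\<^esub> y"
    if "u \<in> Ar (fib F (M \<otimes> M))" "Cod (fib F (M \<otimes> M)) u = ?P" "Dom (fib F (M \<otimes> M)) u = Z"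
      "y \<in> Ar E" "Cod E y = (M \<otimes> M, Z)" for u y Z
  proof -
    have [simp]: "Z \<in> Ob (fib F (M \<otimes> M))" using that by auto
    show ?thesis
      using that ver_pa_slide[of m "M \<otimes> M" M u Z ?P y] by (simp add: ver_cmp)
  qed
  have l1: "?m \<cdot>\<^bsub>E\<^esub> (?m \<odot>\<^bsub>E\<^esub> ?i) = ver M (\<mu> \<cdot>\<^bsub>?D\<^esub> pa F m (la F M M \<mu> ?j)) \<cdot>\<^bsub>E\<^esub> c"
    unfolding c_def split_i(1)[of \<mu> "lift m ?P", simplified]
    by (rule slide) simp_all
  have "?m \<cdot>\<^bsub>E\<^esub> (?i \<odot>\<^bsub>E\<^esub> ?m) \<cdot>\<^bsub>E\<^esub> associator E (M, X) (M, X) (M, X) =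
      ?m \<cdot>\<^bsub>E\<^esub> ver (M \<otimes> M) (la F M M ?j \<mu>) \<cdot>\<^bsub>E\<^esub> ((?i \<odot>\<^bsub>E\<^esub> lift m ?P) \<cdot>\<^bsub>E\<^esub> associator E (M, X) (M, X) (M, X))"
    unfolding split_i(2)[of \<mu> "lift m ?P", simplified] by simp
  also have "\<dots> = ver M (\<mu> \<cdot>\<^bsub>?D\<^esub> pa F m (la F M M ?j \<mu>)) \<cdot>\<^bsub>E\<^esub> lift m (lo F M M X (po F m ?P)) \<cdot>\<^bsub>E\<^esub>
      ((?i \<odot>\<^bsub>E\<^esub> lift m ?P) \<cdot>\<^bsub>E\<^esub> associator E (M, X) (M, X) (M, X))"
    by (rule slide) simp_all
  \<comment> \<open>\<open>hat_associator\<close> replaces the opcartesian arrow of the other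
    bracketing, together with the associator of \<open>E\<close>, by the fibre associator after
    \<open>c\<close>; both composites now follow \<open>c\<close>.\<close>
  also have "\<dots> = ver M (\<mu> \<cdot>\<^bsub>?D\<^esub> pa F m (la F M M ?j \<mu>)) \<cdot>\<^bsub>E\<^esub> ver M ?as \<cdot>\<^bsub>E\<^esub> c"
    using as by (simp add: c_def)
  also have "\<dots> = ver M (\<mu> \<cdot>\<^bsub>?D\<^esub> pa F m (la F M M ?j \<mu>) \<cdot>\<^bsub>?D\<^esub> ?as) \<cdot>\<^bsub>E\<^esub> c"
    using as opcartesian_ar[OF opc(1)] cod by (simp add: ver_cmp)
  finally have r1: "?m \<cdot>\<^bsub>E\<^esub> (?i \<odot>\<^bsub>E\<^esub> ?m) \<cdot>\<^bsub>E\<^esub> associator E (M, X) (M, X) (M, X) = \<dots>" .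
  have l2: "?m \<cdot>\<^bsub>E\<^esub> (?e \<odot>\<^bsub>E\<^esub> ?i) = ver M (\<mu> \<cdot>\<^bsub>?D\<^esub> pa F m (la F M M \<eta> ?j)) \<cdot>\<^bsub>E\<^esub> c'"
    unfolding c'_def split_i(1)[of \<eta> "lift e (iota F)", simplified]
    by (rule slide) (simp_all add: E_unit)
  have r2: "lunitor E (M, X) = ver M (lunitor ?H X) \<cdot>\<^bsub>E\<^esub> c'"
    using lu by (simp add: c'_def)
  have l3: "?m \<cdot>\<^bsub>E\<^esub> (?i \<odot>\<^bsub>E\<^esub> ?e) = ver M (\<mu> \<cdot>\<^bsub>?D\<^esub> pa F m (la F M M ?j \<eta>)) \<cdot>\<^bsub>E\<^esub> c''"
    unfolding c''_def split_i(2)[of \<eta> "lift e (iota F)", simplified]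
    by (rule slide) (simp_all add: E_unit)
  have r3: "runitor E (M, X) = ver M (runitor ?H X) \<cdot>\<^bsub>E\<^esub> c''"
    using ru by (simp add: c''_def)
  have e1: "?m \<cdot>\<^bsub>E\<^esub> (?m \<odot>\<^bsub>E\<^esub> ?i) = ?m \<cdot>\<^bsub>E\<^esub> (?i \<odot>\<^bsub>E\<^esub> ?m) \<cdot>\<^bsub>E\<^esub> associator E (M, X) (M, X) (M, X) \<longleftrightarrow>
    \<mu> \<cdot>\<^bsub>?D\<^esub> pa F m (la F M M \<mu> ?j) = \<mu> \<cdot>\<^bsub>?D\<^esub> pa F m (la F M M ?j \<mu>) \<cdot>\<^bsub>?D\<^esub> ?as"
    unfolding l1 r1 by (rule ver_opcartesian_eq[OF opc(1) cod(1)]) (use as in simp_all)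
  have e2: "?m \<cdot>\<^bsub>E\<^esub> (?e \<odot>\<^bsub>E\<^esub> ?i) = lunitor E (M, X) \<longleftrightarrow> \<mu> \<cdot>\<^bsub>?D\<^esub> pa F m (la F M M \<eta> ?j) = lunitor ?H X"
    unfolding l2 r2 by (rule ver_opcartesian_eq[OF opc(2) cod(2)]) (use lu in simp_all)
  have e3: "?m \<cdot>\<^bsub>E\<^esub> (?i \<odot>\<^bsub>E\<^esub> ?e) = runitor E (M, X) \<longleftrightarrow> \<mu> \<cdot>\<^bsub>?D\<^esub> pa F m (la F M M ?j \<eta>) = runitor ?H X"
    unfolding l3 r3 by (rule ver_opcartesian_eq[OF opc(3) cod(3)]) (use ru in simp_all)
  have d: "monoid_data E (tot a x)" using a x by (simp add: monoid_data_tot is_monoid_data)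
  have "tot a x = ((M, X), ?m, ?e)"
    unfolding ax by (rule tot_eq) (use is_monoid_data[OF a] x in \<open>simp_all only: ax\<close>)
  then have "is_monoid E (tot a x) \<longleftrightarrow> ?m \<cdot>\<^bsub>E\<^esub> (?m \<odot>\<^bsub>E\<^esub> ?i) = ?m \<cdot>\<^bsub>E\<^esub> (?i \<odot>\<^bsub>E\<^esub> ?m) \<cdot>\<^bsub>E\<^esub> associator E (M, X) (M, X) (M, X)
    \<and> ?m \<cdot>\<^bsub>E\<^esub> (?e \<odot>\<^bsub>E\<^esub> ?i) = lunitor E (M, X) \<and> ?m \<cdot>\<^bsub>E\<^esub> (?i \<odot>\<^bsub>E\<^esub> ?e) = runitor E (M, X)"
    using d by (auto simp del: E.assoc)
  also have "\<dots> \<longleftrightarrow> is_monoid ?H (X, \<mu>, \<eta>)"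
    unfolding e1 e2 e3 using x by (auto simp: ax hat_tensor_ar)
  finally show ?thesis by (simp only: ax)
qed

text \<open>Each monoid axiom is checked after precomposition with a tensor product of copies of \<open>c\<close> and
  identities, which is opcartesian and therefore cancels.\<close>

lemma is_monoid_opcartesian:
  assumes c: "opcartesian c" "is_monoid_morphism E p (tot b y) c"
    and p: "is_monoid E p" and b: "is_monoid A b" and y: "monoid_data (hat_ob A F b) y"
  shows "is_monoid E (tot b y)"
proof -
  obtain M m e where p': "p = (M, m, e)" by (cases p)
  obtain N n d where q': "tot b y = (N, n, d)" by (cases "tot b y")
  have q: "monoid_data E (N, n, d)"
    using b y by (simp flip: q' add: monoid_data_tot is_monoid_data)
  have ba: "b = (fst N, base n, base d)"
    using q' by (cases b; cases y) (auto simp: tot_def)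
  note [simp] = hom_iff
  have [simp]: "c \<in> Ar E" "Dom E c = M" "Cod E c = N"
    and cm: "c \<cdot>\<^bsub>E\<^esub> m = n \<cdot>\<^bsub>E\<^esub> (c \<odot>\<^bsub>E\<^esub> c)" and ce: "c \<cdot>\<^bsub>E\<^esub> e = d"
    using c by (auto simp: p' q')
  have [simp]: "M \<in> Ob E" "m \<in> Ar E" "Dom E m = M \<otimes>\<^bsub>E\<^esub> M" "Cod E m = M"
    "e \<in> Ar E" "Dom E e = unit_ob E" "Cod E e = M"
    and m: "m \<cdot>\<^bsub>E\<^esub> (m \<odot>\<^bsub>E\<^esub> Idn E M) = m \<cdot>\<^bsub>E\<^esub> (Idn E M \<odot>\<^bsub>E\<^esub> m) \<cdot>\<^bsub>E\<^esub> associator E M M M"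
      "m \<cdot>\<^bsub>E\<^esub> (e \<odot>\<^bsub>E\<^esub> Idn E M) = lunitor E M" "m \<cdot>\<^bsub>E\<^esub> (Idn E M \<odot>\<^bsub>E\<^esub> e) = runitor E M"
    using p by (auto simp: p')
  have [simp]: "N \<in> Ob E" "n \<in> Ar E" "Dom E n = N \<otimes>\<^bsub>E\<^esub> N" "Cod E n = N"
    "d \<in> Ar E" "Dom E d = unit_ob E" "Cod E d = N"
    using q by auto
  let ?i = "Idn E M" and ?j = "Idn E N" and ?k = "Idn E (unit_ob E)"
  \<comment> \<open>Both sides of an axiom must agree in the base before an opcartesian arrow may be
    cancelled; these equations are the monoid axioms of \<open>b\<close>.\<close>
  have bN: "base n \<cdot> (base n \<odot> Idn A (fst N)) =
      base n \<cdot> (Idn A (fst N) \<odot> base n) \<cdot> associator A (fst N) (fst N) (fst N)"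
    "base n \<cdot> (base d \<odot> Idn A (fst N)) = lunitor A (fst N)"
    "base n \<cdot> (Idn A (fst N) \<odot> base d) = runitor A (fst N)"
    using b unfolding ba by auto
  have slide: "n \<cdot>\<^bsub>E\<^esub> (c \<odot>\<^bsub>E\<^esub> c) \<cdot>\<^bsub>E\<^esub> x = c \<cdot>\<^bsub>E\<^esub> m \<cdot>\<^bsub>E\<^esub> x" if "x \<in> Ar E" "Cod E x = M \<otimes>\<^bsub>E\<^esub> M" for x
    using E.cmp_tail[OF cm[symmetric]] that by simp
  \<comment> \<open>Precomposition moves the composite from \<open>N\<close> to \<open>M\<close>,
    where associativity is known, and naturality of the associator of \<open>E\<close> at
    \<open>c\<close> moves the result back.\<close>
  have "(n \<cdot>\<^bsub>E\<^esub> (n \<odot>\<^bsub>E\<^esub> ?j)) \<cdot>\<^bsub>E\<^esub> ((c \<odot>\<^bsub>E\<^esub> c) \<odot>\<^bsub>E\<^esub> c) = n \<cdot>\<^bsub>E\<^esub> (c \<odot>\<^bsub>E\<^esub> c) \<cdot>\<^bsub>E\<^esub> (m \<odot>\<^bsub>E\<^esub> ?i)"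
    by (simp add: E.tensor_cmp cm)
  also have "\<dots> = c \<cdot>\<^bsub>E\<^esub> m \<cdot>\<^bsub>E\<^esub> (m \<odot>\<^bsub>E\<^esub> ?i)" by (simp add: slide)
  also have "\<dots> = c \<cdot>\<^bsub>E\<^esub> m \<cdot>\<^bsub>E\<^esub> (?i \<odot>\<^bsub>E\<^esub> m) \<cdot>\<^bsub>E\<^esub> associator E M M M" by (simp add: m)
  also have "\<dots> = n \<cdot>\<^bsub>E\<^esub> ((c \<odot>\<^bsub>E\<^esub> c) \<cdot>\<^bsub>E\<^esub> (?i \<odot>\<^bsub>E\<^esub> m)) \<cdot>\<^bsub>E\<^esub> associator E M M M"
    by (simp add: slide)
  also have "(c \<odot>\<^bsub>E\<^esub> c) \<cdot>\<^bsub>E\<^esub> (?i \<odot>\<^bsub>E\<^esub> m) = (?j \<odot>\<^bsub>E\<^esub> n) \<cdot>\<^bsub>E\<^esub> (c \<odot>\<^bsub>E\<^esub> (c \<odot>\<^bsub>E\<^esub> c))"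
    by (simp add: E.tensor_cmp cm)
  also have "n \<cdot>\<^bsub>E\<^esub> ((?j \<odot>\<^bsub>E\<^esub> n) \<cdot>\<^bsub>E\<^esub> (c \<odot>\<^bsub>E\<^esub> (c \<odot>\<^bsub>E\<^esub> c))) \<cdot>\<^bsub>E\<^esub> associator E M M M =
      (n \<cdot>\<^bsub>E\<^esub> (?j \<odot>\<^bsub>E\<^esub> n) \<cdot>\<^bsub>E\<^esub> associator E N N N) \<cdot>\<^bsub>E\<^esub> ((c \<odot>\<^bsub>E\<^esub> c) \<odot>\<^bsub>E\<^esub> c)"
    using E_associator_natural[of c c c] by simp
  finally have 1: "n \<cdot>\<^bsub>E\<^esub> (n \<odot>\<^bsub>E\<^esub> ?j) = n \<cdot>\<^bsub>E\<^esub> (?j \<odot>\<^bsub>E\<^esub> n) \<cdot>\<^bsub>E\<^esub> associator E N N N"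
    by (rule opcartesian_cancel[rotated]) (simp_all add: bN opcartesian_tensor c)
  have "(n \<cdot>\<^bsub>E\<^esub> (d \<odot>\<^bsub>E\<^esub> ?j)) \<cdot>\<^bsub>E\<^esub> (?k \<odot>\<^bsub>E\<^esub> c) = n \<cdot>\<^bsub>E\<^esub> (c \<odot>\<^bsub>E\<^esub> c) \<cdot>\<^bsub>E\<^esub> (e \<odot>\<^bsub>E\<^esub> ?i)"
    by (simp add: E.tensor_cmp ce)
  also have "\<dots> = c \<cdot>\<^bsub>E\<^esub> lunitor E M" by (simp add: slide m)
  also have "\<dots> = lunitor E N \<cdot>\<^bsub>E\<^esub> (?k \<odot>\<^bsub>E\<^esub> c)" using E_lunitor_natural[of c] by simp
  finally have 2: "n \<cdot>\<^bsub>E\<^esub> (d \<odot>\<^bsub>E\<^esub> ?j) = lunitor E N"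
    by (rule opcartesian_cancel[rotated]) (simp_all add: bN opcartesian_tensor opcartesian_idn c)
  have "(n \<cdot>\<^bsub>E\<^esub> (?j \<odot>\<^bsub>E\<^esub> d)) \<cdot>\<^bsub>E\<^esub> (c \<odot>\<^bsub>E\<^esub> ?k) = n \<cdot>\<^bsub>E\<^esub> (c \<odot>\<^bsub>E\<^esub> c) \<cdot>\<^bsub>E\<^esub> (?i \<odot>\<^bsub>E\<^esub> e)"
    by (simp add: E.tensor_cmp ce)
  also have "\<dots> = c \<cdot>\<^bsub>E\<^esub> runitor E M" by (simp add: slide m)
  also have "\<dots> = runitor E N \<cdot>\<^bsub>E\<^esub> (c \<odot>\<^bsub>E\<^esub> ?k)" using E_runitor_natural[of c] by simp
  finally have 3: "n \<cdot>\<^bsub>E\<^esub> (?j \<odot>\<^bsub>E\<^esub> d) = runitor E N"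
    by (rule opcartesian_cancel[rotated]) (simp_all add: bN opcartesian_tensor opcartesian_idn c)
  show ?thesis using 1 2 3 by (simp add: q')
qed

text \<open>Precomposing the multiplicativity of \<open>h\<close> with the opcartesian arrow
  \<open>c \<odot> c\<close> gives the multiplicativity of \<open>h\<close> after \<open>c\<close>,
  and \<open>b\<close> is the base equation that permits cancelling. Compatibility with units
  follows because the unit of \<open>q\<close> is \<open>c\<close> after the unit of
  \<open>p\<close>.\<close>

lemma monoid_morphism_opcartesian:
  assumes c: "opcartesian c" "is_monoid_morphism E p q c"
    and hc: "is_monoid_morphism E p r (h \<cdot>\<^bsub>E\<^esub> c)"
    and h: "h \<in> hom E (fst q) (fst r)"
    and data: "monoid_data E p" "monoid_data E q" "monoid_data E r"
    and b: "base h \<cdot> base (fst (snd q)) = base (fst (snd r)) \<cdot> (base h \<odot> base h)"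
  shows "is_monoid_morphism E q r h"
proof -
  obtain M m e where p: "p = (M, m, e)" by (cases p)
  obtain N n d where q: "q = (N, n, d)" by (cases q)
  obtain L l k where r: "r = (L, l, k)" by (cases r)
  note [simp] = hom_iff
  have [simp]: "c \<in> Ar E" "Dom E c = M" "Cod E c = N" "h \<in> Ar E" "Dom E h = N" "Cod E h = L"
    and cm: "c \<cdot>\<^bsub>E\<^esub> m = n \<cdot>\<^bsub>E\<^esub> (c \<odot>\<^bsub>E\<^esub> c)" and ce: "c \<cdot>\<^bsub>E\<^esub> e = d"
    and hm: "(h \<cdot>\<^bsub>E\<^esub> c) \<cdot>\<^bsub>E\<^esub> m = l \<cdot>\<^bsub>E\<^esub> ((h \<cdot>\<^bsub>E\<^esub> c) \<odot>\<^bsub>E\<^esub> (h \<cdot>\<^bsub>E\<^esub> c))"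
    and he: "(h \<cdot>\<^bsub>E\<^esub> c) \<cdot>\<^bsub>E\<^esub> e = k"
    using c hc h by (auto simp: p q r simp del: E.assoc)
  have [simp]: "M \<in> Ob E" "m \<in> Ar E" "Dom E m = M \<otimes>\<^bsub>E\<^esub> M" "Cod E m = M"
    "e \<in> Ar E" "Dom E e = unit_ob E" "Cod E e = M"
    "N \<in> Ob E" "n \<in> Ar E" "Dom E n = N \<otimes>\<^bsub>E\<^esub> N" "Cod E n = N"
    "L \<in> Ob E" "l \<in> Ar E" "Dom E l = L \<otimes>\<^bsub>E\<^esub> L" "Cod E l = L"
    using data by (auto simp: p q r)
  have "(h \<cdot>\<^bsub>E\<^esub> n) \<cdot>\<^bsub>E\<^esub> (c \<odot>\<^bsub>E\<^esub> c) = (h \<cdot>\<^bsub>E\<^esub> c) \<cdot>\<^bsub>E\<^esub> m" by (simp add: cm)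
  also have "\<dots> = (l \<cdot>\<^bsub>E\<^esub> (h \<odot>\<^bsub>E\<^esub> h)) \<cdot>\<^bsub>E\<^esub> (c \<odot>\<^bsub>E\<^esub> c)" unfolding hm by (simp add: E.tensor_cmp)
  finally have "h \<cdot>\<^bsub>E\<^esub> n = l \<cdot>\<^bsub>E\<^esub> (h \<odot>\<^bsub>E\<^esub> h)"
    by (rule opcartesian_cancel[rotated]) (use b in \<open>simp_all add: opcartesian_tensor c q r\<close>)
  moreover have "h \<cdot>\<^bsub>E\<^esub> d = k" using he by (simp add: ce)
  ultimately show ?thesis by (simp add: q r)
qed

section \<open>Pushforward of monoids along monoid morphisms of the base\<close>

abbreviation push_monoid :: "('o, 'a) monoid \<Rightarrow> ('o, 'a) monoid \<Rightarrow> 'a \<Rightarrow> ('x, 'y) monoid \<Rightarrow> ('x, 'y) monoid" where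
  "push_monoid a b f \<equiv> Mon_ob (hat_ob A F b) (hat_ar A F (a, b, f))"

lemma hat_ar_sel [simp]:
  "obj_map (hat_ar A F (a, b, f)) = po F f" "arr_map (hat_ar A F (a, b, f)) = pa F f"
  by (cases a; cases b; simp add: hat_ar_def Let_def funct.defs smfunct.defs)+

lemma smu_hat_ar:
  "smu (hat_ar A F ((M, m, e), (N, n, d), f)) (X, Y) =
    inv_arrow (fib F N) (pcomp F f m (lo F M M X Y)) \<cdot>\<^bsub>fib F N\<^esub>
    pcomp F n (f \<odot> f) (lo F M M X Y) \<cdot>\<^bsub>fib F N\<^esub> pa F n (lax_2 F f f (X, Y))"
  and seta_hat_ar: "seta (hat_ar A F ((M, m, e), (N, n, d), f)) = inv_arrow (fib F N) (pcomp F f e (iota F))"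
  by (simp_all add: hat_ar_def Let_def funct.defs smfunct.defs)

lemma fst_push_monoid [simp]: "fst (push_monoid a b f x) = po F f (fst x)"
  by (cases x) (simp add: Mon_ob_def)

text \<open>The structure arrows \<open>smu\<close> and \<open>seta\<close> of \<open>hat_ar\<close>
  are built from the corrections for composing and tensoring lifts. The pushed-forward
  multiplication and unit are therefore the ones that make the lift of \<open>f\<close> compatible
  with the structure, which is what \<open>?mult\<close> and \<open>?unit\<close> express.\<close>

lemma monoid_morphism_tot_aux:
  fixes M m e N n d f X \<mu> \<eta>
  defines "y \<equiv> push_monoid (M, m, e) (N, n, d) f (X, \<mu>, \<eta>)"
  assumes a: "monoid_data A (M, m, e)" and b: "monoid_data A (N, n, d)"
    and f: "is_monoid_morphism A (M, m, e) (N, n, d) f"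
    and x: "monoid_data (hat_ob A F (M, m, e)) (X, \<mu>, \<eta>)"
  shows "monoid_data (hat_ob A F (N, n, d)) y" (is ?data)
    "lift f X \<cdot>\<^bsub>E\<^esub> ver M \<mu> \<cdot>\<^bsub>E\<^esub> lift m (lo F M M X X) =
      ver N (fst (snd y)) \<cdot>\<^bsub>E\<^esub> lift n (lo F N N (po F f X) (po F f X)) \<cdot>\<^bsub>E\<^esub> (lift f X \<odot>\<^bsub>E\<^esub> lift f X)" (is ?mult)
    "lift f X \<cdot>\<^bsub>E\<^esub> ver M \<eta> \<cdot>\<^bsub>E\<^esub> lift e (iota F) = ver N (snd (snd y)) \<cdot>\<^bsub>E\<^esub> lift d (iota F)" (is ?unit)
proof -
  note [simp] = hom_iff E_tensor_ob
  have [simp]: "M \<in> Ob A" "m \<in> Ar A" "Dom A m = M \<otimes> M" "Cod A m = M"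
    "e \<in> Ar A" "Dom A e = unit_ob A" "Cod A e = M"
    "N \<in> Ob A" "n \<in> Ar A" "Dom A n = N \<otimes> N" "Cod A n = N"
    "d \<in> Ar A" "Dom A d = unit_ob A" "Cod A d = N"
    "f \<in> Ar A" "Dom A f = M" "Cod A f = N"
    and fm: "n \<cdot> (f \<odot> f) = f \<cdot> m" and fe [simp]: "f \<cdot> e = d"
    using a b f by auto
  let ?P = "lo F M M X X" and ?D = "fib F N" and ?Q = "lo F N N (po F f X) (po F f X)"
  have [simp]: "X \<in> Ob (fib F M)" "\<mu> \<in> Ar (fib F M)" "Dom (fib F M) \<mu> = po F m ?P" "Cod (fib F M) \<mu> = X"
    "\<eta> \<in> Ar (fib F M)" "Dom (fib F M) \<eta> = po F e (iota F)" "Cod (fib F M) \<eta> = X"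
    using x by (auto simp: hat_tensor_ob hat_unit)
  let ?s1 = "inv_arrow ?D (pcomp F f m ?P)" and ?s2 = "pcomp F n (f \<odot> f) ?P" and ?s3 = "lax_2 F f f (X, X)"
  have y: "y = (po F f X, pa F f \<mu> \<cdot>\<^bsub>?D\<^esub> ?s1 \<cdot>\<^bsub>?D\<^esub> ?s2 \<cdot>\<^bsub>?D\<^esub> pa F n ?s3,
      pa F f \<eta> \<cdot>\<^bsub>?D\<^esub> inv_arrow ?D (pcomp F f e (iota F)))"
    by (simp add: y_def Mon_ob_def smu_hat_ar seta_hat_ar)
  show ?data
    by (simp add: y hat_tensor_ob hat_unit fm)
  let ?T = "lift f X \<odot>\<^bsub>E\<^esub> lift f X"
  have "ver N (fst (snd y)) \<cdot>\<^bsub>E\<^esub> lift n ?Q \<cdot>\<^bsub>E\<^esub> ?T =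
      ver N (pa F f \<mu>) \<cdot>\<^bsub>E\<^esub> ver N ?s1 \<cdot>\<^bsub>E\<^esub> ver N ?s2 \<cdot>\<^bsub>E\<^esub> ver N (pa F n ?s3) \<cdot>\<^bsub>E\<^esub> lift n ?Q \<cdot>\<^bsub>E\<^esub> ?T"
    by (simp add: y ver_cmp fm)
  also have "ver N (pa F n ?s3) \<cdot>\<^bsub>E\<^esub> lift n ?Q \<cdot>\<^bsub>E\<^esub> ?T = lift n (po F (f \<odot> f) ?P) \<cdot>\<^bsub>E\<^esub> lift (f \<odot> f) ?P"
    by (subst ver_pa_slide[where a = "N \<otimes> N" and Y = "po F (f \<odot> f) ?P"]) (simp_all add: ver_lax_2)
  also have "ver N ?s2 \<cdot>\<^bsub>E\<^esub> \<dots> = lift (f \<cdot> m) ?P"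
    by (simp add: ver_pcomp fm)
  also have "ver N ?s1 \<cdot>\<^bsub>E\<^esub> \<dots> = lift f (po F m ?P) \<cdot>\<^bsub>E\<^esub> lift m ?P"
    by (rule ver_inv_pcomp) simp_all
  also have "ver N (pa F f \<mu>) \<cdot>\<^bsub>E\<^esub> \<dots> = lift f X \<cdot>\<^bsub>E\<^esub> ver M \<mu> \<cdot>\<^bsub>E\<^esub> lift m ?P"
    by (subst ver_pa_slide[where a = M and Y = X]) simp_all
  finally show ?mult ..
  have "ver N (snd (snd y)) \<cdot>\<^bsub>E\<^esub> lift d (iota F) =
      ver N (pa F f \<eta>) \<cdot>\<^bsub>E\<^esub> ver N (inv_arrow ?D (pcomp F f e (iota F))) \<cdot>\<^bsub>E\<^esub> lift (f \<cdot> e) (iota F)"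
    by (simp add: y ver_cmp)
  also have "ver N (inv_arrow ?D (pcomp F f e (iota F))) \<cdot>\<^bsub>E\<^esub> lift (f \<cdot> e) (iota F) =
      lift f (po F e (iota F)) \<cdot>\<^bsub>E\<^esub> lift e (iota F)"
    by (rule ver_inv_pcomp) simp_all
  also have "ver N (pa F f \<eta>) \<cdot>\<^bsub>E\<^esub> \<dots> = lift f X \<cdot>\<^bsub>E\<^esub> ver M \<eta> \<cdot>\<^bsub>E\<^esub> lift e (iota F)"
    by (subst ver_pa_slide[where a = M and Y = X]) simp_all
  finally show ?unit ..
qed

lemma push_monoid_data:
  "\<lbrakk>monoid_data A a; monoid_data A b; is_monoid_morphism A a b f; monoid_data (hat_ob A F a) x\<rbrakk>
    \<Longrightarrow> monoid_data (hat_ob A F b) (push_monoid a b f x)"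
  using monoid_morphism_tot_aux(1) by (cases a; cases b; cases x) blast

lemma monoid_morphism_tot:
  assumes a: "monoid_data A a" and b: "monoid_data A b" and f: "is_monoid_morphism A a b f"
    and x: "monoid_data (hat_ob A F a) x" and y: "monoid_data (hat_ob A F b) y"
    and u: "u \<in> hom (fib F (fst b)) (po F f (fst x)) (fst y)"
  shows "is_monoid_morphism E (tot a x) (tot b y) (ver (fst b) u \<cdot>\<^bsub>E\<^esub> lift f (fst x)) \<longleftrightarrow>
    is_monoid_morphism (hat_ob A F b) (push_monoid a b f x) y u"
proof -
  obtain M m e where a': "a = (M, m, e)" by (cases a)
  obtain N n d where b': "b = (N, n, d)" by (cases b)
  obtain X \<mu> \<eta> where x': "x = (X, \<mu>, \<eta>)" by (cases x)
  obtain Y \<nu> \<theta> where y': "y = (Y, \<nu>, \<theta>)" by (cases y)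
  obtain \<mu>' \<eta>' where z': "push_monoid a b f x = (po F f X, \<mu>', \<eta>')"
    by (metis fst_conv fst_push_monoid prod.collapse x')
  note aux = monoid_morphism_tot_aux[OF a[unfolded a'] b[unfolded b'] f[unfolded a' b'] x[unfolded a' x'],
      folded a' b' x', unfolded z', simplified fst_conv snd_conv]
  note [simp] = hom_iff E_tensor_ob
  have [simp]: "M \<in> Ob A" "m \<in> Ar A" "Dom A m = M \<otimes> M" "Cod A m = M"
    "e \<in> Ar A" "Dom A e = unit_ob A" "Cod A e = M"
    "N \<in> Ob A" "n \<in> Ar A" "Dom A n = N \<otimes> N" "Cod A n = N"
    "d \<in> Ar A" "Dom A d = unit_ob A" "Cod A d = N"
    "f \<in> Ar A" "Dom A f = M" "Cod A f = N"
    using a b f by (auto simp: a' b')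
  let ?P = "lo F M M X X" and ?D = "fib F N" and ?Q = "lo F N N (po F f X) (po F f X)"
  have [simp]: "X \<in> Ob (fib F M)" "\<mu> \<in> Ar (fib F M)" "Dom (fib F M) \<mu> = po F m ?P" "Cod (fib F M) \<mu> = X"
    "\<eta> \<in> Ar (fib F M)" "Dom (fib F M) \<eta> = po F e (iota F)" "Cod (fib F M) \<eta> = X"
    "Y \<in> Ob ?D" "\<nu> \<in> Ar ?D" "Dom ?D \<nu> = po F n (lo F N N Y Y)" "Cod ?D \<nu> = Y"
    "\<theta> \<in> Ar ?D" "Dom ?D \<theta> = po F d (iota F)" "Cod ?D \<theta> = Y"
    "\<mu>' \<in> Ar ?D" "Dom ?D \<mu>' = po F n ?Q" "Cod ?D \<mu>' = po F f X"
    "\<eta>' \<in> Ar ?D" "Dom ?D \<eta>' = po F d (iota F)" "Cod ?D \<eta>' = po F f X"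
    "u \<in> Ar ?D" "Dom ?D u = po F f X" "Cod ?D u = Y"
    using x y u aux(1) by (auto simp: a' b' x' y' hat_tensor_ob hat_unit)
  let ?l = "lift f X"
  \<comment> \<open>The common opcartesian arrow of the two multiplication composites, starting at
    the tensor square of the source. For the units this role is taken by
    \<open>lift d (iota F)\<close>.\<close>
  let ?c = "lift n ?Q \<cdot>\<^bsub>E\<^esub> (?l \<odot>\<^bsub>E\<^esub> ?l)"
  let ?x = "ver N u \<cdot>\<^bsub>E\<^esub> ?l"
  have "?x \<cdot>\<^bsub>E\<^esub> (ver M \<mu> \<cdot>\<^bsub>E\<^esub> lift m ?P) = ver N (u \<cdot>\<^bsub>?D\<^esub> \<mu>') \<cdot>\<^bsub>E\<^esub> ?c"
    using aux(2) by (simp add: ver_cmp)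
  moreover have "(ver N \<nu> \<cdot>\<^bsub>E\<^esub> lift n (lo F N N Y Y)) \<cdot>\<^bsub>E\<^esub> (?x \<odot>\<^bsub>E\<^esub> ?x) =
      ver N (\<nu> \<cdot>\<^bsub>?D\<^esub> pa F n (la F N N u u)) \<cdot>\<^bsub>E\<^esub> ?c"
  proof -
    have "?x \<odot>\<^bsub>E\<^esub> ?x = ver (N \<otimes> N) (la F N N u u) \<cdot>\<^bsub>E\<^esub> (?l \<odot>\<^bsub>E\<^esub> ?l)"
      by (simp add: E.tensor_cmp ver_tensor_ver[symmetric])
    then show ?thesis
      using ver_pa_slide[of n "N \<otimes> N" N "la F N N u u" ?Q "lo F N N Y Y" "?l \<odot>\<^bsub>E\<^esub> ?l"]
      by (simp add: ver_cmp)
  qed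
  moreover have "?x \<cdot>\<^bsub>E\<^esub> (ver M \<eta> \<cdot>\<^bsub>E\<^esub> lift e (iota F)) = ver N (u \<cdot>\<^bsub>?D\<^esub> \<eta>') \<cdot>\<^bsub>E\<^esub> lift d (iota F)"
    using aux(3) by (simp add: ver_cmp)
  moreover have "ver N (u \<cdot>\<^bsub>?D\<^esub> \<mu>') \<cdot>\<^bsub>E\<^esub> ?c = ver N (\<nu> \<cdot>\<^bsub>?D\<^esub> pa F n (la F N N u u)) \<cdot>\<^bsub>E\<^esub> ?c \<longleftrightarrow>
      u \<cdot>\<^bsub>?D\<^esub> \<mu>' = \<nu> \<cdot>\<^bsub>?D\<^esub> pa F n (la F N N u u)"
    by (rule ver_opcartesian_eq[where Y = "po F n ?Q"])
      (simp_all add: opcartesian_cmp opcartesian_lift opcartesian_tensor)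
  moreover have "ver N (u \<cdot>\<^bsub>?D\<^esub> \<eta>') \<cdot>\<^bsub>E\<^esub> lift d (iota F) = ver N \<theta> \<cdot>\<^bsub>E\<^esub> lift d (iota F) \<longleftrightarrow>
      u \<cdot>\<^bsub>?D\<^esub> \<eta>' = \<theta>"
    by (rule ver_opcartesian_eq[where Y = "po F d (iota F)"]) (simp_all add: opcartesian_lift)
  moreover have "tot a x = ((M, X), ver M \<mu> \<cdot>\<^bsub>E\<^esub> lift m ?P, ver M \<eta> \<cdot>\<^bsub>E\<^esub> lift e (iota F))"
    "tot b y = ((N, Y), ver N \<nu> \<cdot>\<^bsub>E\<^esub> lift n (lo F N N Y Y), ver N \<theta> \<cdot>\<^bsub>E\<^esub> lift d (iota F))"
    using tot_eq a b x y unfolding a' b' x' y' by blast+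
  ultimately show ?thesis
    unfolding z' by (simp add: a' b' x' y' hat_tensor_ar del: E.assoc)
qed

text \<open>This is not the case of an identity in \<open>monoid_morphism_tot\<close>: there the
  source in the fibre would be the pushforward of \<open>x\<close> along the identity, which in
  general differs from \<open>x\<close>.\<close>

lemma monoid_morphism_ver:
  assumes a: "monoid_data A a"
    and x: "monoid_data (hat_ob A F a) x" and y: "monoid_data (hat_ob A F a) y"
    and u: "u \<in> hom (fib F (fst a)) (fst x) (fst y)"
  shows "is_monoid_morphism E (tot a x) (tot a y) (ver (fst a) u) \<longleftrightarrow>
    is_monoid_morphism (hat_ob A F a) x y u"
proof -
  obtain M m e where a': "a = (M, m, e)" by (cases a)
  obtain X \<mu> \<eta> where x': "x = (X, \<mu>, \<eta>)" by (cases x)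
  obtain Y \<nu> \<theta> where y': "y = (Y, \<nu>, \<theta>)" by (cases y)
  note [simp] = hom_iff E_tensor_ob
  have [simp]: "M \<in> Ob A" "m \<in> Ar A" "Dom A m = M \<otimes> M" "Cod A m = M"
    "e \<in> Ar A" "Dom A e = unit_ob A" "Cod A e = M"
    using a by (auto simp: a')
  let ?P = "lo F M M X X" and ?D = "fib F M"
  have [simp]: "X \<in> Ob ?D" "\<mu> \<in> Ar ?D" "Dom ?D \<mu> = po F m ?P" "Cod ?D \<mu> = X"
    "\<eta> \<in> Ar ?D" "Dom ?D \<eta> = po F e (iota F)" "Cod ?D \<eta> = X"
    "Y \<in> Ob ?D" "\<nu> \<in> Ar ?D" "Dom ?D \<nu> = po F m (lo F M M Y Y)" "Cod ?D \<nu> = Y"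
    "\<theta> \<in> Ar ?D" "Dom ?D \<theta> = po F e (iota F)" "Cod ?D \<theta> = Y"
    "u \<in> Ar ?D" "Dom ?D u = X" "Cod ?D u = Y"
    using x y u by (auto simp: a' x' y' hat_tensor_ob hat_unit)
  have "ver M u \<cdot>\<^bsub>E\<^esub> (ver M \<mu> \<cdot>\<^bsub>E\<^esub> lift m ?P) = ver M (u \<cdot>\<^bsub>?D\<^esub> \<mu>) \<cdot>\<^bsub>E\<^esub> lift m ?P"
    by (simp add: ver_cmp)
  moreover have "(ver M \<nu> \<cdot>\<^bsub>E\<^esub> lift m (lo F M M Y Y)) \<cdot>\<^bsub>E\<^esub> (ver M u \<odot>\<^bsub>E\<^esub> ver M u) =
      ver M (\<nu> \<cdot>\<^bsub>?D\<^esub> pa F m (la F M M u u)) \<cdot>\<^bsub>E\<^esub> lift m ?P"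
    by (simp add: ver_tensor_ver lift_cmp_ver ver_cmp)
  moreover have "ver M u \<cdot>\<^bsub>E\<^esub> (ver M \<eta> \<cdot>\<^bsub>E\<^esub> lift e (iota F)) = ver M (u \<cdot>\<^bsub>?D\<^esub> \<eta>) \<cdot>\<^bsub>E\<^esub> lift e (iota F)"
    by (simp add: ver_cmp)
  moreover have "ver M (u \<cdot>\<^bsub>?D\<^esub> \<mu>) \<cdot>\<^bsub>E\<^esub> lift m ?P = ver M (\<nu> \<cdot>\<^bsub>?D\<^esub> pa F m (la F M M u u)) \<cdot>\<^bsub>E\<^esub> lift m ?P \<longleftrightarrow>
      u \<cdot>\<^bsub>?D\<^esub> \<mu> = \<nu> \<cdot>\<^bsub>?D\<^esub> pa F m (la F M M u u)"
    by (rule ver_opcartesian_eq[where Y = "po F m ?P"]) (simp_all add: opcartesian_lift)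
  moreover have "ver M (u \<cdot>\<^bsub>?D\<^esub> \<eta>) \<cdot>\<^bsub>E\<^esub> lift e (iota F) = ver M \<theta> \<cdot>\<^bsub>E\<^esub> lift e (iota F) \<longleftrightarrow>
      u \<cdot>\<^bsub>?D\<^esub> \<eta> = \<theta>"
    by (rule ver_opcartesian_eq[where Y = "po F e (iota F)"]) (simp_all add: opcartesian_lift)
  moreover have "tot a x = ((M, X), ver M \<mu> \<cdot>\<^bsub>E\<^esub> lift m ?P, ver M \<eta> \<cdot>\<^bsub>E\<^esub> lift e (iota F))"
    "tot a y = ((M, Y), ver M \<nu> \<cdot>\<^bsub>E\<^esub> lift m (lo F M M Y Y), ver M \<theta> \<cdot>\<^bsub>E\<^esub> lift e (iota F))"
    using tot_eq a x y unfolding a' x' y' by blast+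
  ultimately show ?thesis
    by (simp add: a' x' y' hat_tensor_ar del: E.assoc)
qed

text \<open>The case of an identity fibre part in \<open>monoid_morphism_tot\<close>.\<close>

lemma monoid_morphism_lift:
  assumes "monoid_data A a" "monoid_data A b" "is_monoid_morphism A a b f" "monoid_data (hat_ob A F a) x"
  shows "is_monoid_morphism E (tot a x) (tot b (push_monoid a b f x)) (lift f (fst x))"
proof -
  have d: "monoid_data (hat_ob A F b) (push_monoid a b f x)"
    using assms by (rule push_monoid_data)
  have o: "fst b \<in> Ob A" "po F f (fst x) \<in> Ob (fib F (fst b))" "f \<in> Ar A" "Cod A f = fst b"
    "fst x \<in> Ob (fib F (Dom A f))"
    using assms by (cases a; cases b; cases x; auto simp: hom_iff)+
  have "is_monoid_morphism (hat_ob A F b) (push_monoid a b f x) (push_monoid a b f x)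
      (Idn (fib F (fst b)) (po F f (fst x)))"
    using tensor_category.monoid_data_idn[OF hat_tensor_category[OF assms(2)] d] by simp
  then have "is_monoid_morphism E (tot a x) (tot b (push_monoid a b f x))
      (ver (fst b) (Idn (fib F (fst b)) (po F f (fst x))) \<cdot>\<^bsub>E\<^esub> lift f (fst x))"
    using o by (subst monoid_morphism_tot) (use assms d in \<open>simp_all add: hom_iff\<close>)
  then show ?thesis using o by simp
qed

text \<open>The triple that the pushforward gives in \<open>E\<close> is the target of an
  opcartesian morphism out of a monoid, so it is a monoid by transport, and
  \<open>is_monoid_tot\<close> returns the axioms to the fibre over \<open>b\<close>.\<close>

lemma push_monoid_is_monoid:
  assumes "is_monoid A a" "is_monoid A b" "is_monoid_morphism A a b f" "is_monoid (hat_ob A F a) x"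
  shows "is_monoid (hat_ob A F b) (push_monoid a b f x)"
proof -
  have d: "monoid_data (hat_ob A F b) (push_monoid a b f x)"
    by (rule push_monoid_data) (use assms in \<open>simp_all only: is_monoid_data\<close>)
  have o: "f \<in> Ar A" "fst x \<in> Ob (fib F (Dom A f))"
    using assms by (cases a; cases b; cases x; auto simp: hom_iff)+
  have t: "is_monoid E (tot a x)"
    using is_monoid_tot[OF assms(1) is_monoid_data] assms(4) by simp
  have "is_monoid E (tot b (push_monoid a b f x))"
    by (rule is_monoid_opcartesian[OF opcartesian_lift[OF o] monoid_morphism_lift])
      (use assms d t in \<open>simp_all only: is_monoid_data\<close>)
  then show ?thesis using is_monoid_tot[OF assms(2) d] by simp
qed

section \<open>Pushforwards and coherence isomorphisms of \<open>F\<close> as morphisms of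
  monoids\<close>

declare is_monoid.simps [simp del] is_monoid_morphism.simps [simp del] monoid_data.simps [simp del]

lemma fst_tot [simp]: "fst (tot a x) = (fst a, fst x)"
  and base_mult_tot [simp]: "base (fst (snd (tot a x))) = fst (snd a)"
  and base_unit_tot [simp]: "base (snd (snd (tot a x))) = snd (snd a)"
  by (cases a; cases x; simp add: tot_def)+

lemma morphism_ar [simp]:
  assumes "is_monoid_morphism A a b f"
  shows "f \<in> Ar A" "Dom A f = fst a" "Cod A f = fst b"
  using monoid_morphism_hom[OF assms] by (auto simp: hom_iff)

lemma morphism_mult: "is_monoid_morphism A a b f \<Longrightarrow> f \<cdot> fst (snd a) = fst (snd b) \<cdot> (f \<odot> f)"
  by (cases a; cases b) (simp add: is_monoid_morphism.simps)

lemma hat_morphism_ar [simp]: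
  assumes "is_monoid_morphism (hat_ob A F a) x y u"
  shows "u \<in> Ar (fib F (fst a))" "Dom (fib F (fst a)) u = fst x" "Cod (fib F (fst a)) u = fst y"
  using monoid_morphism_hom[OF assms] by (auto simp: hom_iff)

lemma monoid_fst [simp]: "is_monoid A a \<Longrightarrow> fst a \<in> Ob A"
  by (rule is_monoid_fst)

lemma hat_monoid_fst [simp]: "is_monoid (hat_ob A F a) x \<Longrightarrow> fst x \<in> Ob (fib F (fst a))"
  using is_monoid_fst[of "hat_ob A F a" x] by simp

lemma tot_monoid: "\<lbrakk>is_monoid A a; is_monoid (hat_ob A F a) x\<rbrakk> \<Longrightarrow> is_monoid E (tot a x)"
  by (simp add: is_monoid_tot is_monoid_data)

lemma lift_morphism:
  assumes "is_monoid A a" "is_monoid A b" "is_monoid_morphism A a b f" "is_monoid (hat_ob A F a) x"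
  shows "is_monoid_morphism E (tot a x) (tot b (push_monoid a b f x)) (lift f (fst x))"
  by (rule monoid_morphism_lift) (use assms in \<open>simp_all only: is_monoid_data\<close>)

lemma ver_morphism:
  assumes "is_monoid A a" "is_monoid (hat_ob A F a) x" "is_monoid (hat_ob A F a) y"
    and "u \<in> Ar (fib F (fst a))" "Dom (fib F (fst a)) u = fst x" "Cod (fib F (fst a)) u = fst y"
  shows "is_monoid_morphism E (tot a x) (tot a y) (ver (fst a) u) \<longleftrightarrow>
    is_monoid_morphism (hat_ob A F a) x y u"
  by (rule monoid_morphism_ver) (use assms in \<open>simp_all add: is_monoid_data hom_iff\<close>)

text \<open>Composed with the lift of \<open>f\<close> at \<open>x\<close>, the vertical arrow of
  \<open>pa F f v\<close> equals the lift at \<open>y\<close> after the vertical arrow of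
  \<open>v\<close>, a composite of monoid morphisms. The opcartesian lift then cancels.\<close>

lemma push_monoid_morphism:
  assumes "is_monoid A a" "is_monoid A b" "is_monoid_morphism A a b f"
    and "is_monoid (hat_ob A F a) x" "is_monoid (hat_ob A F a) y" "is_monoid_morphism (hat_ob A F a) x y v"
  shows "is_monoid_morphism (hat_ob A F b) (push_monoid a b f x) (push_monoid a b f y) (pa F f v)"
proof -
  let ?x = "push_monoid a b f x" and ?y = "push_monoid a b f y"
  let ?h = "ver (fst b) (pa F f v)"
  have p: "is_monoid (hat_ob A F b) ?x" "is_monoid (hat_ob A F b) ?y"
    using assms by (simp_all add: push_monoid_is_monoid)
  note [simp] = assms(1-5) hat_morphism_ar[OF assms(6)] morphism_ar[OF assms(3)]
  have slide: "?h \<cdot>\<^bsub>E\<^esub> lift f (fst x) = lift f (fst y) \<cdot>\<^bsub>E\<^esub> ver (fst a) v"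
    by (simp add: lift_cmp_ver)
  have "is_monoid_morphism E (tot b ?x) (tot b ?y) ?h"
  proof (rule monoid_morphism_opcartesian)
    show "opcartesian (lift f (fst x))" by (rule opcartesian_lift) simp_all
    show "is_monoid_morphism E (tot a x) (tot b ?x) (lift f (fst x))"
      by (rule lift_morphism) simp_all
    show "is_monoid_morphism E (tot a x) (tot b ?y) (?h \<cdot>\<^bsub>E\<^esub> lift f (fst x))"
      unfolding slide
    proof (rule E.monoid_morphism_cmp)
      show "is_monoid_morphism E (tot a x) (tot a y) (ver (fst a) v)"
        using assms by (simp add: ver_morphism)
      show "is_monoid_morphism E (tot a y) (tot b ?y) (lift f (fst y))"
        by (rule lift_morphism) simp_all
    qed (use p in \<open>simp_all add: tot_monoid\<close>)
    show "?h \<in> hom E (fst (tot b ?x)) (fst (tot b ?y))"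
      by (simp add: hom_iff)
    \<comment> \<open>A vertical arrow has an identity as base, so this is the multiplicativity of
      the identity of \<open>b\<close>.\<close>
    show "base ?h \<cdot> base (fst (snd (tot b ?x))) = base (fst (snd (tot b ?y))) \<cdot> (base ?h \<odot> base ?h)"
      using morphism_mult[OF A.monoid_morphism_idn[OF assms(2)]] by simp
  qed (use p in \<open>simp_all add: tot_monoid is_monoid_data\<close>)
  then show ?thesis
    using p by (subst (asm) ver_morphism) simp_all
qed

text \<open>Composed with the two lifts, the component of \<open>pcomp\<close> becomes the single
  lift of \<open>g \<cdot> f\<close> by \<open>ver_pcomp\<close>, and lifts are monoid morphisms.
  The composite of the two lifts is opcartesian and cancels.\<close>

lemma pcomp_morphism:
  assumes "is_monoid A a" "is_monoid A b" "is_monoid A c" "is_monoid_morphism A a b f"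
    and "is_monoid_morphism A b c g" "is_monoid (hat_ob A F a) x"
  shows "is_monoid_morphism (hat_ob A F c) (push_monoid b c g (push_monoid a b f x))
    (push_monoid a c (g \<cdot> f) x) (pcomp F g f (fst x))"
proof -
  let ?y = "push_monoid a b f x" and ?z = "push_monoid b c g (push_monoid a b f x)"
  let ?w = "push_monoid a c (g \<cdot> f) x"
  let ?h = "ver (fst c) (pcomp F g f (fst x))"
  let ?c = "lift g (po F f (fst x)) \<cdot>\<^bsub>E\<^esub> lift f (fst x)"
  note [simp] = assms morphism_ar[OF assms(4)] morphism_ar[OF assms(5)]
  have gf [simp]: "is_monoid_morphism A a c (g \<cdot> f)"
    using assms A.monoid_morphism_cmp by blast
  have p [simp]: "is_monoid (hat_ob A F b) ?y" "is_monoid (hat_ob A F c) ?z" "is_monoid (hat_ob A F c) ?w"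
    by (simp_all add: push_monoid_is_monoid)
  have "is_monoid_morphism E (tot c ?z) (tot c ?w) ?h"
  proof (rule monoid_morphism_opcartesian)
    show "opcartesian ?c" by (intro opcartesian_cmp opcartesian_lift) simp_all
    show "is_monoid_morphism E (tot a x) (tot c ?z) ?c"
    proof (rule E.monoid_morphism_cmp)
      show "is_monoid_morphism E (tot a x) (tot b ?y) (lift f (fst x))"
        by (rule lift_morphism) simp_all
      show "is_monoid_morphism E (tot b ?y) (tot c ?z) (lift g (po F f (fst x)))"
        using lift_morphism[of b c g ?y] by simp
    qed (simp_all add: tot_monoid)
    show "is_monoid_morphism E (tot a x) (tot c ?w) (?h \<cdot>\<^bsub>E\<^esub> ?c)"
      by (subst ver_pcomp) (simp_all add: lift_morphism)
    show "?h \<in> hom E (fst (tot c ?z)) (fst (tot c ?w))"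
      by (simp add: hom_iff)
    show "base ?h \<cdot> base (fst (snd (tot c ?z))) = base (fst (snd (tot c ?w))) \<cdot> (base ?h \<odot> base ?h)"
      using morphism_mult[OF A.monoid_morphism_idn[OF assms(3)]] by simp
  qed (simp_all add: tot_monoid is_monoid_data)
  then show ?thesis
    by (subst (asm) ver_morphism) simp_all
qed

text \<open>By \<open>ver_punit\<close> the vertical arrow of this component is itself a lift, of
  the identity of \<open>a\<close>, so \<open>lift_morphism\<close> applies directly.\<close>

lemma punit_morphism:
  assumes "is_monoid A a" "is_monoid (hat_ob A F a) x"
  shows "is_monoid_morphism (hat_ob A F a) x (push_monoid a a (Idn A (fst a)) x) (punit F (fst a) (fst x))"
proof -
  note [simp] = assms A.monoid_morphism_idn
  have "is_monoid (hat_ob A F a) (push_monoid a a (Idn A (fst a)) x)"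
    by (simp add: push_monoid_is_monoid)
  moreover have "is_monoid_morphism E (tot a x) (tot a (push_monoid a a (Idn A (fst a)) x))
      (ver (fst a) (punit F (fst a) (fst x)))"
    by (simp add: ver_punit lift_morphism)
  ultimately show ?thesis
    by (subst (asm) ver_morphism) simp_all
qed

text \<open>The components of \<open>Mon_trans\<close> name their source through the composite
  strong monoidal functor, while iterated pushforward applies \<open>Mon_ob\<close> twice. The
  agreement on the nose, by functoriality of \<open>pa F g\<close> and associativity, is the
  strictness of \<open>Mon\<close> as a 2-functor.\<close>

lemma Mon_ob_comp:
  assumes "is_monoid A a" "is_monoid A b" "is_monoid A c" "is_monoid_morphism A a b f"
    and "is_monoid_morphism A b c g" "is_monoid (hat_ob A F a) x"
  shows "Mon_ob (hat_ob A F c) (comp_smfunct (hat_ob A F c) (hat_ar A F (b, c, g)) (hat_ar A F (a, b, f))) x =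
    push_monoid b c g (push_monoid a b f x)"
proof -
  obtain M m e where a: "a = (M, m, e)" by (cases a)
  obtain N n d where b: "b = (N, n, d)" by (cases b)
  obtain L l k where c: "c = (L, l, k)" by (cases c)
  obtain X \<mu> \<eta> where x: "x = (X, \<mu>, \<eta>)" by (cases x)
  note [simp] = hom_iff
  have [simp]: "M \<in> Ob A" "m \<in> Ar A" "Dom A m = M \<otimes> M" "Cod A m = M"
    "e \<in> Ar A" "Dom A e = unit_ob A" "Cod A e = M"
    "N \<in> Ob A" "n \<in> Ar A" "Dom A n = N \<otimes> N" "Cod A n = N"
    "d \<in> Ar A" "Dom A d = unit_ob A" "Cod A d = N"
    "L \<in> Ob A" "l \<in> Ar A" "Dom A l = L \<otimes> L" "Cod A l = L"
    "k \<in> Ar A" "Dom A k = unit_ob A" "Cod A k = L"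
    "f \<in> Ar A" "Dom A f = M" "Cod A f = N" "g \<in> Ar A" "Dom A g = N" "Cod A g = L"
    and eqs [simp]: "n \<cdot> (f \<odot> f) = f \<cdot> m" "f \<cdot> e = d" "l \<cdot> (g \<odot> g) = g \<cdot> n" "g \<cdot> d = k"
    using assms by (auto simp: a b c is_monoid.simps is_monoid_morphism.simps)
  have [simp]: "X \<in> Ob (fib F M)" "\<mu> \<in> Ar (fib F M)" "Dom (fib F M) \<mu> = po F m (lo F M M X X)"
    "Cod (fib F M) \<mu> = X"
    "\<eta> \<in> Ar (fib F M)" "Dom (fib F M) \<eta> = po F e (iota F)" "Cod (fib F M) \<eta> = X"
    using assms by (auto simp: a x is_monoid.simps hat_tensor_ob hat_unit)
  show ?thesis
    by (simp add: a b c x Mon_ob_def comp_smfunct_def comp_funct_def funct.defs smfunct.defs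
        smu_hat_ar seta_hat_ar hat_ar_sel[of "(M, m, e)"] hat_ar_sel[of "(N, n, d)"] pa_cmp)
qed

text \<open>The identity part of the strictness of \<open>Mon\<close>.\<close>

lemma Mon_ob_id:
  assumes "is_monoid A a" "is_monoid (hat_ob A F a) x"
  shows "Mon_ob (hat_ob A F a) (id_smfunct (hat_ob A F a)) x = x"
proof -
  interpret H: tensor_category "hat_ob A F a"
    by (rule hat_tensor_category) (use assms in \<open>simp add: is_monoid_data\<close>)
  show ?thesis
    using assms(2) by (cases x)
      (auto simp: is_monoid.simps Mon_ob_def id_smfunct_def id_funct_def funct.defs smfunct.defs hom_iff
        simp del: hat_sel)
qed

section \<open>The pseudofunctor of monoids in the fibres\<close>

abbreviation G where "G \<equiv> Mon_after (Mon A) (hat A F)"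

lemma G_fib [simp]: "fib G a = Mon (hat_ob A F a)"
  and G_po [simp]: "po G (a, b, f) = push_monoid a b f"
  and G_pa [simp]: "pa G (a, b, f) (x, y, v) = (push_monoid a b f x, push_monoid a b f y, pa F f v)"
  by (simp_all add: Mon_after_def hat_def Mon_funct_def)

lemma G_pcomp [simp]:
  assumes "is_monoid A a" "is_monoid A b" "is_monoid A c" "is_monoid_morphism A a b f"
    and "is_monoid_morphism A b c g" "is_monoid (hat_ob A F a) x"
  shows "pcomp G (b, c, g) (a, b, f) x =
    (push_monoid b c g (push_monoid a b f x), push_monoid a c (g \<cdot> f) x, pcomp F g f (fst x))"
  using assms by (simp add: Mon_after_def hat_def Mon_trans_def Mon_ob_comp)

lemma G_punit [simp]:
  assumes "is_monoid A a" "is_monoid (hat_ob A F a) x"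
  shows "punit G a x = (x, push_monoid a a (Idn A (fst a)) x, punit F (fst a) (fst x))"
  using assms by (simp add: Mon_after_def hat_def Mon_trans_def Mon_ob_id)

lemma Mon_hat_category: "is_monoid A a \<Longrightarrow> category (Mon (hat_ob A F a))"
  by (rule tensor_category.Mon_category, rule hat_tensor_category, rule is_monoid_data)

lemma Mon_hom_cases:
  assumes "h \<in> hom (Mon C) a b"
  obtains f where "h = (a, b, f)" "is_monoid C a" "is_monoid C b" "is_monoid_morphism C a b f"
  using assms by (cases h) (auto simp: hom_iff)

lemma G_push_functor:
  assumes "is_monoid A a" "is_monoid A b" "is_monoid_morphism A a b f"
  shows "is_functor (Mon (hat_ob A F a)) (Mon (hat_ob A F b)) (push G (a, b, f))"
proof (intro is_functor.intro is_functor_axioms.intro Mon_hat_category assms)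
  note [simp] = assms morphism_ar[OF assms(3)] push_monoid_is_monoid push_monoid_morphism
  show "x \<in> Ob (Mon (hat_ob A F a)) \<Longrightarrow> po G (a, b, f) x \<in> Ob (Mon (hat_ob A F b))" for x
    by simp
  show "v \<in> hom (Mon (hat_ob A F a)) x y \<Longrightarrow>
      pa G (a, b, f) v \<in> hom (Mon (hat_ob A F b)) (po G (a, b, f) x) (po G (a, b, f) y)" for v x y
    by (erule Mon_hom_cases) (simp add: hom_iff)
  show "x \<in> Ob (Mon (hat_ob A F a)) \<Longrightarrow>
      pa G (a, b, f) (Idn (Mon (hat_ob A F a)) x) = Idn (Mon (hat_ob A F b)) (po G (a, b, f) x)" for x
    by simp
  show "v \<in> hom (Mon (hat_ob A F a)) x y \<Longrightarrow> w \<in> hom (Mon (hat_ob A F a)) y z \<Longrightarrow>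
      pa G (a, b, f) (w \<cdot>\<^bsub>Mon (hat_ob A F a)\<^esub> v) =
      pa G (a, b, f) w \<cdot>\<^bsub>Mon (hat_ob A F b)\<^esub> pa G (a, b, f) v" for v w x y z
    by (elim Mon_hom_cases) (simp add: pa_cmp[where a = "fst a" and b = "fst b"])
qed

lemma G_iso:
  assumes "is_monoid A a" "is_monoid (hat_ob A F a) x" "is_monoid (hat_ob A F a) y"
    and "is_monoid_morphism (hat_ob A F a) x y u" "iso_arrow (fib F (fst a)) u"
  shows "iso_arrow (Mon (hat_ob A F a)) (x, y, u)"
    "inv_arrow (Mon (hat_ob A F a)) (x, y, u) = (y, x, inv_arrow (fib F (fst a)) u)"
proof -
  have "inverse_arrows (Mon (hat_ob A F a)) (x, y, u) (y, x, inv_arrow (hat_ob A F a) u)"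
    by (rule tensor_category.Mon_inverse[OF hat_tensor_category])
      (use assms in \<open>simp_all add: is_monoid_data\<close>)
  then show "iso_arrow (Mon (hat_ob A F a)) (x, y, u)"
    "inv_arrow (Mon (hat_ob A F a)) (x, y, u) = (y, x, inv_arrow (fib F (fst a)) u)"
    using category.inv_eqI[OF Mon_hat_category[OF assms(1)]]
    by (auto simp: iso_arrow_def simp del: split_paired_Ex)
qed

text \<open>An arrow of \<open>Mon\<close> is determined by its end points and its underlying arrow,
  so naturality and the coherence laws of \<open>G\<close> reduce to those of \<open>F\<close>. What
  must be supplied beyond this is that the arrows involved are monoid morphisms.\<close>

lemma G_pseudofunctor: "pseudofunctor (Mon A) G"
proof (intro pseudofunctor.intro pseudofunctor_axioms.intro A.Mon_category)
  note [simp] = push_monoid_is_monoid push_monoid_morphism pcomp_morphism punit_morphism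
    A.monoid_morphism_idn
  have cmp [simp]: "is_monoid_morphism A a c (g \<cdot> f)"
    if "is_monoid_morphism A a b f" "is_monoid_morphism A b c g" "is_monoid A a" "is_monoid A b" "is_monoid A c"
    for a b c f g
    using that A.monoid_morphism_cmp by blast
  show "a \<in> Ob (Mon A) \<Longrightarrow> category (fib G a)" for a
    by (simp add: Mon_hat_category)
  show "f \<in> hom (Mon A) a b \<Longrightarrow> is_functor (fib G a) (fib G b) (push G f)" for f a b
    by (erule Mon_hom_cases) (simp add: G_push_functor)
  show "nat_iso (fib G a) (fib G c) (push G g' \<circ>\<^sub>F push G f') (push G (g' \<cdot>\<^bsub>Mon A\<^esub> f')) (pcomp G g' f')"
    if f': "f' \<in> hom (Mon A) a b" and g': "g' \<in> hom (Mon A) b c" for f' g' a b c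
  proof -
    obtain f where f: "f' = (a, b, f)" "is_monoid A a" "is_monoid A b" "is_monoid_morphism A a b f"
      using f' by (rule Mon_hom_cases)
    obtain g where g: "g' = (b, c, g)" "is_monoid A c" "is_monoid_morphism A b c g"
      using g' by (rule Mon_hom_cases)
    note [simp] = f g morphism_ar[OF f(4)] morphism_ar[OF g(3)]
    note gf [simp] = cmp[OF f(4) g(3) f(2) f(3) g(2)]
    show ?thesis
    proof (intro nat_iso.intro nat_iso_axioms.intro)
      show "is_functor (fib G a) (fib G c) (push G g' \<circ>\<^sub>F push G f')"
        using comp_is_functor[OF G_push_functor G_push_functor] by simp
      show "is_functor (fib G a) (fib G c) (push G (g' \<cdot>\<^bsub>Mon A\<^esub> f'))"
        using G_push_functor[of a c "g \<cdot> f"] by simp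
      show "x \<in> Ob (fib G a) \<Longrightarrow> pcomp G g' f' x \<in>
          hom (fib G c) (obj_map (push G g' \<circ>\<^sub>F push G f') x) (po G (g' \<cdot>\<^bsub>Mon A\<^esub> f') x)" for x
        by (simp add: comp_funct_def hom_iff)
      show "x \<in> Ob (fib G a) \<Longrightarrow> iso_arrow (fib G c) (pcomp G g' f' x)" for x
        by (simp add: G_iso)
      show "v \<in> hom (fib G a) x y \<Longrightarrow> pcomp G g' f' y \<cdot>\<^bsub>fib G c\<^esub> arr_map (push G g' \<circ>\<^sub>F push G f') v =
          pa G (g' \<cdot>\<^bsub>Mon A\<^esub> f') v \<cdot>\<^bsub>fib G c\<^esub> pcomp G g' f' x" for v x y
        unfolding G_fib by (erule Mon_hom_cases)
          (simp add: comp_funct_def pcomp_natural[where a = "fst a" and c = "fst c"])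
    qed
  qed
  show "nat_iso (fib G a) (fib G a) id_funct (push G (Idn (Mon A) a)) (punit G a)"
    if "a \<in> Ob (Mon A)" for a
  proof -
    have a [simp]: "is_monoid A a" using that by simp
    show ?thesis
    proof (intro nat_iso.intro nat_iso_axioms.intro)
      show "is_functor (fib G a) (fib G a) id_funct"
        by (simp add: id_is_functor Mon_hat_category)
      show "is_functor (fib G a) (fib G a) (push G (Idn (Mon A) a))"
        using G_push_functor[of a a "Idn A (fst a)"] by simp
      show "x \<in> Ob (fib G a) \<Longrightarrow> punit G a x \<in>
          hom (fib G a) (obj_map id_funct x) (po G (Idn (Mon A) a) x)" for x
        by (simp add: id_funct_def hom_iff)
      show "x \<in> Ob (fib G a) \<Longrightarrow> iso_arrow (fib G a) (punit G a x)" for x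
        by (simp add: G_iso)
      show "v \<in> hom (fib G a) x y \<Longrightarrow> punit G a y \<cdot>\<^bsub>fib G a\<^esub> arr_map id_funct v =
          pa G (Idn (Mon A) a) v \<cdot>\<^bsub>fib G a\<^esub> punit G a x" for v x y
        unfolding G_fib by (erule Mon_hom_cases)
          (simp add: id_funct_def punit_natural[where a = "fst a"])
    qed
  qed
  show "pcomp G (h \<cdot>\<^bsub>Mon A\<^esub> g) f x \<cdot>\<^bsub>fib G d\<^esub> pcomp G h g (po G f x) =
      pcomp G h (g \<cdot>\<^bsub>Mon A\<^esub> f) x \<cdot>\<^bsub>fib G d\<^esub> pa G h (pcomp G g f x)"
    if fgh: "f \<in> hom (Mon A) a b" "g \<in> hom (Mon A) b c" "h \<in> hom (Mon A) c d" and x': "x \<in> Ob (fib G a)"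
    for f g h a b c d x
  proof -
    obtain f' where f: "f = (a, b, f')" "is_monoid A a" "is_monoid A b" "is_monoid_morphism A a b f'"
      using fgh(1) by (rule Mon_hom_cases)
    obtain g' where g: "g = (b, c, g')" "is_monoid A c" "is_monoid_morphism A b c g'"
      using fgh(2) by (rule Mon_hom_cases)
    obtain h' where h: "h = (c, d, h')" "is_monoid A d" "is_monoid_morphism A c d h'"
      using fgh(3) by (rule Mon_hom_cases)
    have x [simp]: "is_monoid (hat_ob A F a) x" using x' by simp
    note [simp] = f g h morphism_ar[OF f(4)] morphism_ar[OF g(3)] morphism_ar[OF h(3)]
    note [simp] = cmp[OF f(4) g(3) f(2) f(3) g(2)] cmp[OF g(3) h(3) f(3) g(2) h(2)]
    have [simp]: "is_monoid_morphism A a d (h' \<cdot> g' \<cdot> f')"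
      using cmp[of a c "g' \<cdot> f'" d h'] by simp
    show ?thesis
      using pcomp_assoc[of f' "fst a" "fst b" g' "fst c" h' "fst d" "fst x"] by (simp add: hom_iff)
  qed
  show "pcomp G f (Idn (Mon A) a) x \<cdot>\<^bsub>fib G b\<^esub> pa G f (punit G a x) = Idn (fib G b) (po G f x)"
    if f': "f \<in> hom (Mon A) a b" and x: "x \<in> Ob (fib G a)" for f a b x
  proof -
    obtain f' where f: "f = (a, b, f')" "is_monoid A a" "is_monoid A b" "is_monoid_morphism A a b f'"
      using f' by (rule Mon_hom_cases)
    note [simp] = f morphism_ar[OF f(4)]
    show ?thesis
      using x pcomp_punit_right[of f' "fst a" "fst b" "fst x"] by (simp add: hom_iff)
  qed
  show "pcomp G (Idn (Mon A) b) f x \<cdot>\<^bsub>fib G b\<^esub> punit G b (po G f x) = Idn (fib G b) (po G f x)"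
    if f': "f \<in> hom (Mon A) a b" and x: "x \<in> Ob (fib G a)" for f a b x
  proof -
    obtain f' where f: "f = (a, b, f')" "is_monoid A a" "is_monoid A b" "is_monoid_morphism A a b f'"
      using f' by (rule Mon_hom_cases)
    note [simp] = f morphism_ar[OF f(4)]
    show ?thesis
      using x pcomp_punit_left[of f' "fst a" "fst b" "fst x"] by (simp add: hom_iff)
  qed
qed

section \<open>Monoids and morphisms of the total category in terms of base and fibres\<close>

lemma monoid_E_cases:
  assumes "is_monoid E p"
  obtains a x where "p = tot a x" "is_monoid A a" "is_monoid (hat_ob A F a) x"
proof -
  obtain a x where p: "p = tot a x"
    using assms by (metis is_monoid_data monoid_data_is_tot)
  have a: "is_monoid A a" using assms is_monoid_base by (simp add: p)
  have "monoid_data (hat_ob A F a) x"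
    using is_monoid_data[OF assms] by (simp add: p monoid_data_tot)
  then have "is_monoid (hat_ob A F a) x" using assms is_monoid_tot[OF a] by (simp add: p)
  with p a show ?thesis by (rule that)
qed

text \<open>The projection is strict monoidal, so \<open>base\<close> carries the conditions for
  multiplication and unit to \<open>A\<close> unchanged.\<close>

lemma monoid_morphism_base:
  assumes "is_monoid_morphism E (tot a x) (tot b y) h"
  shows "is_monoid_morphism A a b (base h)"
proof -
  obtain M m e where p: "tot a x = (M, m, e)" by (cases "tot a x")
  obtain N n d where q: "tot b y = (N, n, d)" by (cases "tot b y")
  have a: "a = (fst M, base m, base e)" "b = (fst N, base n, base d)"
    using fst_tot[of a x] base_mult_tot[of a x] base_unit_tot[of a x]
      fst_tot[of b y] base_mult_tot[of b y] base_unit_tot[of b y] by (simp_all add: p q)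
  have h: "h \<in> hom E M N" "h \<cdot>\<^bsub>E\<^esub> m = n \<cdot>\<^bsub>E\<^esub> (h \<odot>\<^bsub>E\<^esub> h)" "h \<cdot>\<^bsub>E\<^esub> e = d"
    using assms by (simp_all add: p q is_monoid_morphism.simps)
  have "base h \<in> hom A (fst M) (fst N)"
    using h(1) by (cases h rule: groth_arr_exhaust) (auto simp: hom_iff E_ar)
  then show ?thesis
    using h(2,3)[THEN arg_cong[where f = base]] by (simp add: a is_monoid_morphism.simps)
qed

text \<open>The right side describes a hom set in the Grothendieck construction of \<open>G\<close>.
  The condition on \<open>f\<close> is extracted first, because \<open>monoid_morphism_tot\<close>
  speaks of arrows over monoid morphisms.\<close>

lemma monoid_morphism_E_iff:
  assumes "is_monoid A a" "is_monoid A b" "is_monoid (hat_ob A F a) x" "is_monoid (hat_ob A F b) y"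
  shows "is_monoid_morphism E (tot a x) (tot b y) (p, q, (f, u)) \<longleftrightarrow>
    p = (fst a, fst x) \<and> q = (fst b, fst y) \<and> is_monoid_morphism A a b f \<and>
    is_monoid_morphism (hat_ob A F b) (push_monoid a b f x) y u"
proof -
  let ?h = "((fst a, fst x), (fst b, fst y), (f, u))"
  have main: "is_monoid_morphism E (tot a x) (tot b y) ?h \<longleftrightarrow>
      is_monoid_morphism (hat_ob A F b) (push_monoid a b f x) y u"
    if f: "is_monoid_morphism A a b f" and u: "u \<in> hom (fib F (fst b)) (po F f (fst x)) (fst y)"
  proof -
    have "?h = ver (fst b) u \<cdot>\<^bsub>E\<^esub> lift f (fst x)"
      using u assms by (simp add: ver_cmp_lift morphism_ar[OF f] hom_iff)
    then show ?thesis
      using monoid_morphism_tot[of a b f x y u] assms f u by (simp add: is_monoid_data)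
  qed
  show ?thesis
  proof
    assume h: "is_monoid_morphism E (tot a x) (tot b y) (p, q, (f, u))"
    then have "(p, q, (f, u)) \<in> hom E (fst a, fst x) (fst b, fst y)"
      using monoid_morphism_hom[OF h] by simp
    then have pq: "p = (fst a, fst x)" "q = (fst b, fst y)"
        "u \<in> hom (fib F (fst b)) (po F f (fst x)) (fst y)"
      by (auto simp: hom_iff E_ar)
    moreover have "is_monoid_morphism A a b f"
      using monoid_morphism_base[OF h] by simp
    ultimately show "p = (fst a, fst x) \<and> q = (fst b, fst y) \<and> is_monoid_morphism A a b f \<and>
        is_monoid_morphism (hat_ob A F b) (push_monoid a b f x) y u"
      using h main by simp
  next
    assume h: "p = (fst a, fst x) \<and> q = (fst b, fst y) \<and> is_monoid_morphism A a b f \<and>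
        is_monoid_morphism (hat_ob A F b) (push_monoid a b f x) y u"
    then have "u \<in> hom (fib F (fst b)) (po F f (fst x)) (fst y)"
      using hat_morphism_ar[of b "push_monoid a b f x" y u] by (simp add: hom_iff)
    then show "is_monoid_morphism E (tot a x) (tot b y) (p, q, (f, u))"
      using h main by simp
  qed
qed

section \<open>The induced functor on monoids and the comparison isomorphism\<close>

abbreviation P where "P \<equiv> monoidal_groth_proj A"

lemma Mon_ob_proj:
  assumes "is_monoid A a"
  shows "Mon_ob A P (tot a x) = a"
  using assms by (cases a; cases x)
    (auto simp: is_monoid.simps hom_iff Mon_ob_def tot_def monoidal_groth_proj_def groth_proj_def
      funct.defs smfunct.defs E_unit)

lemma arr_map_proj: "arr_map P h = base h"
  by (cases h rule: groth_arr_exhaust) (simp add: monoidal_groth_proj_def groth_proj_def funct.defs smfunct.defs)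

lemma Mon_E_category: "category (Mon E)"
  by (rule E.Mon_category)

lemma Mon_E_hom_cases:
  assumes "h \<in> hom (Mon E) p q"
  obtains a x b y f u where "p = tot a x" "q = tot b y"
    "h = (tot a x, tot b y, ((fst a, fst x), (fst b, fst y), (f, u)))"
    "is_monoid A a" "is_monoid A b" "is_monoid (hat_ob A F a) x" "is_monoid (hat_ob A F b) y"
    "is_monoid_morphism A a b f" "is_monoid_morphism (hat_ob A F b) (push_monoid a b f x) y u"
proof -
  obtain h' where h: "h = (p, q, h')" "is_monoid E p" "is_monoid E q" "is_monoid_morphism E p q h'"
    using assms by (rule Mon_hom_cases)
  obtain r s f u where h': "h' = (r, s, (f, u))" by (cases h' rule: groth_arr_exhaust)
  obtain a x where p: "p = tot a x" "is_monoid A a" "is_monoid (hat_ob A F a) x"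
    using h(2) by (rule monoid_E_cases)
  obtain b y where q: "q = tot b y" "is_monoid A b" "is_monoid (hat_ob A F b) y"
    using h(3) by (rule monoid_E_cases)
  show ?thesis
    using h p q by (intro that[of a x b y f u]) (auto simp: h' monoid_morphism_E_iff)
qed

lemma Mon_P_functor: "is_functor (Mon E) (Mon A) (Mon_funct A P)"
proof (intro is_functor.intro is_functor_axioms.intro A.Mon_category Mon_E_category)
  show "p \<in> Ob (Mon E) \<Longrightarrow> obj_map (Mon_funct A P) p \<in> Ob (Mon A)" for p
    by (auto simp: Mon_funct_def Mon_ob_proj elim!: monoid_E_cases)
  show "h \<in> hom (Mon E) p q \<Longrightarrow> arr_map (Mon_funct A P) h \<in>
      hom (Mon A) (obj_map (Mon_funct A P) p) (obj_map (Mon_funct A P) q)" for h p q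
    by (erule Mon_E_hom_cases) (simp add: Mon_funct_def Mon_ob_proj hom_iff arr_map_proj)
  show "p \<in> Ob (Mon E) \<Longrightarrow> arr_map (Mon_funct A P) (Idn (Mon E) p) =
      Idn (Mon A) (obj_map (Mon_funct A P) p)" for p
    by (auto simp: Mon_funct_def Mon_ob_proj arr_map_proj elim!: monoid_E_cases)
  show "arr_map (Mon_funct A P) (k \<cdot>\<^bsub>Mon E\<^esub> h) =
      arr_map (Mon_funct A P) k \<cdot>\<^bsub>Mon A\<^esub> arr_map (Mon_funct A P) h"
    if "h \<in> hom (Mon E) p q" "k \<in> hom (Mon E) q r" for h k p q r
    using that by (elim Mon_hom_cases) (simp add: Mon_funct_def arr_map_proj)
qed

text \<open>A left inverse of \<open>tot\<close> that merely selects tuple entries. As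
  \<open>tot\<close> stores raw tuples, \<open>untot_tot\<close> holds for all arguments, and
  \<open>regroup\<close> can be defined on all triples.\<close>

definition untot :: "('o \<times> 'x, ('o, 'a, 'x, 'y) groth_arr) monoid \<Rightarrow> ('o, 'a) monoid \<times> ('x, 'y) monoid" where
  "untot p = ((fst (fst p), base (fst (snd p)), base (snd (snd p))),
     (snd (fst p), snd (snd (snd (fst (snd p)))), snd (snd (snd (snd (snd p))))))"

lemma untot_tot [simp]: "untot (tot a x) = (a, x)"
  by (cases a; cases x) (simp add: untot_def tot_def)

lemma tot_inject: "tot a x = tot b y \<longleftrightarrow> a = b \<and> x = y"
  using untot_tot by (metis prod.inject)

text \<open>The base arrow \<open>f\<close> and the fibre arrow \<open>u\<close> are kept. Since
  arrows of \<open>Mon\<close> carry their end points, the fibre arrow must also be given its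
  source, the pushforward along \<open>f\<close>.\<close>

definition regroup where
  "regroup = \<lparr>obj_map = untot, arr_map = (\<lambda>(p, q, (_, _, (f, u))).
     (untot p, untot q, ((fst (untot p), fst (untot q), f),
       (push_monoid (fst (untot p)) (fst (untot q)) f (snd (untot p)), snd (untot q), u))))\<rparr>"

definition ungroup where
  "ungroup = \<lparr>obj_map = (\<lambda>(a, x). tot a x), arr_map = (\<lambda>((a, x), (b, y), ((_, _, f), (_, _, u))).
     (tot a x, tot b y, ((fst a, fst x), (fst b, fst y), (f, u))))\<rparr>"

interpretation G: groth_category "Mon A" G "grothendieck (Mon A) G"
  by (intro groth_category.intro G_pseudofunctor groth_category_axioms.intro) simp_all

text \<open>Both Grothendieck constructions compose by the same formula. The one over
  \<open>Mon A\<close> uses inverses of \<open>pcomp G\<close> and \<open>punit G\<close>, and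
  \<open>G_iso\<close> computes them from the inverses in the fibres of \<open>F\<close>, so the two
  formulas agree literally.\<close>

lemma regroup_functor: "is_functor (Mon E) (grothendieck (Mon A) G) regroup"
proof (intro is_functor.intro is_functor_axioms.intro Mon_E_category G.E_category)
  note [simp] = push_monoid_is_monoid pcomp_morphism punit_morphism A.monoid_morphism_idn
  show "p \<in> Ob (Mon E) \<Longrightarrow> obj_map regroup p \<in> Ob (grothendieck (Mon A) G)" for p
    by (auto simp: regroup_def elim!: monoid_E_cases)
  show "h \<in> hom (Mon E) p q \<Longrightarrow> arr_map regroup h \<in>
      hom (grothendieck (Mon A) G) (obj_map regroup p) (obj_map regroup q)" for h p q
    by (erule Mon_E_hom_cases) (simp add: regroup_def hom_iff G.E_ar)
  show "arr_map regroup (Idn (Mon E) p) = Idn (grothendieck (Mon A) G) (obj_map regroup p)"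
    if "p \<in> Ob (Mon E)" for p
  proof -
    have "is_monoid E p" using that by simp
    then obtain a x where p: "p = tot a x" "is_monoid A a" "is_monoid (hat_ob A F a) x"
      by (rule monoid_E_cases)
    then show ?thesis by (simp add: regroup_def E_idn G.E_idn G_iso)
  qed
  show "arr_map regroup (k \<cdot>\<^bsub>Mon E\<^esub> h) =
      arr_map regroup k \<cdot>\<^bsub>grothendieck (Mon A) G\<^esub> arr_map regroup h"
    if h: "h \<in> hom (Mon E) p q" and k: "k \<in> hom (Mon E) q r" for h k p q r
  proof -
    obtain a x b y f u where h': "p = tot a x" "q = tot b y"
      "h = (tot a x, tot b y, ((fst a, fst x), (fst b, fst y), (f, u)))"
      "is_monoid A a" "is_monoid A b" "is_monoid (hat_ob A F a) x" "is_monoid (hat_ob A F b) y"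
      "is_monoid_morphism A a b f" "is_monoid_morphism (hat_ob A F b) (push_monoid a b f x) y u"
      using h by (rule Mon_E_hom_cases)
    obtain b' y' c z g v where k': "q = tot b' y'" "r = tot c z"
      "k = (tot b' y', tot c z, ((fst b', fst y'), (fst c, fst z), (g, v)))"
      "is_monoid A c" "is_monoid (hat_ob A F c) z"
      "is_monoid_morphism A b' c g" "is_monoid_morphism (hat_ob A F c) (push_monoid b' c g y') z v"
      using k by (rule Mon_E_hom_cases)
    \<comment> \<open>The middle monoid \<open>q\<close> has been decomposed twice, from
      \<open>h\<close> and from \<open>k\<close>; injectivity of \<open>tot\<close> identifies the
      results.\<close>
    have e [simp]: "b' = b" "y' = y"
      using h'(2) k'(1) by (simp_all add: tot_inject)
    have gf [simp]: "is_monoid_morphism A a c (g \<cdot> f)"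
      using A.monoid_morphism_cmp h' k' by simp
    note [simp] = h'(4-) k'(4-)[unfolded e] morphism_ar[OF h'(8)] morphism_ar[OF k'(6)[unfolded e]]
    show ?thesis
      by (simp add: h'(3) k'(3) regroup_def E_cmp G.E_cmp G_iso)
  qed
qed

lemma regroup_iso: "iso_of_categories (Mon E) (grothendieck (Mon A) G) regroup"
proof -
  have ob: "obj_map ungroup p \<in> Ob (Mon E) \<and> obj_map regroup (obj_map ungroup p) = p"
    if "p \<in> Ob (grothendieck (Mon A) G)" for p
    using that by (cases p) (simp add: ungroup_def regroup_def tot_monoid)
  have ar: "arr_map ungroup h \<in> Ar (Mon E) \<and> arr_map regroup (arr_map ungroup h) = h"
    if h0: "h \<in> Ar (grothendieck (Mon A) G)" for h
  proof -
    obtain a x b y f' u' where h: "h = ((a, x), (b, y), (f', u'))" by (cases h rule: groth_arr_exhaust)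
    obtain f where f: "f' = (a, b, f)" "is_monoid A a" "is_monoid A b" "is_monoid_morphism A a b f"
      using h0 by (cases f') (auto simp: h G.E_ar)
    obtain u where u: "u' = (push_monoid a b f x, y, u)" "is_monoid (hat_ob A F a) x"
      "is_monoid (hat_ob A F b) y" "is_monoid_morphism (hat_ob A F b) (push_monoid a b f x) y u"
      using h0 by (cases u') (auto simp: h f G.E_ar)
    show ?thesis
      using f u by (simp add: h ungroup_def regroup_def tot_monoid monoid_morphism_E_iff)
  qed
  have ob': "obj_map ungroup (obj_map regroup p) = p" if "p \<in> Ob (Mon E)" for p
    using that by (auto simp: ungroup_def regroup_def elim!: monoid_E_cases)
  have ar': "arr_map ungroup (arr_map regroup h) = h" if "h \<in> Ar (Mon E)" for h
  proof -
    have "h \<in> hom (Mon E) (Dom (Mon E) h) (Cod (Mon E) h)" using that by (simp add: hom_iff)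
    then show ?thesis
      by (rule Mon_E_hom_cases) (simp add: ungroup_def regroup_def)
  qed
  have "is_functor (grothendieck (Mon A) G) (Mon E) ungroup"
    using regroup_functor ob ar ob' ar' by (rule inverse_is_functor)
  moreover have "funct_eq_on (Mon E) (ungroup \<circ>\<^sub>F regroup) id_funct"
    unfolding funct_eq_on_def by (intro conjI ballI) (simp_all add: comp_funct_def id_funct_def ob' ar')
  moreover have "funct_eq_on (grothendieck (Mon A) G) (regroup \<circ>\<^sub>F ungroup) id_funct"
    unfolding funct_eq_on_def by (intro conjI ballI) (simp_all add: comp_funct_def id_funct_def ob ar)
  ultimately show ?thesis
    unfolding iso_of_categories_def using regroup_functor by blast
qed

lemma Mon_P_is_grothendieck: "is_grothendieck_construction_of (Mon A) (Mon E) (Mon_funct A P) G"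
proof -
  have "funct_eq_on (Mon E) (groth_proj \<circ>\<^sub>F regroup) (Mon_funct A P)"
    unfolding funct_eq_on_def
  proof (intro conjI ballI)
    show "obj_map (groth_proj \<circ>\<^sub>F regroup) p = obj_map (Mon_funct A P) p" if "p \<in> Ob (Mon E)" for p
      using that by (auto simp: comp_funct_def groth_proj_def regroup_def Mon_funct_def Mon_ob_proj
          elim!: monoid_E_cases)
    show "arr_map (groth_proj \<circ>\<^sub>F regroup) h = arr_map (Mon_funct A P) h" if "h \<in> Ar (Mon E)" for h
    proof -
      have "h \<in> hom (Mon E) (Dom (Mon E) h) (Cod (Mon E) h)" using that by (simp add: hom_iff)
      then show ?thesis
        by (rule Mon_E_hom_cases) (simp add: comp_funct_def groth_proj_def regroup_def Mon_funct_def
            Mon_ob_proj arr_map_proj)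
    qed
  qed
  then show ?thesis
    unfolding is_grothendieck_construction_of_def
    using G_pseudofunctor Mon_P_functor regroup_iso by blast
qed

end

theorem theorem7p5:
  fixes A :: "('o, 'a) moncat"
    and F :: "('o, 'a, 'x, 'y) laxpsfun"
    and E :: "('o \<times> 'x, ('o, 'a, 'x, 'y) groth_arr) moncat"
    and P :: "('o \<times> 'x, ('o, 'a, 'x, 'y) groth_arr, 'o, 'a) smfunct"
  assumes "monoidal_category A"
    and "weakly_lax_monoidal_pseudofunctor A F"
    and "E = monoidal_grothendieck A F"
    and "P = monoidal_groth_proj A"
  shows "is_grothendieck_construction_of (Mon A) (Mon E) (Mon_funct A P)
    (Mon_after (Mon A) (hat A F))"
  unfolding assms(3,4)
  using assms(2) by (rule weakly_lax_monoidal_pseudofunctor.Mon_P_is_grothendieck)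

end
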